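(* Let $n\ge2$, $\lambda=(\lambda_1,\lambda_2)\in\mathbb R^2$, $\mu\in\mathbb R$ and $\delta=\mu-\lambda_1-\lambda_2$. If $\delta$ is not resonant, there exists a unique $sl_{n+1}$-equivariant symbol map $\sigma_{\lambda,\mu}:\mathcal M^2_{\mathit{diff}}(\lambda,\mu)\to\mathcal S^{(2)}_\delta$. It is a differential operator.
   Context: Everything is smooth; $x^1,\dots,x^n$ are the coordinates of $\mathbb R^n$, $\partial_i=\partial/\partial x^i$. For $\lambda\in\mathbb R$, densities of weight $\lambda$ are sections of the trivial line bundle $\Delta^\lambda(\mathbb R^n)$, identified with functions $\phi$ with $L_X\phi=\sum_iX^i\partial_i\phi+\lambda(\sum_i\partial_iX^i)\phi$. Bidifferential operators: $\mathcal M^2_{\mathit{diff}}(\lambda,\mu)$ is the space of bidifferential operators $T:(f,g)\mapsto\sum A_{a,b}D^afD^bg$ (finite sums, $a,b$ multi-indices) from densities of weights $\lambda_1$, $\lambda_2$ to densities of weight $\mu$; the coefficients are $\delta$-densities. Module structure: $(L_XT)(f,g)=L_X(T(f,g))-T(L_Xf,g)-T(f,L_Xg)$. The total order of $T$ is the largest $|a|+|b|$ with $A_{a,b}\neq0$. Symbols: $\mathcal S^{(2)}_\delta=\bigoplus_{k,l\ge0}\Gamma(\vee^kT\mathbb R^n\otimes\vee^lT\mathbb R^n\otimes\Delta^\delta(\mathbb R^n))$, viewed as polynomials in $\alpha,\beta\in\mathbb R^{n*}$ with $\delta$-densities as coefficients, with $L_XP=\sum_iX^i\partial_iP-\sum_{i,j}(\partial_jX^i)(\alpha_iD_{\alpha_j}+\beta_iD_{\beta_j})P+\delta(\sum_i\partial_iX^i)P$.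 The polynomial form of $T$ is $\sum A_{a,b}\alpha^a\beta^b\in\mathcal S^{(2)}_\delta$; its principal symbol is the homogeneous component of highest total degree of its polynomial form. $sl_{n+1}$ is the Lie algebra of vector fields spanned by $\partial_i$, $x^j\partial_i$, $x^j\sum_ix^i\partial_i$ ($1\le i,j\le n$). An $sl_{n+1}$-equivariant (projectively equivariant) symbol map is a linear bijection $\sigma:\mathcal M^2_{\mathit{diff}}(\lambda,\mu)\to\mathcal S^{(2)}_\delta$ that preserves the principal symbol (for $T$ of total order $r$, $\sigma(T)$ has degree $r$ and its homogeneous component of total degree $r$ is the principal symbol of $T$) and satisfies $\sigma(L_XT)=L_X(\sigma(T))$ for all $X\in sl_{n+1}$ and all $T$. That it is a differential operator means that, on the operators of total order at most $r$ (for each $r$), $\sigma(T)$ depends on the coefficients of $T$ through a differential operator. For $i,p\in\mathbb N$ put $\gamma_{i,p}=n(n+1)\delta(\delta-1)-2((n+1)\delta-n+p)i+2i^2+2p(p-1)$. The shift $\delta$ is resonant if there exist $i,p,j,q\in\mathbb N$ with $p\le\lfloor i/2\rfloor$, $q\le\lfloor j/2\rfloor$, $i>j$ and $\gamma_{i,p}=\gamma_{j,q}$. *)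

theory Defs
  imports "HOL-Analysis.Analysis" "HOL-Library.Poly_Mapping"
begin

definition partial_deriv :: "'n::finite \<Rightarrow> (real ^ 'n \<Rightarrow> real) \<Rightarrow> real ^ 'n \<Rightarrow> real" where
  "partial_deriv i f = (\<lambda>x. frechet_derivative f (at x) (axis i 1))"

primrec times_differentiable :: "nat \<Rightarrow> (real ^ 'n::finite \<Rightarrow> real) \<Rightarrow> bool" where
  "times_differentiable 0 f \<longleftrightarrow> True"
| "times_differentiable (Suc k) f \<longleftrightarrow>
     (\<forall>x. f differentiable at x) \<and> (\<forall>i. times_differentiable k (partial_deriv i f))"

definition smooth :: "(real ^ 'n::finite \<Rightarrow> real) \<Rightarrow> bool" where
  "smooth f \<longleftrightarrow> (\<forall>k. times_differentiable k f)"

lemma smooth_differentiable: "smooth f \<Longrightarrow> f differentiable at x"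
  unfolding smooth_def by (metis times_differentiable.simps(2))

lemma smooth_partial_deriv: "smooth f \<Longrightarrow> smooth (partial_deriv i f)"
  unfolding smooth_def by (metis times_differentiable.simps(2))

lemma times_differentiable_SucD: "times_differentiable (Suc k) f \<Longrightarrow> times_differentiable k f"
  by (induction k arbitrary: f) auto

lemma partial_deriv_eqI:
  assumes "\<And>x. (f has_derivative f' x) (at x)"
  shows "partial_deriv i f = (\<lambda>x. f' x (axis i 1))"
  unfolding partial_deriv_def using frechet_derivative_at[OF assms] by metis

lemma has_derivative_frechet:
  "f differentiable at x \<Longrightarrow> (f has_derivative frechet_derivative f (at x)) (at x)"
  by (simp add: frechet_derivative_works)

lemma partial_deriv_const: "partial_deriv i (\<lambda>x. c) = (\<lambda>x. 0)"
  by (subst partial_deriv_eqI[where f' = "\<lambda>x h. 0"]) (auto intro!: derivative_eq_intros)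

lemma partial_deriv_add:
  assumes "\<And>x. f differentiable at x" "\<And>x. g differentiable at x"
  shows "partial_deriv i (\<lambda>x. f x + g x) = (\<lambda>x. partial_deriv i f x + partial_deriv i g x)"
  by (subst partial_deriv_eqI[OF has_derivative_add, OF has_derivative_frechet has_derivative_frechet])
     (use assms in \<open>auto simp: partial_deriv_def\<close>)

lemma partial_deriv_mult:
  assumes "\<And>x. f differentiable at x" "\<And>x. g differentiable at x"
  shows "partial_deriv i (\<lambda>x. f x * g x) =
    (\<lambda>x. f x * partial_deriv i g x + partial_deriv i f x * g x)"
  by (subst partial_deriv_eqI[OF has_derivative_mult, OF has_derivative_frechet has_derivative_frechet])
     (use assms in \<open>auto simp: partial_deriv_def\<close>)

lemma times_differentiable_const: "times_differentiable k (\<lambda>x. c)"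
  by (induction k arbitrary: c) (auto simp: partial_deriv_const)

lemma times_differentiable_add:
  "times_differentiable k f \<Longrightarrow> times_differentiable k g \<Longrightarrow> times_differentiable k (\<lambda>x. f x + g x)"
  by (induction k arbitrary: f g) (auto simp: partial_deriv_add)

lemma times_differentiable_mult:
  "times_differentiable k f \<Longrightarrow> times_differentiable k g \<Longrightarrow> times_differentiable k (\<lambda>x. f x * g x)"
proof (induction k arbitrary: f g)
  case (Suc k)
  have "times_differentiable k f" "times_differentiable k g"
    using Suc.prems times_differentiable_SucD by blast+
  with Suc show ?case
    by (auto simp: partial_deriv_mult intro!: times_differentiable_add)
qed auto

lemma smooth_const: "smooth (\<lambda>x. c)"
  by (simp add: smooth_def times_differentiable_const)

lemma smooth_add: "smooth f \<Longrightarrow> smooth g \<Longrightarrow> smooth (\<lambda>x. f x + g x)"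
  by (simp add: smooth_def times_differentiable_add)

lemma smooth_mult: "smooth f \<Longrightarrow> smooth g \<Longrightarrow> smooth (\<lambda>x. f x * g x)"
  by (simp add: smooth_def times_differentiable_mult)

lemma smooth_cmult: "smooth f \<Longrightarrow> smooth (\<lambda>x. c * f x)"
  by (rule smooth_mult[OF smooth_const])

lemma smooth_coordinate: "smooth (\<lambda>x :: real ^ 'n::finite. x $ i)"
proof -
  have "((\<lambda>x. x $ i) has_derivative (\<lambda>h. h $ i)) (at x)" for x :: "real ^ 'n"
    by (rule bounded_linear_imp_has_derivative) (rule bounded_linear_vec_nth)
  note d = this
  have "partial_deriv j (\<lambda>x :: real ^ 'n. x $ i) = (\<lambda>x. axis j 1 $ i)" for j
    by (rule partial_deriv_eqI[OF d])
  moreover have "(\<lambda>x :: real ^ 'n. x $ i) differentiable at x" for x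
    using d by (rule differentiableI)
  ultimately have "times_differentiable k (\<lambda>x :: real ^ 'n. x $ i)" for k
    by (cases k) (auto simp: times_differentiable_const)
  then show ?thesis by (simp add: smooth_def)
qed

lemma partial_deriv_along_line:
  assumes "\<And>x. f differentiable at x"
  shows "((\<lambda>s. f (a + s *\<^sub>R axis i 1)) has_real_derivative partial_deriv i f (a + s *\<^sub>R axis i 1)) (at s)"
proof -
  let ?e = "axis i 1 :: real ^ 'a" and ?D = "frechet_derivative f (at (a + s *\<^sub>R axis i 1))"
  have l: "((\<lambda>s. a + s *\<^sub>R ?e) has_derivative (\<lambda>h. h *\<^sub>R ?e)) (at s)"
    by (auto intro!: derivative_eq_intros)
  have D: "(f has_derivative ?D) (at (a + s *\<^sub>R ?e))"
    using assms has_derivative_frechet by blast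
  have *: "((\<lambda>s. f (a + s *\<^sub>R ?e)) has_derivative (\<lambda>h. ?D (h *\<^sub>R ?e))) (at s)"
    by (rule has_derivative_compose[OF l D])
  have "(\<lambda>h. ?D (h *\<^sub>R ?e)) = (*) (partial_deriv i f (a + s *\<^sub>R ?e))"
    unfolding linear_scale[OF has_derivative_linear[OF D]] partial_deriv_def
    by (simp add: fun_eq_iff mult.commute)
  with * show ?thesis unfolding has_field_derivative_def by simp
qed

lemma second_difference:
  assumes f: "smooth f" and h: "0 < h"
  shows "\<exists>s t. 0 < s \<and> s < h \<and> 0 < t \<and> t < h \<and>
    f (x + h *\<^sub>R axis i 1 + h *\<^sub>R axis j 1) - f (x + h *\<^sub>R axis i 1) - f (x + h *\<^sub>R axis j 1) + f x
    = h * h * partial_deriv j (partial_deriv i f) (x + s *\<^sub>R axis i 1 + t *\<^sub>R axis j 1)"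
proof -
  let ?e = "\<lambda>i. axis i 1 :: real ^ 'a"
  let ?F = "\<lambda>s. f (x + h *\<^sub>R ?e j + s *\<^sub>R ?e i) - f (x + s *\<^sub>R ?e i)"
  have "(?F has_real_derivative partial_deriv i f (x + h *\<^sub>R ?e j + s *\<^sub>R ?e i)
      - partial_deriv i f (x + s *\<^sub>R ?e i)) (at s)" for s
    by (intro DERIV_diff partial_deriv_along_line smooth_differentiable f)
  from MVT2[OF h this] obtain s where s: "0 < s" "s < h"
    and S: "?F h - ?F 0 = h * (partial_deriv i f (x + h *\<^sub>R ?e j + s *\<^sub>R ?e i)
      - partial_deriv i f (x + s *\<^sub>R ?e i))" by auto
  let ?G = "\<lambda>t. partial_deriv i f (x + s *\<^sub>R ?e i + t *\<^sub>R ?e j)"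
  have "(?G has_real_derivative partial_deriv j (partial_deriv i f) (x + s *\<^sub>R ?e i + t *\<^sub>R ?e j)) (at t)" for t
    by (intro partial_deriv_along_line smooth_differentiable smooth_partial_deriv f)
  from MVT2[OF h this] obtain t where t: "0 < t" "t < h"
    and T: "?G h - ?G 0 = h * partial_deriv j (partial_deriv i f) (x + s *\<^sub>R ?e i + t *\<^sub>R ?e j)" by auto
  have "?F h - ?F 0 = h * h * partial_deriv j (partial_deriv i f) (x + s *\<^sub>R ?e i + t *\<^sub>R ?e j)"
    using S T by (simp add: algebra_simps)
  then show ?thesis using s t by (intro exI[of _ s] exI[of _ t]) (simp add: algebra_simps)
qed

lemma partial_deriv_commute:
  assumes f: "smooth f"
  shows "partial_deriv i (partial_deriv j f) = partial_deriv j (partial_deriv i f)"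
proof (rule ext, rule ccontr)
  fix x
  let ?e = "\<lambda>i. axis i 1 :: real ^ 'a"
  let ?P = "partial_deriv i (partial_deriv j f)" and ?Q = "partial_deriv j (partial_deriv i f)"
  assume "?P x \<noteq> ?Q x"
  then have eps: "\<bar>?P x - ?Q x\<bar> / 2 > 0" by simp
  have "isCont ?P x" "isCont ?Q x"
    by (intro differentiable_imp_continuous_within smooth_differentiable smooth_partial_deriv f)+
  then have P: "\<exists>d>0. \<forall>y. dist y x < d \<longrightarrow> dist (?P y) (?P x) < \<bar>?P x - ?Q x\<bar> / 2"
    and Q: "\<exists>d>0. \<forall>y. dist y x < d \<longrightarrow> dist (?Q y) (?Q x) < \<bar>?P x - ?Q x\<bar> / 2"
    using eps unfolding continuous_at_eps_delta by (blast, blast)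
  from P obtain d1 where d1: "d1 > 0"
    and P: "\<And>y. dist y x < d1 \<Longrightarrow> dist (?P y) (?P x) < \<bar>?P x - ?Q x\<bar> / 2" by blast
  from Q obtain d2 where d2: "d2 > 0"
    and Q: "\<And>y. dist y x < d2 \<Longrightarrow> dist (?Q y) (?Q x) < \<bar>?P x - ?Q x\<bar> / 2" by blast
  define h where "h = min d1 d2 / 2"
  have h: "h > 0" "2 * h \<le> d1" "2 * h \<le> d2" using d1 d2 by (auto simp: h_def)
  have near: "dist (x + s *\<^sub>R ?e k + t *\<^sub>R ?e l) x < 2 * h"
    if "0 < s" "s < h" "0 < t" "t < h" for s t k l
  proof -
    have "norm (s *\<^sub>R ?e k + t *\<^sub>R ?e l) \<le> norm (s *\<^sub>R ?e k) + norm (t *\<^sub>R ?e l)"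
      by (rule norm_triangle_ineq)
    also have "\<dots> < 2 * h" using that by simp
    finally show ?thesis by (simp add: dist_norm add.assoc)
  qed
  obtain s t where st: "0 < s" "s < h" "0 < t" "t < h"
    and 1: "f (x + h *\<^sub>R ?e i + h *\<^sub>R ?e j) - f (x + h *\<^sub>R ?e i) - f (x + h *\<^sub>R ?e j) + f x
      = h * h * ?Q (x + s *\<^sub>R ?e i + t *\<^sub>R ?e j)"
    using second_difference[OF f h(1)] by blast
  obtain s' t' where st': "0 < s'" "s' < h" "0 < t'" "t' < h"
    and 2: "f (x + h *\<^sub>R ?e j + h *\<^sub>R ?e i) - f (x + h *\<^sub>R ?e j) - f (x + h *\<^sub>R ?e i) + f x
      = h * h * ?P (x + s' *\<^sub>R ?e j + t' *\<^sub>R ?e i)"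
    using second_difference[OF f h(1)] by blast
  have swap: "x + h *\<^sub>R ?e i + h *\<^sub>R ?e j = x + h *\<^sub>R ?e j + h *\<^sub>R ?e i" by simp
  have "h * h * ?Q (x + s *\<^sub>R ?e i + t *\<^sub>R ?e j) = h * h * ?P (x + s' *\<^sub>R ?e j + t' *\<^sub>R ?e i)"
    using 1[unfolded swap] 2 by linarith
  then have "?Q (x + s *\<^sub>R ?e i + t *\<^sub>R ?e j) = ?P (x + s' *\<^sub>R ?e j + t' *\<^sub>R ?e i)"
    using h(1) by simp
  moreover have "dist (?Q (x + s *\<^sub>R ?e i + t *\<^sub>R ?e j)) (?Q x) < \<bar>?P x - ?Q x\<bar> / 2"
    by (rule Q) (rule less_le_trans[OF near[OF st] h(3)])
  moreover have "dist (?P (x + s' *\<^sub>R ?e j + t' *\<^sub>R ?e i)) (?P x) < \<bar>?P x - ?Q x\<bar> / 2"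
    by (rule P) (rule less_le_trans[OF near[OF st'] h(2)])
  ultimately have "dist (?Q x) (?P x) < \<bar>?P x - ?Q x\<bar>"
    by (metis dist_triangle_half_r)
  then show False by (simp add: dist_real_def abs_minus_commute)
qed

typedef (overloaded) 'n smooth_fun = "{f :: real ^ 'n::finite \<Rightarrow> real. smooth f}"
  morphisms apply_smooth Abs_smooth_fun
  using smooth_const by blast

setup_lifting type_definition_smooth_fun

instantiation smooth_fun :: (finite) "{comm_ring_1, real_algebra_1}"
begin

lift_definition zero_smooth_fun :: "'a smooth_fun" is "\<lambda>x. 0" by (rule smooth_const)
lift_definition one_smooth_fun :: "'a smooth_fun" is "\<lambda>x. 1" by (rule smooth_const)
lift_definition plus_smooth_fun :: "'a smooth_fun \<Rightarrow> 'a smooth_fun \<Rightarrow> 'a smooth_fun"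
  is "\<lambda>f g x. f x + g x" by (rule smooth_add)
lift_definition minus_smooth_fun :: "'a smooth_fun \<Rightarrow> 'a smooth_fun \<Rightarrow> 'a smooth_fun"
  is "\<lambda>f g x. f x - g x" using smooth_add[OF _ smooth_cmult[where c = "-1"]] by simp
lift_definition uminus_smooth_fun :: "'a smooth_fun \<Rightarrow> 'a smooth_fun"
  is "\<lambda>f x. - f x" using smooth_cmult[where c = "-1"] by simp
lift_definition times_smooth_fun :: "'a smooth_fun \<Rightarrow> 'a smooth_fun \<Rightarrow> 'a smooth_fun"
  is "\<lambda>f g x. f x * g x" by (rule smooth_mult)
lift_definition scaleR_smooth_fun :: "real \<Rightarrow> 'a smooth_fun \<Rightarrow> 'a smooth_fun"
  is "\<lambda>c f x. c * f x" by (rule smooth_cmult)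

instance
  by standard (transfer; auto simp: algebra_simps fun_eq_iff)+

end

lift_definition pdiff :: "'n::finite \<Rightarrow> 'n smooth_fun \<Rightarrow> 'n smooth_fun" is partial_deriv
  by (rule smooth_partial_deriv)

lift_definition coordinate :: "'n::finite \<Rightarrow> 'n smooth_fun" is "\<lambda>i x. x $ i"
  by (rule smooth_coordinate)

lemma pdiff_commute: "pdiff i (pdiff j f) = pdiff j (pdiff i f)"
  by transfer (rule partial_deriv_commute)

type_synonym 'n multi_index = "nat ^ 'n"

definition multi_deriv :: "'n::finite multi_index \<Rightarrow> 'n smooth_fun \<Rightarrow> 'n smooth_fun" where
  "multi_deriv a f = Finite_Set.fold (\<lambda>i. pdiff i ^^ (a $ i)) f UNIV"

text \<open>The fold is well defined because the partial derivatives commute.\<close>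

lemma comp_fun_commute_pdiff: "comp_fun_commute (\<lambda>i. pdiff i ^^ (a i))"
proof -
  have "pdiff i ((pdiff j ^^ k) f) = (pdiff j ^^ k) (pdiff i f)" for i j k and f :: "'a smooth_fun"
    by (induction k) (simp_all add: pdiff_commute[of i j])
  then have "(pdiff i ^^ m) ((pdiff j ^^ k) f) = (pdiff j ^^ k) ((pdiff i ^^ m) f)"
    for i j k m and f :: "'a smooth_fun"
    by (induction m) simp_all
  then show ?thesis by (intro comp_fun_commute.intro) (auto simp: fun_eq_iff)
qed

text \<open>The key \<open>(a, b)\<close> stands for the monomial \<open>\<alpha>\<^sup>a \<beta>\<^sup>b\<close>; multiplication is the product of
  polynomials.\<close>

type_synonym 'n symbol = "('n multi_index \<times> 'n multi_index) \<Rightarrow>\<^sub>0 'n smooth_fun"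

definition monomial_degree :: "'n::finite multi_index \<times> 'n multi_index \<Rightarrow> nat" where
  "monomial_degree k = (\<Sum>i\<in>UNIV. fst k $ i) + (\<Sum>i\<in>UNIV. snd k $ i)"

text \<open>The zero polynomial gets degree 0.\<close>

definition total_degree :: "'n::finite symbol \<Rightarrow> nat" where
  "total_degree P = Max (insert 0 (monomial_degree ` Poly_Mapping.keys P))"

definition homogeneous_component :: "nat \<Rightarrow> 'n::finite symbol \<Rightarrow> 'n symbol" where
  "homogeneous_component r P = Poly_Mapping.mapp (\<lambda>k c. c when monomial_degree k = r) P"

definition const_symbol :: "'n::finite smooth_fun \<Rightarrow> 'n symbol" where
  "const_symbol f = Poly_Mapping.single 0 f"

definition alpha :: "'n::finite \<Rightarrow> 'n symbol" where
  "alpha i = Poly_Mapping.single (axis i 1, 0) 1"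

definition beta :: "'n::finite \<Rightarrow> 'n symbol" where
  "beta i = Poly_Mapping.single (0, axis i 1) 1"

definition D_alpha :: "'n::finite \<Rightarrow> 'n symbol \<Rightarrow> 'n symbol" where
  "D_alpha j P = (\<Sum>k\<in>Poly_Mapping.keys P.
     Poly_Mapping.single (fst k - axis j 1, snd k) (of_nat (fst k $ j) * Poly_Mapping.lookup P k))"

definition D_beta :: "'n::finite \<Rightarrow> 'n symbol \<Rightarrow> 'n symbol" where
  "D_beta j P = (\<Sum>k\<in>Poly_Mapping.keys P.
     Poly_Mapping.single (fst k, snd k - axis j 1) (of_nat (snd k $ j) * Poly_Mapping.lookup P k))"

definition coeff_pdiff :: "'n::finite \<Rightarrow> 'n symbol \<Rightarrow> 'n symbol" where
  "coeff_pdiff i P = Poly_Mapping.map (pdiff i) P"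

type_synonym 'n vector_field = "'n smooth_fun ^ 'n"

definition divergence :: "'n::finite vector_field \<Rightarrow> 'n smooth_fun" where
  "divergence X = (\<Sum>i\<in>UNIV. pdiff i (X $ i))"

definition lie_density :: "real \<Rightarrow> 'n::finite vector_field \<Rightarrow> 'n smooth_fun \<Rightarrow> 'n smooth_fun" where
  "lie_density w X \<phi> = (\<Sum>i\<in>UNIV. X $ i * pdiff i \<phi>) + w *\<^sub>R (divergence X * \<phi>)"

definition lie_symbol :: "real \<Rightarrow> 'n::finite vector_field \<Rightarrow> 'n symbol \<Rightarrow> 'n symbol" where
  "lie_symbol \<delta> X P =
     (\<Sum>i\<in>UNIV. const_symbol (X $ i) * coeff_pdiff i P)
     - (\<Sum>i\<in>UNIV. \<Sum>j\<in>UNIV. const_symbol (pdiff j (X $ i)) *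
          (alpha i * D_alpha j P + beta i * D_beta j P))
     + const_symbol (\<delta> *\<^sub>R divergence X) * P"

text \<open>The projective Lie algebra; \<open>axis i f\<close> is the vector field \<open>f \<partial>\<^sub>i\<close>.\<close>

definition sl_fields :: "'n::finite vector_field set" where
  "sl_fields = span
     (range (\<lambda>i. axis i 1)
      \<union> range (\<lambda>(j, i). axis i (coordinate j))
      \<union> range (\<lambda>j. \<chi> i. coordinate j * coordinate i))"

type_synonym 'n bi_operator = "'n smooth_fun \<Rightarrow> 'n smooth_fun \<Rightarrow> 'n smooth_fun"

definition bidiff_of :: "'n::finite symbol \<Rightarrow> 'n bi_operator" where
  "bidiff_of A f g = (\<Sum>k\<in>Poly_Mapping.keys A.
     Poly_Mapping.lookup A k * multi_deriv (fst k) f * multi_deriv (snd k) g)"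

text \<open>The weights play no role for the underlying space, only for the action of vector fields.\<close>

definition bidiff_ops :: "'n::finite bi_operator set" where
  "bidiff_ops = range bidiff_of"

definition lie_bidiff ::
  "real \<times> real \<Rightarrow> real \<Rightarrow> 'n::finite vector_field \<Rightarrow> 'n bi_operator \<Rightarrow> 'n bi_operator" where
  "lie_bidiff w \<mu> X T f g =
     lie_density \<mu> X (T f g) - T (lie_density (fst w) X f) g - T f (lie_density (snd w) X g)"

text \<open>The coefficients of a bidifferential operator are determined by the operator.\<close>

definition polynomial_form :: "'n::finite bi_operator \<Rightarrow> 'n symbol" where
  "polynomial_form T = (THE A. T = bidiff_of A)"

definition total_order :: "'n::finite bi_operator \<Rightarrow> nat" where
  "total_order T = total_degree (polynomial_form T)"

definition principal_symbol :: "'n::finite bi_operator \<Rightarrow> 'n symbol" where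
  "principal_symbol T = homogeneous_component (total_order T) (polynomial_form T)"

definition preserves_principal_symbol :: "('n::finite bi_operator \<Rightarrow> 'n symbol) \<Rightarrow> bool" where
  "preserves_principal_symbol \<sigma> \<longleftrightarrow> (\<forall>T\<in>bidiff_ops.
     total_degree (\<sigma> T) = total_order T \<and>
     homogeneous_component (total_order T) (\<sigma> T) = principal_symbol T)"

definition equivariant_symbol_map ::
  "real \<times> real \<Rightarrow> real \<Rightarrow> ('n::finite bi_operator \<Rightarrow> 'n symbol) \<Rightarrow> bool" where
  "equivariant_symbol_map w \<mu> \<sigma> \<longleftrightarrow>
     (\<forall>S\<in>bidiff_ops. \<forall>T\<in>bidiff_ops. \<sigma> (\<lambda>f g. S f g + T f g) = \<sigma> S + \<sigma> T) \<and>
     (\<forall>c. \<forall>T\<in>bidiff_ops. \<sigma> (\<lambda>f g. c *\<^sub>R T f g) = Poly_Mapping.map ((*\<^sub>R) c) (\<sigma> T)) \<and>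
     bij_betw \<sigma> bidiff_ops UNIV \<and>
     preserves_principal_symbol \<sigma> \<and>
     (\<forall>X\<in>sl_fields. \<forall>T\<in>bidiff_ops.
        \<sigma> (lie_bidiff w \<mu> X T) = lie_symbol (\<mu> - fst w - snd w) X (\<sigma> T))"

text \<open>For each \<open>r\<close>, on the operators of total order at most \<open>r\<close> the coefficients of \<open>\<sigma> T\<close> are
  given by finitely many terms \<open>C\<^bsub>l,k,c\<^esub> D\<^sup>c A\<^sub>k\<close>, where \<open>A\<^sub>k\<close> are the coefficients of \<open>T\<close>
  and the smooth functions \<open>C\<^bsub>l,k,c\<^esub>\<close> do not depend on \<open>T\<close>.\<close>

definition is_differential :: "('n::finite bi_operator \<Rightarrow> 'n symbol) \<Rightarrow> bool" where
  "is_differential \<sigma> \<longleftrightarrow>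
     (\<forall>r. \<exists>C :: (('n multi_index \<times> 'n multi_index) \<times> ('n multi_index \<times> 'n multi_index)
                 \<times> 'n multi_index) \<Rightarrow>\<^sub>0 'n smooth_fun.
        \<forall>T\<in>bidiff_ops. total_order T \<le> r \<longrightarrow>
          \<sigma> T = (\<Sum>(l, k, c)\<in>Poly_Mapping.keys C. Poly_Mapping.single l
                   (Poly_Mapping.lookup C (l, k, c) *
                    multi_deriv c (Poly_Mapping.lookup (polynomial_form T) k))))"

definition casimir_gamma :: "nat \<Rightarrow> real \<Rightarrow> nat \<Rightarrow> nat \<Rightarrow> real" where
  "casimir_gamma n \<delta> i p =
     real n * (real n + 1) * \<delta> * (\<delta> - 1) - 2 * ((real n + 1) * \<delta> - real n + real p) * real i
     + 2 * (real i)\<^sup>2 + 2 * real p * (real p - 1)"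

definition resonant :: "nat \<Rightarrow> real \<Rightarrow> bool" where
  "resonant n \<delta> \<longleftrightarrow> (\<exists>i p j q. p \<le> i div 2 \<and> q \<le> j div 2 \<and> i > j \<and>
     casimir_gamma n \<delta> i p = casimir_gamma n \<delta> j q)"

end

theory Submission
  imports Defs "HOL-Computational_Algebra.Polynomial"
begin

text \<open>
  A bidifferential operator is determined by its polynomial form, so the projective fields act twice
  on one and the same space of polynomials in \<open>\<alpha>\<close> and \<open>\<beta>\<close>: by the Lie derivative of symbols, and
  by the Lie derivative of operators, read on polynomial forms (\<open>op_action\<close>). The two actions agree
  on affine fields, and on the quadratic fields they differ by an operator that lowers the degree by
  one. An equivariant symbol map is an intertwiner of the two actions that is the identity up to
  terms of lower degree.

  Each action has a Casimir operator. Let \<open>C\<close> be the one on symbols and \<open>K\<close> the one on operators;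
  both commute with their action, and \<open>K - C\<close> lowers the degree. On symbols of total degree \<open>i\<close> the
  polynomial \<open>\<pi>\<^sub>i = \<Prod>\<^bsub>p \<le> i/2\<^esub> (X - \<gamma>\<^bsub>i,p\<^esub>)\<close> vanishes at \<open>C\<close>. Indeed, in bidegree \<open>(k, l)\<close> one finds
  \<open>C = \<gamma>\<^bsub>k+l,l\<^esub> + 2 F E\<close> (\<open>symbol_casimir_bidegree\<close>), where \<open>E = \<Sum>\<^sub>i \<alpha>\<^sub>i D\<^bsub>\<beta>i\<^esub>\<close> and \<open>F = \<Sum>\<^sub>i \<beta>\<^sub>i D\<^bsub>\<alpha>i\<^esub>\<close> commute
  with \<open>C\<close>. As \<open>E\<close> lowers \<open>l\<close> and kills \<open>l = 0\<close>, induction on \<open>l\<close> shows that the product of the factors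
  with \<open>p \<le> l\<close> vanishes (\<open>sl2_ladder_annihilates\<close>). The same holds with \<open>k\<close> instead of \<open>l\<close>, and one of the
  two is at most \<open>i/2\<close>.

  Nonresonance says exactly that \<open>\<pi>\<^sub>i\<close> and \<open>\<pi>\<^sub>j\<close> are coprime for \<open>i \<noteq> j\<close>. Hence there is a polynomial
  \<open>q\<^sub>i\<close> that is \<open>1\<close> modulo \<open>\<pi>\<^sub>i\<close> and \<open>0\<close> modulo \<open>\<pi>\<^sub>j\<close> for all \<open>j < i\<close>. Then \<open>q\<^sub>i(K)\<close> commutes with the action
  on operators, kills all polynomials of degree below \<open>i\<close>, and \<open>q\<^sub>i(K) P\<close> has leading part \<open>P\<close> if \<open>P\<close> is
  homogeneous of degree \<open>i\<close>. The map \<open>P \<mapsto> q\<^sub>i(K) P\<close> on degree \<open>i\<close> (\<open>lift\<close>) is therefore unipotent, and it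
  is equivariant, since the two actions on \<open>P\<close> differ by something that \<open>q\<^sub>i(K)\<close> kills
  (\<open>lift_equivariant\<close>). Its inverse is the symbol map. On bounded degree this inverse is a finite
  recursion in polynomials of \<open>K\<close> (\<open>unlift\<close>), hence a differential operator.

  Conversely, an equivariant symbol map intertwines \<open>K\<close> and \<open>C\<close>. If it sends \<open>A\<close> to \<open>P\<close>, homogeneous of
  degree \<open>i\<close>, then \<open>\<pi>\<^sub>i(K) A = 0\<close>, so \<open>A = q\<^sub>i(K) A\<close>, and this is \<open>q\<^sub>i(K) P\<close> because \<open>A\<close> and \<open>P\<close> have the same
  leading part (\<open>lift_unique\<close>). This is uniqueness.

  That \<open>K\<close> commutes with the action rests on the presentation of the projective fields as the matrix
  units of \<open>gl\<^bsub>n+1\<^esub>\<close> in homogeneous coordinates (\<open>gl_field\<close>, \<open>gl_casimir_commutes\<close>).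
\<close>

section \<open>Polynomials in a linear operator\<close>

definition op_poly :: "real poly \<Rightarrow> ('v::real_vector \<Rightarrow> 'v) \<Rightarrow> 'v \<Rightarrow> 'v" where
  "op_poly p K = fold_coeffs (\<lambda>c F v. c *\<^sub>R v + K (F v)) p (\<lambda>v. 0)"

lemma op_poly_0 [simp]: "op_poly 0 K v = 0"
  by (simp add: op_poly_def)

lemma op_poly_pCons:
  assumes "linear K"
  shows "op_poly (pCons c p) K v = c *\<^sub>R v + K (op_poly p K v)"
  using linear_0[OF assms] by (cases "p = 0 \<and> c = 0") (auto simp: op_poly_def)

lemma linear_op_poly:
  assumes "linear K"
  shows "linear (op_poly p K)"
  by (induction p)
     (auto intro!: linearI simp: op_poly_pCons[OF assms] linear_add linear_scale assms
       scaleR_add_right algebra_simps)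

lemma op_poly_add:
  assumes "linear K"
  shows "op_poly (p + q) K v = op_poly p K v + op_poly q K v"
  by (induction p q rule: poly_induct2)
     (simp_all add: op_poly_pCons[OF assms] linear_add[OF assms] algebra_simps)

lemma op_poly_smult:
  assumes "linear K"
  shows "op_poly (smult c p) K v = c *\<^sub>R op_poly p K v"
  by (induction p)
     (simp_all add: op_poly_pCons[OF assms] linear_scale[OF assms] algebra_simps)

lemma op_poly_mult:
  assumes "linear K"
  shows "op_poly (p * q) K v = op_poly p K (op_poly q K v)"
  by (induction p)
     (simp_all add: op_poly_pCons[OF assms] op_poly_add[OF assms] op_poly_smult[OF assms]
       linear_0[OF assms])

lemma op_poly_1:
  assumes "linear K"
  shows "op_poly 1 K v = v"
  by (simp add: one_pCons op_poly_pCons[OF assms] linear_0[OF assms])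

lemma op_poly_intertwine:
  assumes "linear K" "linear K'" "linear G" "\<And>v. G (K v) = K' (G v)"
  shows "G (op_poly p K v) = op_poly p K' (G v)"
  by (induction p)
     (simp_all add: op_poly_pCons[OF assms(1)] op_poly_pCons[OF assms(2)] assms(4)
       linear_0[OF assms(3)] linear_add[OF assms(3)] linear_scale[OF assms(3)])

text \<open>Coprimality in the form of a Bezout identity, which can be evaluated at an operator.\<close>

definition comaximal :: "'a::comm_ring_1 \<Rightarrow> 'a \<Rightarrow> bool" where
  "comaximal p q \<longleftrightarrow> (\<exists>u v. u * p + v * q = 1)"

lemma comaximal_sym: "comaximal p q \<Longrightarrow> comaximal q p"
  unfolding comaximal_def by (metis add.commute)

lemma comaximal_1: "comaximal p 1"
  unfolding comaximal_def by (intro exI[of _ 0] exI[of _ 1]) simp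

lemma comaximal_mult:
  assumes "comaximal p q" "comaximal p r"
  shows "comaximal p (q * r)"
proof -
  from assms obtain u v u' v' where 1: "u * p + v * q = 1" and 2: "u' * p + v' * r = 1"
    unfolding comaximal_def by blast
  have "(u * p + v * q) * (u' * p + v' * r) = 1"
    by (simp add: 1 2)
  then have "(u * u' * p + u * v' * r + v * q * u') * p + (v * v') * (q * r) = 1"
    by (simp add: algebra_simps)
  then show ?thesis unfolding comaximal_def by blast
qed

lemma comaximal_prod:
  "(\<And>j. j \<in> J \<Longrightarrow> comaximal p (f j)) \<Longrightarrow> comaximal p (prod f J)"
  by (induction J rule: infinite_finite_induct) (auto intro: comaximal_1 comaximal_mult)

lemma comaximal_linear_factors:
  fixes x y :: real
  assumes "x \<noteq> y"
  shows "comaximal [:- x, 1:] [:- y, 1:]"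
  unfolding comaximal_def
proof (intro exI)
  have "1 / (y - x) * (y - x) = 1" using assms by simp
  then show "[:1 / (y - x):] * [:- x, 1:] + [:- (1 / (y - x)):] * [:- y, 1:] = 1"
    by (simp add: one_pCons right_diff_distrib)
qed

section \<open>Triangular perturbations of a graded operator\<close>

text \<open>The linear algebra behind the theorem. The operator \<open>C\<close> preserves the grading, and
  \<open>\<pi> i\<close> vanishes at \<open>C\<close> in degree \<open>i\<close>; \<open>K\<close> agrees with \<open>C\<close> up to terms of lower degree. Since the
  \<open>\<pi> i\<close> are pairwise coprime, the generalised eigenspaces of \<open>K\<close> attached to different degrees are
  independent, and each vector of degree \<open>i\<close> is the leading part of exactly one vector killed by
  \<open>\<pi> i\<close> evaluated at \<open>K\<close>.\<close>

locale graded_perturbation =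
  fixes hom :: "nat \<Rightarrow> 'v::real_vector \<Rightarrow> 'v" and C K :: "'v \<Rightarrow> 'v" and \<pi> :: "nat \<Rightarrow> real poly"
  assumes linear_hom: "linear (hom i)"
    and hom_hom: "hom i (hom j v) = (if i = j then hom i v else 0)"
    and hom_bounded: "\<exists>m. \<forall>i\<ge>m. hom i v = 0"
    and hom_separates: "(\<And>i. hom i v = 0) \<Longrightarrow> v = 0"
    and linear_C: "linear C" and linear_K: "linear K"
    and hom_C: "hom i (C v) = C (hom i v)"
    and K_minus_C: "(\<And>i. i > m \<Longrightarrow> hom i v = 0) \<Longrightarrow> j \<ge> m \<Longrightarrow> hom j (K v - C v) = 0"
    and annihilates: "op_poly (\<pi> i) C (hom i v) = 0"
    and pairwise_comaximal: "i \<noteq> j \<Longrightarrow> comaximal (\<pi> i) (\<pi> j)"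
begin

definition filt :: "nat \<Rightarrow> 'v set" where
  "filt m = {v. \<forall>i\<ge>m. hom i v = 0}"

lemma subspace_filt: "subspace (filt m)"
  by (auto simp: subspace_def filt_def linear_0[OF linear_hom] linear_add[OF linear_hom]
      linear_scale[OF linear_hom])

lemma filt_0: "v \<in> filt 0 \<longleftrightarrow> v = 0"
  using hom_separates linear_0[OF linear_hom] by (auto simp: filt_def)

lemma filt_mono: "m \<le> n \<Longrightarrow> filt m \<subseteq> filt n"
  by (auto simp: filt_def)

lemma in_some_filt: "\<exists>m. v \<in> filt m"
  using hom_bounded by (auto simp: filt_def)

lemma hom_in_filt: "hom i v \<in> filt (Suc i)"
  by (auto simp: filt_def hom_hom)

lemma minus_top_in_filt: "v \<in> filt (Suc m) \<Longrightarrow> v - hom m v \<in> filt m"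
  by (auto simp: filt_def hom_hom linear_diff[OF linear_hom])

lemma K_minus_C_filt: "v \<in> filt (Suc m) \<Longrightarrow> K v - C v \<in> filt m"
  using K_minus_C[of m v] by (auto simp: filt_def)

lemma C_filt: "v \<in> filt m \<Longrightarrow> C v \<in> filt m"
  by (auto simp: filt_def hom_C linear_0[OF linear_C])

lemma K_filt: "v \<in> filt m \<Longrightarrow> K v \<in> filt m"
proof (cases m)
  case 0
  then show "v \<in> filt m \<Longrightarrow> K v \<in> filt m"
    by (auto simp: filt_0 linear_0[OF linear_K])
next
  case (Suc k)
  assume v: "v \<in> filt m"
  have "(K v - C v) + C v \<in> filt m"
    using K_minus_C_filt v C_filt[OF v] filt_mono[of k m] Suc
    by (intro subspace_add[OF subspace_filt]) auto
  then show "K v \<in> filt m" by simp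
qed

lemma op_poly_filt: "v \<in> filt m \<Longrightarrow> op_poly p K v \<in> filt m"
  by (induction p)
     (auto simp: op_poly_pCons[OF linear_K] intro!: subspace_add[OF subspace_filt]
       subspace_0[OF subspace_filt] subspace_scale[OF subspace_filt] K_filt)

lemma op_poly_C_filt: "v \<in> filt m \<Longrightarrow> op_poly p C v \<in> filt m"
  by (induction p)
     (auto simp: op_poly_pCons[OF linear_C] intro!: subspace_add[OF subspace_filt]
       subspace_0[OF subspace_filt] subspace_scale[OF subspace_filt] C_filt)

lemma op_poly_K_minus_C: "v \<in> filt (Suc m) \<Longrightarrow> op_poly p K v - op_poly p C v \<in> filt m"
proof (induction p)
  case 0
  then show ?case by (simp add: subspace_0[OF subspace_filt])
next
  case (pCons c p)
  have "K (op_poly p K v - op_poly p C v) + (K (op_poly p C v) - C (op_poly p C v)) \<in> filt m"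
    using pCons by (intro subspace_add[OF subspace_filt] K_filt K_minus_C_filt op_poly_C_filt) auto
  then show ?case
    by (simp add: op_poly_pCons[OF linear_K] op_poly_pCons[OF linear_C] linear_diff[OF linear_K])
qed

text \<open>Each factor \<open>\<pi> m\<close> kills the leading part and hence lowers the filtration degree by one.\<close>

lemma prod_annihilates_filt: "v \<in> filt m \<Longrightarrow> op_poly (\<Prod>j<m. \<pi> j) K v = 0"
proof (induction m arbitrary: v)
  case 0
  then show ?case by (simp add: filt_0 op_poly_1[OF linear_K])
next
  case (Suc m)
  let ?p = "op_poly (\<pi> m) K"
  have "?p v = ?p (v - hom m v) + (?p (hom m v) - op_poly (\<pi> m) C (hom m v))"
    by (simp add: linear_diff[OF linear_op_poly[OF linear_K]] annihilates)
  also have "\<dots> \<in> filt m"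
    using Suc.prems
    by (intro subspace_add[OF subspace_filt] op_poly_filt op_poly_K_minus_C minus_top_in_filt hom_in_filt)
  finally show ?case using Suc.IH by (simp add: op_poly_mult[OF linear_K])
qed

text \<open>The interpolation polynomial which is \<open>1\<close> modulo \<open>\<pi> i\<close> and \<open>0\<close> modulo every \<open>\<pi> j\<close> with
  \<open>j < i\<close>. At \<open>K\<close> it is the projection of the vectors of degree at most \<open>i\<close> onto the generalised
  eigenspace belonging to degree \<open>i\<close>.\<close>

definition selector :: "nat \<Rightarrow> real poly" where
  "selector i = (SOME q. (\<exists>u. q = 1 - u * \<pi> i) \<and> (\<Prod>j<i. \<pi> j) dvd q)"

lemma selector: "\<exists>u. selector i = 1 - u * \<pi> i" "(\<Prod>j<i. \<pi> j) dvd selector i"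
proof -
  have "comaximal (\<pi> i) (\<Prod>j<i. \<pi> j)"
    by (rule comaximal_prod) (auto intro: pairwise_comaximal)
  then obtain u v where "u * \<pi> i + v * (\<Prod>j<i. \<pi> j) = 1"
    unfolding comaximal_def by blast
  then have "v * (\<Prod>j<i. \<pi> j) = 1 - u * \<pi> i"
    by (simp add: algebra_simps)
  then have "\<exists>q. (\<exists>u. q = 1 - u * \<pi> i) \<and> (\<Prod>j<i. \<pi> j) dvd q"
    by (metis dvd_triv_right)
  from someI_ex[OF this] show "\<exists>u. selector i = 1 - u * \<pi> i" "(\<Prod>j<i. \<pi> j) dvd selector i"
    unfolding selector_def by blast+
qed

abbreviation lift_at :: "nat \<Rightarrow> 'v \<Rightarrow> 'v" where
  "lift_at i \<equiv> op_poly (selector i) K"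

lemma linear_lift_at: "linear (lift_at i)"
  by (rule linear_op_poly[OF linear_K])

lemma lift_at_filt: "v \<in> filt i \<Longrightarrow> lift_at i v = 0"
  using selector(2)[of i] prod_annihilates_filt
  by (auto simp: dvd_def op_poly_mult[OF linear_K] mult.commute
      linear_0[OF linear_op_poly[OF linear_K]])
 
lemma lift_at_eigen: "linear L \<Longrightarrow> op_poly (\<pi> i) L v = 0 \<Longrightarrow> op_poly (selector i) L v = v"
proof -
  assume L: "linear L" "op_poly (\<pi> i) L v = 0"
  obtain u where u: "selector i = 1 - u * \<pi> i" using selector(1) by blast
  have "op_poly (selector i + u * \<pi> i) L v = v"
    by (simp add: u op_poly_1[OF L(1)])
  then show ?thesis
    by (simp add: op_poly_add[OF L(1)] op_poly_mult[OF L(1)] L(2) linear_0[OF linear_op_poly[OF L(1)]])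
qed

lemma lift_at_hom: "lift_at i (hom i v) - hom i v \<in> filt i"
  using op_poly_K_minus_C[OF hom_in_filt, of "selector i" i v]
  by (simp add: lift_at_eigen[OF linear_C annihilates])

text \<open>The inverse symbol map: a homogeneous vector goes to the vector with that leading part in the
  generalised eigenspace of its degree.\<close>

definition lift :: "'v \<Rightarrow> 'v" where
  "lift v = (\<Sum>i | hom i v \<noteq> 0. lift_at i (hom i v))"

lemma lift_eq_sum: "v \<in> filt m \<Longrightarrow> lift v = (\<Sum>i<m. lift_at i (hom i v))"
  unfolding lift_def
  by (rule sum.mono_neutral_left)
     (auto simp: filt_def linear_0[OF linear_lift_at] not_less[symmetric])

lemma linear_lift: "linear lift"
proof (rule linearI)
  fix u v
  obtain a b where "u \<in> filt a" "v \<in> filt b" using in_some_filt by blast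
  then have uv: "u \<in> filt (max a b)" "v \<in> filt (max a b)"
    using filt_mono[of a "max a b"] filt_mono[of b "max a b"] by auto
  then show "lift (u + v) = lift u + lift v"
    using subspace_add[OF subspace_filt uv]
    by (simp add: lift_eq_sum linear_add[OF linear_hom] linear_add[OF linear_lift_at] sum.distrib)
next
  fix c v
  obtain a where v: "v \<in> filt a" using in_some_filt by blast
  then show "lift (c *\<^sub>R v) = c *\<^sub>R lift v"
    by (simp add: lift_eq_sum[OF v] lift_eq_sum[OF subspace_scale[OF subspace_filt v]]
        linear_scale[OF linear_hom] linear_scale[OF linear_lift_at] scaleR_sum_right)
qed

lemma lift_hom: "lift (hom m v) = lift_at m (hom m v)"
proof -
  have "lift (hom m v) = (\<Sum>i<Suc m. lift_at i (hom i (hom m v)))"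
    by (rule lift_eq_sum[OF hom_in_filt])
  also have "\<dots> = (\<Sum>i<Suc m. if i = m then lift_at m (hom m v) else 0)"
    by (intro sum.cong) (auto simp: hom_hom linear_0[OF linear_lift_at])
  finally show ?thesis by simp
qed

lemma lift_filt: "v \<in> filt m \<Longrightarrow> lift v \<in> filt m"
proof -
  assume v: "v \<in> filt m"
  have "lift_at i (hom i v) \<in> filt m" if "i < m" for i
    using hom_in_filt[of i v] filt_mono[of "Suc i" m] that by (intro op_poly_filt) auto
  then show ?thesis
    unfolding lift_eq_sum[OF v] by (intro subspace_sum[OF subspace_filt]) auto
qed

lemma lift_minus_id: "v \<in> filt (Suc m) \<Longrightarrow> lift v - v \<in> filt m"
proof -
  assume v: "v \<in> filt (Suc m)"
  let ?w = "v - hom m v"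
  have "lift v - v = (lift ?w - ?w) + (lift_at m (hom m v) - hom m v)"
    by (simp add: linear_diff[OF linear_lift] lift_hom)
  also have "\<dots> \<in> filt m"
    using minus_top_in_filt[OF v]
    by (intro subspace_add[OF subspace_filt] lift_at_hom subspace_diff[OF subspace_filt lift_filt])
  finally show ?thesis .
qed

lemma lift_eq_0: "v \<in> filt m \<Longrightarrow> lift v = 0 \<Longrightarrow> v = 0"
proof (induction m)
  case (Suc m)
  then show ?case
    using lift_minus_id[OF Suc.prems(1)] subspace_neg[OF subspace_filt] by fastforce
qed (simp add: filt_0)

lemma inj_lift: "inj lift"
  using in_some_filt lift_eq_0 by (metis linear_injective_0[OF linear_lift])

text \<open>Inverts \<open>lift\<close> on degrees below \<open>m\<close> by peeling off leading parts. Only the projections onto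
  homogeneous components and polynomials in \<open>K\<close> occur, so that differential operators yield a
  differential operator.\<close>

primrec unlift :: "nat \<Rightarrow> 'v \<Rightarrow> 'v" where
  "unlift 0 v = 0"
| "unlift (Suc m) v = hom m v + unlift m (v - lift_at m (hom m v))"

lemma lift_unlift: "v \<in> filt m \<Longrightarrow> lift (unlift m v) = v"
proof (induction m arbitrary: v)
  case 0
  then show ?case by (simp add: filt_0 linear_0[OF linear_lift])
next
  case (Suc m)
  have "v - lift_at m (hom m v) = (v - hom m v) - (lift_at m (hom m v) - hom m v)"
    by simp
  also have "\<dots> \<in> filt m"
    by (intro subspace_diff[OF subspace_filt] minus_top_in_filt lift_at_hom Suc.prems)
  finally show ?case
    using Suc.IH by (simp add: linear_add[OF linear_lift] lift_hom)
qed

lemma bij_lift: "bij lift"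
  using inj_lift lift_unlift in_some_filt by (metis bijI surjI surj_def)

text \<open>The selector polynomials in \<open>K\<close> commute with \<open>A\<close>, and they kill the difference of \<open>A\<close> and \<open>B\<close>
  because it has lower degree.\<close>

lemma lift_equivariant:
  assumes A: "linear A" "linear B"
    and comm: "\<And>v. A (K v) = K (A v)"
    and hom: "\<And>i v. hom i (B v) = B (hom i v)"
    and diff: "\<And>m v. v \<in> filt (Suc m) \<Longrightarrow> A v - B v \<in> filt m"
  shows "A (lift v) = lift (B v)"
proof -
  obtain m where v: "v \<in> filt m" using in_some_filt by blast
  have Bv: "B v \<in> filt m" using v by (auto simp: filt_def hom linear_0[OF A(2)])
  have "A (lift_at i (hom i v)) = lift_at i (B (hom i v))" for i
  proof -
    have "A (lift_at i (hom i v)) = lift_at i (A (hom i v))"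
      by (rule op_poly_intertwine[OF linear_K linear_K A(1) comm])
    also have "\<dots> = lift_at i (A (hom i v) - B (hom i v)) + lift_at i (B (hom i v))"
      by (simp add: linear_diff[OF linear_lift_at])
    finally show ?thesis
      using lift_at_filt[OF diff[OF hom_in_filt]] by simp
  qed
  then show ?thesis
    by (simp add: lift_eq_sum[OF v] lift_eq_sum[OF Bv] linear_sum[OF A(1)] hom)
qed

text \<open>The selector is \<open>1\<close> modulo \<open>\<pi> i\<close>, so it fixes \<open>a\<close>; it kills the lower part of \<open>a\<close>.\<close>

lemma lift_unique:
  assumes "op_poly (\<pi> i) K a = 0" "a - hom i v \<in> filt i"
  shows "a = lift (hom i v)"
proof -
  have "a = lift_at i a" using lift_at_eigen[OF linear_K assms(1)] by simp
  also have "\<dots> = lift_at i (a - hom i v) + lift_at i (hom i v)"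
    by (simp add: linear_diff[OF linear_lift_at])
  finally show ?thesis by (simp add: lift_at_filt[OF assms(2)] lift_hom)
qed

end

section \<open>Casimir operators of gl and ladders of sl2\<close>

text \<open>The bracket with \<open>L c d\<close> is a derivation, and the four resulting sums cancel in pairs. The matrix
  units \<open>(a, b)\<close> and \<open>(b, a)\<close> are dual for the trace form, so the sum is the quadratic Casimir operator.\<close>

lemma gl_casimir_commutes:
  fixes L :: "'i::finite \<Rightarrow> 'i \<Rightarrow> 'v::real_vector \<Rightarrow> 'v"
  assumes lin: "\<And>a b. linear (L a b)"
    and bracket: "\<And>a b c d v. L a b (L c d v) - L c d (L a b v) =
      (if b = c then L a d v else 0) - (if d = a then L c b v else 0)"
  shows "L c d (\<Sum>a\<in>UNIV. \<Sum>b\<in>UNIV. L a b (L b a v)) = (\<Sum>a\<in>UNIV. \<Sum>b\<in>UNIV. L a b (L b a (L c d v)))"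
proof -
  have 1: "L c d (L a b w) = L a b (L c d w) + (if d = a then L c b w else 0)
      - (if b = c then L a d w else 0)"
    for a b w
    using bracket[of c d a b w] by (simp add: algebra_simps)
  have "L c d (L a b (L b a v)) = L a b (L b a (L c d v))
     + L a b (if d = b then L c a v else 0) - L a b (if a = c then L b d v else 0)
     + (if d = a then L c b (L b a v) else 0) - (if b = c then L a d (L b a v) else 0)" for a b
    unfolding 1[of a b] 1[of b a] by (simp add: linear_add[OF lin] linear_diff[OF lin])
  then have "L c d (L a b (L b a v)) = L a b (L b a (L c d v))
     + (if b = d then L a d (L c a v) else 0) - (if a = c then L c b (L b d v) else 0)
     + (if a = d then L c b (L b d v) else 0) - (if b = c then L a d (L c a v) else 0)" for a b
    by (auto simp: linear_0[OF lin])
  moreover have "(\<Sum>a\<in>UNIV. \<Sum>b\<in>UNIV. if a = e then f b else 0) = (\<Sum>b\<in>UNIV. f b)"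
    for e :: 'i and f :: "'i \<Rightarrow> 'v"
    by (subst sum.swap) simp
  ultimately show ?thesis
    by (simp add: linear_sum[OF lin] sum.distrib sum_subtractf)
qed

text \<open>On the bottom step \<open>C\<close> is the scalar \<open>g 0\<close>. On a higher step \<open>C - g l\<close> is a multiple of \<open>F E\<close>,
  and \<open>E\<close> leads one step down, where the product over the smaller indices vanishes; \<open>F\<close> commutes
  with \<open>C\<close> and carries this back.\<close>

lemma sl2_ladder_annihilates:
  fixes B :: "nat \<Rightarrow> 'v::real_vector set" and C E F :: "'v \<Rightarrow> 'v" and g :: "nat \<Rightarrow> real"
  assumes lin: "linear C" "linear E" "linear F"
    and B: "\<And>l. subspace (B l)"
    and C: "\<And>l v. v \<in> B l \<Longrightarrow> C v \<in> B l"
    and E: "\<And>l v. v \<in> B (Suc l) \<Longrightarrow> E v \<in> B l"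
    and E0: "\<And>v. v \<in> B 0 \<Longrightarrow> E v = 0"
    and CF: "\<And>l v. v \<in> B l \<Longrightarrow> C (F v) = F (C v)"
    and FE: "\<And>l v. v \<in> B l \<Longrightarrow> C v = g l *\<^sub>R v + 2 *\<^sub>R F (E v)"
  shows "v \<in> B l \<Longrightarrow> op_poly (\<Prod>p\<le>l. [:- g p, 1:]) C v = 0"
proof (induction l arbitrary: v)
  case 0
  then show ?case using FE[OF 0] E0[OF 0]
    by (simp add: op_poly_pCons[OF lin(1)] linear_0 lin)
next
  case (Suc l)
  let ?P = "\<Prod>p\<le>l. [:- g p, 1:]"
  have *: "op_poly p C (F u) = F (op_poly p C u) \<and> op_poly p C u \<in> B l" if "u \<in> B l" for p u
  proof (induction p)
    case 0
    then show ?case by (simp add: linear_0 lin subspace_0[OF B])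
  next
    case (pCons c p)
    then show ?case using that
      by (auto simp: op_poly_pCons[OF lin(1)] linear_add lin linear_scale CF
          intro!: subspace_add[OF B] subspace_scale[OF B] C)
  qed
  have "op_poly [:- g (Suc l), 1:] C v = 2 *\<^sub>R F (E v)"
    using FE[OF Suc.prems] by (simp add: op_poly_pCons[OF lin(1)] linear_0 lin)
  then have "op_poly (\<Prod>p\<le>Suc l. [:- g p, 1:]) C v = op_poly ?P C (2 *\<^sub>R F (E v))"
    by (simp only: prod.atMost_Suc op_poly_mult[OF lin(1)])
  also have "\<dots> = 2 *\<^sub>R F (op_poly ?P C (E v))"
    using *[OF E[OF Suc.prems]] by (simp add: linear_scale[OF linear_op_poly[OF lin(1)]])
  finally show ?case
    using Suc.IH[OF E[OF Suc.prems]] by (simp add: linear_0 lin)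
qed

section \<open>Finitely supported functions as real vector spaces\<close>

instantiation poly_mapping :: (type, real_vector) real_vector
begin

definition scaleR_poly_mapping :: "real \<Rightarrow> ('a \<Rightarrow>\<^sub>0 'b) \<Rightarrow> 'a \<Rightarrow>\<^sub>0 'b" where
  "scaleR_poly_mapping c = Poly_Mapping.map ((*\<^sub>R) c)"

lemma lookup_scaleR: "Poly_Mapping.lookup (c *\<^sub>R p) k = c *\<^sub>R Poly_Mapping.lookup p k"
  by (auto simp: scaleR_poly_mapping_def map.rep_eq when_def)

instance
  by standard (auto intro!: poly_mapping_eqI simp: lookup_scaleR lookup_add algebra_simps)

end

lemma scaleR_single: "c *\<^sub>R Poly_Mapping.single k b = Poly_Mapping.single k (c *\<^sub>R b)"
  by (auto intro!: poly_mapping_eqI simp: lookup_scaleR lookup_single when_def)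

lemma single_plus_induct [case_names single plus]:
  assumes "\<And>k c. P (Poly_Mapping.single k c)"
    and "\<And>p q. P p \<Longrightarrow> P q \<Longrightarrow> P (p + q)"
  shows "P (p :: 'a \<Rightarrow>\<^sub>0 'b::comm_monoid_add)"
proof (induction p rule: update_induct)
  case const
  show ?case using assms(1)[of undefined 0] by simp
next
  case (update f a b)
  have "Poly_Mapping.update a b f = Poly_Mapping.single a b + f"
    using update(1)
    by (auto intro!: poly_mapping_eqI simp: lookup_update lookup_add lookup_single in_keys_iff)
  then show ?case using assms update(3) by metis
qed

instance poly_mapping :: (comm_monoid_add, real_algebra_1) real_algebra_1
proof
  fix c :: real and p q :: "'a \<Rightarrow>\<^sub>0 'b"
  have 1: "c *\<^sub>R Poly_Mapping.single k b * q = c *\<^sub>R (Poly_Mapping.single k b * q)" for k b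
    by (induction q rule: single_plus_induct)
       (simp_all add: scaleR_single mult_single distrib_left scaleR_add_right)
  show "c *\<^sub>R p * q = c *\<^sub>R (p * q)"
    by (induction p rule: single_plus_induct) (simp_all add: 1 distrib_right scaleR_add_right)
  have 2: "Poly_Mapping.single k b * c *\<^sub>R q = c *\<^sub>R (Poly_Mapping.single k b * q)" for k b
    by (induction q rule: single_plus_induct)
       (simp_all add: scaleR_single mult_single distrib_left scaleR_add_right)
  show "p * c *\<^sub>R q = c *\<^sub>R (p * q)"
    by (induction p rule: single_plus_induct) (simp_all add: 2 distrib_right scaleR_add_right)
qed

lemma sum_single_keys: "(\<Sum>k\<in>Poly_Mapping.keys p. Poly_Mapping.single k (Poly_Mapping.lookup p k)) = p"
  by (rule poly_mapping_eqI)
     (auto simp: lookup_sum lookup_single when_def in_keys_iff)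

lemma linear_eq_on_singles:
  assumes "linear f" "linear g" "\<And>k c. f (Poly_Mapping.single k c) = g (Poly_Mapping.single k c)"
  shows "f p = g p"
  by (induction p rule: single_plus_induct)
     (simp_all add: assms(3) linear_add[OF assms(1)] linear_add[OF assms(2)])

text \<open>The operators \<open>D_alpha\<close>, \<open>D_beta\<close> and \<open>bidiff_of\<close> are given by sums over the keys of their
  argument. Such a sum is linear although the set of keys is not additive.\<close>

lemma linear_keys_sum:
  fixes f :: "'a \<Rightarrow> 'b::real_vector \<Rightarrow> 'c::real_vector"
  assumes f: "\<And>k. linear (f k)"
  shows "linear (\<lambda>p. \<Sum>k\<in>Poly_Mapping.keys p. f k (Poly_Mapping.lookup p k))"
proof (rule linearI)
  fix p q :: "'a \<Rightarrow>\<^sub>0 'b" and c :: real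
  show "(\<Sum>k\<in>Poly_Mapping.keys (p + q). f k (Poly_Mapping.lookup (p + q) k)) =
      (\<Sum>k\<in>Poly_Mapping.keys p. f k (Poly_Mapping.lookup p k)) +
      (\<Sum>k\<in>Poly_Mapping.keys q. f k (Poly_Mapping.lookup q k))"
    by (rule setsum_keys_plus_distrib) (simp_all add: linear_0[OF f] linear_add[OF f])
  have "(\<Sum>k\<in>Poly_Mapping.keys (c *\<^sub>R p). f k (Poly_Mapping.lookup (c *\<^sub>R p) k)) =
      (\<Sum>k\<in>Poly_Mapping.keys p. f k (Poly_Mapping.lookup (c *\<^sub>R p) k))"
    by (rule sum.mono_neutral_left) (auto simp: in_keys_iff lookup_scaleR linear_0[OF f])
  then show "(\<Sum>k\<in>Poly_Mapping.keys (c *\<^sub>R p). f k (Poly_Mapping.lookup (c *\<^sub>R p) k)) =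
      c *\<^sub>R (\<Sum>k\<in>Poly_Mapping.keys p. f k (Poly_Mapping.lookup p k))"
    by (simp add: lookup_scaleR linear_scale[OF f] scaleR_sum_right)
qed

lemma keys_sum_single:
  fixes f :: "'a \<Rightarrow> 'b::real_vector \<Rightarrow> 'c::real_vector"
  assumes f: "\<And>k. linear (f k)"
  shows "(\<Sum>k\<in>Poly_Mapping.keys (Poly_Mapping.single l c). f k (Poly_Mapping.lookup (Poly_Mapping.single l c) k)) = f l c"
  by (simp add: linear_0[OF f])

section \<open>The ring of smooth functions\<close>

lemma pdiff_add: "pdiff i (f + g) = pdiff i f + pdiff i g"
  by transfer (simp add: partial_deriv_add smooth_differentiable)

lemma pdiff_mult: "pdiff i (f * g) = f * pdiff i g + pdiff i f * g"
  by transfer (simp add: partial_deriv_mult smooth_differentiable)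

lemma pdiff_scaleR: "pdiff i (c *\<^sub>R f) = c *\<^sub>R pdiff i f"
  by transfer (simp add: partial_deriv_mult smooth_differentiable smooth_const[THEN smooth_differentiable] partial_deriv_const)

lemma linear_pdiff: "linear (pdiff i)"
  by (rule linearI) (rule pdiff_add pdiff_scaleR)+

lemma pdiff_0 [simp]: "pdiff i 0 = 0"
  by (rule linear_0[OF linear_pdiff])

lemma pdiff_1 [simp]: "pdiff i 1 = 0"
  by transfer (rule partial_deriv_const)

lemma pdiff_coordinate: "pdiff j (coordinate i) = (if i = j then 1 else 0)"
proof transfer
  fix i j :: 'a
  have "partial_deriv j (\<lambda>x :: real ^ 'a. x $ i) = (\<lambda>x. axis j 1 $ i)"
    by (rule partial_deriv_eqI) (rule bounded_linear_imp_has_derivative, rule bounded_linear_vec_nth)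
  then show "partial_deriv j (\<lambda>x. x $ i) = (if i = j then \<lambda>x. 1 else (\<lambda>x. 0))"
    by (auto simp: axis_def)
qed

section \<open>The calculus of symbols\<close>

lemma linear_times_left: "linear ((*) (q :: 'a::real_algebra))"
  by (rule linearI) (simp_all add: distrib_left)

lemma linear_single: "linear (Poly_Mapping.single k)"
  by (rule linearI) (simp_all add: single_add scaleR_single)

lemma linear_weighted_single:
  fixes c :: "'b::real_algebra"
  shows "linear (\<lambda>x. Poly_Mapping.single k (c * x))"
  by (rule linearI) (simp_all add: single_add scaleR_single distrib_left)

lemma linear_D_alpha: "linear (D_alpha j)"
  unfolding D_alpha_def by (rule linear_keys_sum) (rule linear_weighted_single)

lemma linear_D_beta: "linear (D_beta j)"
  unfolding D_beta_def by (rule linear_keys_sum) (rule linear_weighted_single)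

lemma D_alpha_single:
  "D_alpha j (Poly_Mapping.single (a, b) c) = Poly_Mapping.single (a - axis j 1, b) (of_nat (a $ j) * c)"
  unfolding D_alpha_def by (subst keys_sum_single) (simp_all add: linear_weighted_single)

lemma D_beta_single:
  "D_beta j (Poly_Mapping.single (a, b) c) = Poly_Mapping.single (a, b - axis j 1) (of_nat (b $ j) * c)"
  unfolding D_beta_def by (subst keys_sum_single) (simp_all add: linear_weighted_single)

lemma lookup_coeff_pdiff: "Poly_Mapping.lookup (coeff_pdiff i P) k = pdiff i (Poly_Mapping.lookup P k)"
  by (auto simp: coeff_pdiff_def map.rep_eq when_def)

lemma linear_coeff_pdiff: "linear (coeff_pdiff i)"
  by (rule linearI)
     (auto intro!: poly_mapping_eqI simp: lookup_coeff_pdiff lookup_add lookup_scaleR pdiff_add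
         pdiff_scaleR)

lemma coeff_pdiff_single: "coeff_pdiff i (Poly_Mapping.single k c) = Poly_Mapping.single k (pdiff i c)"
  by (auto intro!: poly_mapping_eqI simp: lookup_coeff_pdiff lookup_single when_def)

lemma const_symbol_times_single: "const_symbol f * Poly_Mapping.single k c = Poly_Mapping.single k (f * c)"
  by (simp add: const_symbol_def mult_single)

lemma alpha_times_single: "alpha i * Poly_Mapping.single (a, b) c = Poly_Mapping.single (a + axis i 1, b) c"
  by (simp add: alpha_def mult_single add.commute)

lemma beta_times_single: "beta i * Poly_Mapping.single (a, b) c = Poly_Mapping.single (a, b + axis i 1) c"
  by (simp add: beta_def mult_single add.commute)

lemma const_symbol_0 [simp]: "const_symbol 0 = 0"
  by (simp add: const_symbol_def)

lemma const_symbol_1 [simp]: "const_symbol 1 = 1"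
  by (simp add: const_symbol_def)

lemma const_symbol_add: "const_symbol (f + g) = const_symbol f + const_symbol g"
  by (simp add: const_symbol_def single_add)

lemma const_symbol_uminus: "const_symbol (- f) = - const_symbol f"
  by (simp add: const_symbol_def single_uminus)

lemma const_symbol_mult: "const_symbol (f * g) = const_symbol f * const_symbol g"
  by (simp add: const_symbol_def mult_single)

lemma const_symbol_scaleR: "const_symbol (c *\<^sub>R f) = c *\<^sub>R const_symbol f"
  by (simp add: const_symbol_def scaleR_single)

lemma linear_const_symbol: "linear const_symbol"
  by (rule linearI) (rule const_symbol_add const_symbol_scaleR)+

lemmas symbol_linear_simps =
  linear_add[OF linear_D_alpha] linear_add[OF linear_D_beta] linear_add[OF linear_coeff_pdiff]
  linear_diff[OF linear_D_alpha] linear_diff[OF linear_D_beta] linear_diff[OF linear_coeff_pdiff]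
  linear_neg[OF linear_D_alpha] linear_neg[OF linear_D_beta] linear_neg[OF linear_coeff_pdiff]
  linear_scale[OF linear_D_alpha] linear_scale[OF linear_D_beta] linear_scale[OF linear_coeff_pdiff]
  linear_sum[OF linear_D_alpha] linear_sum[OF linear_D_beta] linear_sum[OF linear_coeff_pdiff]
  linear_0[OF linear_D_alpha] linear_0[OF linear_D_beta] linear_0[OF linear_coeff_pdiff]

lemmas symbol_single_simps =
  D_alpha_single D_beta_single coeff_pdiff_single const_symbol_times_single alpha_times_single
  beta_times_single

lemma multi_index_add_sub: "(a::'n::finite multi_index) + axis i 1 - axis i 1 = a"
  by (simp add: vec_eq_iff)

lemma multi_index_sub_add: "(a::'n::finite multi_index) $ i \<noteq> 0 \<Longrightarrow> a - axis i 1 + axis i 1 = a"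
  by (auto simp: vec_eq_iff axis_def)

lemma multi_index_swap:
  "i \<noteq> j \<Longrightarrow> (a::'n::finite multi_index) + axis j 1 - axis i 1 = a - axis i 1 + axis j 1"
  by (auto simp: vec_eq_iff axis_def)

lemma multi_index_sub_commute: "(a::'n::finite multi_index) - axis i 1 - axis j 1 = a - axis j 1 - axis i 1"
  by (auto simp: vec_eq_iff)

lemma axis_1_nth: "(axis j 1 :: nat ^ 'n::finite) $ i = (if i = j then 1 else 0)"
  by (auto simp: axis_def)

text \<open>Together with the following lemmas: the Weyl algebra relations between the operators on symbols.
  Each side is linear in \<open>P\<close>, so monomials suffice; the truncated subtraction of exponents is
  harmless because the factor \<open>a $ j\<close> vanishes where it truncates.\<close>

lemma D_alpha_times_alpha: "D_alpha i (alpha j * P) = alpha j * D_alpha i P + (if i = j then P else 0)"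
proof (rule linear_eq_on_singles[where f = "\<lambda>P. D_alpha i (alpha j * P)" and
    g = "\<lambda>P. alpha j * D_alpha i P + (if i = j then P else 0)"])
  fix k and c :: "'a smooth_fun"
  show "D_alpha i (alpha j * Poly_Mapping.single k c) =
      alpha j * D_alpha i (Poly_Mapping.single k c) + (if i = j then Poly_Mapping.single k c else 0)"
  proof (cases k)
    case (Pair a b)
    show ?thesis
    proof (cases "i = j \<and> a $ i \<noteq> 0")
      case True
      then show ?thesis
        by (auto simp: Pair symbol_single_simps axis_1_nth multi_index_add_sub multi_index_sub_add
            distrib_right single_add simp del: One_nat_def)
    next
      case False
      then show ?thesis
        by (auto simp: Pair symbol_single_simps axis_1_nth multi_index_add_sub multi_index_swap
              simp del: One_nat_def)
    qed
  qed
qed (auto intro!: linearI simp: symbol_linear_simps distrib_left scaleR_add_right)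

lemma D_beta_times_beta: "D_beta i (beta j * P) = beta j * D_beta i P + (if i = j then P else 0)"
proof (rule linear_eq_on_singles[where f = "\<lambda>P. D_beta i (beta j * P)" and
    g = "\<lambda>P. beta j * D_beta i P + (if i = j then P else 0)"])
  fix k and c :: "'a smooth_fun"
  show "D_beta i (beta j * Poly_Mapping.single k c) =
      beta j * D_beta i (Poly_Mapping.single k c) + (if i = j then Poly_Mapping.single k c else 0)"
  proof (cases k)
    case (Pair a b)
    show ?thesis
    proof (cases "i = j \<and> b $ i \<noteq> 0")
      case True
      then show ?thesis
        by (auto simp: Pair symbol_single_simps axis_1_nth multi_index_add_sub multi_index_sub_add
            distrib_right single_add simp del: One_nat_def)
    next
      case False
      then show ?thesis
        by (auto simp: Pair symbol_single_simps axis_1_nth multi_index_add_sub multi_index_swap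
              simp del: One_nat_def)
    qed
  qed
qed (auto intro!: linearI simp: symbol_linear_simps distrib_left scaleR_add_right)

lemma D_alpha_times_beta: "D_alpha i (beta j * P) = beta j * D_alpha i P"
  by (rule linear_eq_on_singles[where f = "\<lambda>P. D_alpha i (beta j * P)"])
     (auto intro!: linearI simp: symbol_linear_simps distrib_left symbol_single_simps)

lemma D_beta_times_alpha: "D_beta i (alpha j * P) = alpha j * D_beta i P"
  by (rule linear_eq_on_singles[where f = "\<lambda>P. D_beta i (alpha j * P)"])
     (auto intro!: linearI simp: symbol_linear_simps distrib_left symbol_single_simps)

lemma D_alpha_times_const: "D_alpha i (const_symbol f * P) = const_symbol f * D_alpha i P"
  by (rule linear_eq_on_singles[where f = "\<lambda>P. D_alpha i (const_symbol f * P)"])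
     (auto intro!: linearI simp: symbol_linear_simps distrib_left symbol_single_simps mult.left_commute)

lemma D_beta_times_const: "D_beta i (const_symbol f * P) = const_symbol f * D_beta i P"
  by (rule linear_eq_on_singles[where f = "\<lambda>P. D_beta i (const_symbol f * P)"])
     (auto intro!: linearI simp: symbol_linear_simps distrib_left symbol_single_simps mult.left_commute)

lemma coeff_pdiff_times_alpha: "coeff_pdiff i (alpha j * P) = alpha j * coeff_pdiff i P"
  by (rule linear_eq_on_singles[where f = "\<lambda>P. coeff_pdiff i (alpha j * P)"])
     (auto intro!: linearI simp: symbol_linear_simps distrib_left symbol_single_simps)

lemma coeff_pdiff_times_beta: "coeff_pdiff i (beta j * P) = beta j * coeff_pdiff i P"
  by (rule linear_eq_on_singles[where f = "\<lambda>P. coeff_pdiff i (beta j * P)"])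
     (auto intro!: linearI simp: symbol_linear_simps distrib_left symbol_single_simps)

lemma coeff_pdiff_times_const:
  "coeff_pdiff i (const_symbol f * P) = const_symbol f * coeff_pdiff i P + const_symbol (pdiff i f) * P"
  by (rule linear_eq_on_singles[where f = "\<lambda>P. coeff_pdiff i (const_symbol f * P)"])
     (auto intro!: linearI simp: symbol_linear_simps distrib_left symbol_single_simps scaleR_add_right
        pdiff_mult single_add)

lemma D_alpha_commute: "D_alpha i (D_alpha j P) = D_alpha j (D_alpha i P)"
proof (rule linear_eq_on_singles[where f = "\<lambda>P. D_alpha i (D_alpha j P)"])
  fix k and c :: "'a smooth_fun"
  show "D_alpha i (D_alpha j (Poly_Mapping.single k c)) = D_alpha j (D_alpha i (Poly_Mapping.single k c))"
    by (cases k; cases "i = j")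
       (simp_all add: symbol_single_simps axis_1_nth multi_index_sub_commute[of _ i j]
           mult.left_commute del: One_nat_def)
qed (auto intro!: linearI simp: symbol_linear_simps)

lemma D_beta_commute: "D_beta i (D_beta j P) = D_beta j (D_beta i P)"
proof (rule linear_eq_on_singles[where f = "\<lambda>P. D_beta i (D_beta j P)"])
  fix k and c :: "'a smooth_fun"
  show "D_beta i (D_beta j (Poly_Mapping.single k c)) = D_beta j (D_beta i (Poly_Mapping.single k c))"
    by (cases k; cases "i = j")
       (simp_all add: symbol_single_simps axis_1_nth multi_index_sub_commute[of _ i j]
           mult.left_commute del: One_nat_def)
qed (auto intro!: linearI simp: symbol_linear_simps)

lemma D_alpha_D_beta: "D_alpha i (D_beta j P) = D_beta j (D_alpha i P)"
  by (rule linear_eq_on_singles[where f = "\<lambda>P. D_alpha i (D_beta j P)"])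
     (auto intro!: linearI simp: symbol_linear_simps symbol_single_simps mult.left_commute)

lemma pdiff_of_nat_mult: "pdiff i (of_nat m * c) = of_nat m * pdiff i c"
  by (induction m) (simp_all add: pdiff_add distrib_right)

lemma D_alpha_coeff_pdiff: "D_alpha i (coeff_pdiff j P) = coeff_pdiff j (D_alpha i P)"
  by (rule linear_eq_on_singles[where f = "\<lambda>P. D_alpha i (coeff_pdiff j P)"])
     (auto intro!: linearI simp: symbol_linear_simps symbol_single_simps pdiff_of_nat_mult)

lemma D_beta_coeff_pdiff: "D_beta i (coeff_pdiff j P) = coeff_pdiff j (D_beta i P)"
  by (rule linear_eq_on_singles[where f = "\<lambda>P. D_beta i (coeff_pdiff j P)"])
     (auto intro!: linearI simp: symbol_linear_simps symbol_single_simps pdiff_of_nat_mult)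

lemma coeff_pdiff_commute: "coeff_pdiff i (coeff_pdiff j P) = coeff_pdiff j (coeff_pdiff i P)"
  by (rule poly_mapping_eqI) (simp add: lookup_coeff_pdiff pdiff_commute)

section \<open>Bidegrees\<close>

definition bidegree :: "'n::finite multi_index \<times> 'n multi_index \<Rightarrow> nat \<times> nat" where
  "bidegree k = (\<Sum>i\<in>UNIV. fst k $ i, \<Sum>i\<in>UNIV. snd k $ i)"

lemma monomial_degree_bidegree: "monomial_degree k = fst (bidegree k) + snd (bidegree k)"
  by (simp add: monomial_degree_def bidegree_def)

text \<open>Carries the degree, the bidegree and the order filtration at once: each is the case of a
  suitable set \<open>D\<close>.\<close>

definition supported :: "(nat \<times> nat) set \<Rightarrow> 'n::finite symbol set" where
  "supported D = {P. \<forall>k. bidegree k \<notin> D \<longrightarrow> Poly_Mapping.lookup P k = 0}"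

lemma subspace_supported: "subspace (supported D)"
  by (auto simp: subspace_def supported_def lookup_add lookup_scaleR)

lemma single_supported: "bidegree k \<in> D \<Longrightarrow> Poly_Mapping.single k c \<in> supported D"
  by (auto simp: supported_def lookup_single when_def)

lemma supported_linear_image:
  assumes P: "P \<in> supported D" and T: "linear T" and S: "subspace S"
    and single: "\<And>k c. bidegree k \<in> D \<Longrightarrow> T (Poly_Mapping.single k c) \<in> S"
  shows "T P \<in> S"
proof -
  have "T P = (\<Sum>k\<in>Poly_Mapping.keys P. T (Poly_Mapping.single k (Poly_Mapping.lookup P k)))"
    by (metis (no_types, lifting) linear_sum[OF T] sum_single_keys sum.cong)
  also have "\<dots> \<in> S"
    using P by (intro subspace_sum[OF S] single) (auto simp: supported_def in_keys_iff)
  finally show ?thesis .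
qed

lemma sum_axis_1: "(\<Sum>i\<in>UNIV. (axis j 1 :: nat ^ 'n::finite) $ i) = 1"
  by (simp add: axis_1_nth del: One_nat_def)

lemma bidegree_add_alpha: "bidegree (a + axis i 1, b) =
    (Suc (fst (bidegree (a, b))), snd (bidegree (a, b)))"
  by (simp add: bidegree_def sum.distrib sum_axis_1 del: One_nat_def)

lemma bidegree_add_beta: "bidegree (a, b + axis i 1) = (fst (bidegree (a, b)), Suc (snd (bidegree (a, b))))"
  by (simp add: bidegree_def sum.distrib sum_axis_1 del: One_nat_def)

lemma alpha_supported:
  assumes "P \<in> supported D" "\<And>k l. (k, l) \<in> D \<Longrightarrow> (Suc k, l) \<in> D'"
  shows "alpha i * P \<in> supported D'"
  using assms(1)
  by (rule supported_linear_image[OF _ linear_times_left subspace_supported])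
     (force simp: alpha_times_single bidegree_add_alpha simp del: One_nat_def
        intro!: single_supported intro: assms(2))

lemma beta_supported:
  assumes "P \<in> supported D" "\<And>k l. (k, l) \<in> D \<Longrightarrow> (k, Suc l) \<in> D'"
  shows "beta i * P \<in> supported D'"
  using assms(1)
  by (rule supported_linear_image[OF _ linear_times_left subspace_supported])
     (force simp: beta_times_single bidegree_add_beta simp del: One_nat_def
        intro!: single_supported intro: assms(2))

lemma const_supported: "P \<in> supported D \<Longrightarrow> const_symbol f * P \<in> supported D"
  by (rule supported_linear_image[OF _ linear_times_left subspace_supported])
     (auto simp: const_symbol_times_single intro!: single_supported)

lemma coeff_pdiff_supported: "P \<in> supported D \<Longrightarrow> coeff_pdiff i P \<in> supported D"
  by (rule supported_linear_image[OF _ linear_coeff_pdiff subspace_supported])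
     (auto simp: coeff_pdiff_single intro!: single_supported)

lemma D_alpha_supported:
  assumes "P \<in> supported D" "\<And>k l. (Suc k, l) \<in> D \<Longrightarrow> (k, l) \<in> D'"
  shows "D_alpha i P \<in> supported D'"
  using assms(1)
proof (rule supported_linear_image[OF _ linear_D_alpha subspace_supported])
  fix k :: "'a multi_index \<times> 'a multi_index" and c
  assume k: "bidegree k \<in> D"
  obtain a b where ab: "k = (a, b)" by (cases k)
  show "D_alpha i (Poly_Mapping.single k c) \<in> supported D'"
  proof (cases "a $ i = 0")
    case True
    then show ?thesis by (simp add: ab D_alpha_single subspace_0[OF subspace_supported])
  next
    case False
    then have "bidegree k = (Suc (fst (bidegree (a - axis i 1, b))), snd (bidegree (a - axis i 1, b)))"
      by (metis ab bidegree_add_alpha multi_index_sub_add)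
    then have "bidegree (a - axis i 1, b) \<in> D'"
      using k assms(2) by (metis prod.collapse)
    then show ?thesis by (simp add: ab D_alpha_single single_supported)
  qed
qed

lemma D_beta_supported:
  assumes "P \<in> supported D" "\<And>k l. (k, Suc l) \<in> D \<Longrightarrow> (k, l) \<in> D'"
  shows "D_beta i P \<in> supported D'"
  using assms(1)
proof (rule supported_linear_image[OF _ linear_D_beta subspace_supported])
  fix k :: "'a multi_index \<times> 'a multi_index" and c
  assume k: "bidegree k \<in> D"
  obtain a b where ab: "k = (a, b)" by (cases k)
  show "D_beta i (Poly_Mapping.single k c) \<in> supported D'"
  proof (cases "b $ i = 0")
    case True
    then show ?thesis by (simp add: ab D_beta_single subspace_0[OF subspace_supported])
  next
    case False
    then have "bidegree k = (fst (bidegree (a, b - axis i 1)), Suc (snd (bidegree (a, b - axis i 1))))"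
      by (metis ab bidegree_add_beta multi_index_sub_add)
    then have "bidegree (a, b - axis i 1) \<in> D'"
      using k assms(2) by (metis prod.collapse)
    then show ?thesis by (simp add: ab D_beta_single single_supported)
  qed
qed

lemma supported_empty: "P \<in> supported {} \<longleftrightarrow> P = 0"
  by (auto simp: supported_def intro: poly_mapping_eqI)

lemma supported_mono: "D \<subseteq> D' \<Longrightarrow> P \<in> supported D \<Longrightarrow> P \<in> supported D'"
  by (auto simp: supported_def)

lemma times_D_single:
  "alpha i * D_alpha i (Poly_Mapping.single (a, b) c) = Poly_Mapping.single (a, b) (of_nat (a $ i) * c)"
  "beta i * D_beta i (Poly_Mapping.single (a, b) c) = Poly_Mapping.single (a, b) (of_nat (b $ i) * c)"
  by (cases "a $ i = 0", simp_all add: symbol_single_simps multi_index_sub_add del: One_nat_def)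
     (cases "b $ i = 0", simp_all add: symbol_single_simps multi_index_sub_add del: One_nat_def)

lemma of_nat_times_smooth: "of_nat m * (c :: 'n::finite smooth_fun) = real m *\<^sub>R c"
  by (simp add: scaleR_conv_of_real)

lemma euler_bidegree:
  assumes "P \<in> supported {(k, l)}"
  shows "(\<Sum>i\<in>UNIV. alpha i * D_alpha i P) = real k *\<^sub>R P"
    and "(\<Sum>i\<in>UNIV. beta i * D_beta i P) = real l *\<^sub>R P"
proof -
  have lin: "linear (\<lambda>P. (\<Sum>i\<in>UNIV. alpha i * D_alpha i P) - real k *\<^sub>R P)"
    "linear (\<lambda>P. (\<Sum>i\<in>UNIV. beta i * D_beta i P) - real l *\<^sub>R P)"
    by (auto intro!: linearI simp: symbol_linear_simps distrib_left sum.distrib scaleR_add_right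
        scaleR_sum_right scaleR_diff_right)
  have "(\<Sum>i\<in>UNIV. alpha i * D_alpha i P) - real k *\<^sub>R P \<in> {0}"
    using assms
    by (rule supported_linear_image[OF _ lin(1) subspace_single_0])
       (auto simp: times_D_single bidegree_def scaleR_single of_nat_times_smooth
          linear_sum[OF linear_single, symmetric] scaleR_left.sum[symmetric])
  then show "(\<Sum>i\<in>UNIV. alpha i * D_alpha i P) = real k *\<^sub>R P" by simp
  have "(\<Sum>i\<in>UNIV. beta i * D_beta i P) - real l *\<^sub>R P \<in> {0}"
    using assms
    by (rule supported_linear_image[OF _ lin(2) subspace_single_0])
       (auto simp: times_D_single bidegree_def scaleR_single of_nat_times_smooth
          linear_sum[OF linear_single, symmetric] scaleR_left.sum[symmetric])
  then show "(\<Sum>i\<in>UNIV. beta i * D_beta i P) = real l *\<^sub>R P" by simp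
qed

section \<open>Bidifferential operators and their polynomial forms\<close>

lemma fold_pdiff_insert:
  assumes "finite S" "i \<notin> S"
  shows "Finite_Set.fold (\<lambda>k. pdiff k ^^ (a $ k)) f (insert i S) =
    (pdiff i ^^ (a $ i)) (Finite_Set.fold (\<lambda>k. pdiff k ^^ (a $ k)) f S)"
proof -
  interpret comp_fun_commute "\<lambda>k. pdiff k ^^ (a $ k)" by (rule comp_fun_commute_pdiff)
  show ?thesis using assms by simp
qed

lemma multi_deriv_0 [simp]: "multi_deriv 0 f = f"
proof -
  have "Finite_Set.fold (\<lambda>k. pdiff k ^^ ((0 :: 'a multi_index) $ k)) f S = f" if "finite S" for S
    using that
  proof induction
    case (insert x S)
    then show ?case using fold_pdiff_insert[OF insert(1,2), of "0 :: 'a multi_index" f]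
        by (simp add: id_def)
  qed simp
  then show ?thesis by (simp add: multi_deriv_def)
qed

lemma multi_deriv_add_axis: "multi_deriv (a + axis i 1) f = pdiff i (multi_deriv a f)"
proof -
  have eq: "Finite_Set.fold (\<lambda>k. pdiff k ^^ ((a + axis i 1) $ k)) f S =
      Finite_Set.fold (\<lambda>k. pdiff k ^^ (a $ k)) f S" if "finite S" "i \<notin> S" for S
    using that by induction (auto simp: fold_pdiff_insert axis_def simp del: vector_add_component, auto)
  have "multi_deriv b f = (pdiff i ^^ (b $ i))
      (Finite_Set.fold (\<lambda>k. pdiff k ^^ (b $ k)) f (UNIV - {i}))" for b
    unfolding multi_deriv_def by (subst fold_pdiff_insert[symmetric]) (simp_all add: insert_absorb)
  note md = this
  have "Finite_Set.fold (\<lambda>k. pdiff k ^^ ((a + axis i 1) $ k)) f (UNIV - {i}) =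
      Finite_Set.fold (\<lambda>k. pdiff k ^^ (a $ k)) f (UNIV - {i})"
    by (rule eq) auto
  then show ?thesis
    unfolding md[of "a + axis i 1"] md[of a] by (simp only:) (simp add: axis_def)
qed

lemma multi_index_induct [case_names zero add]:
  fixes a :: "'n::finite multi_index"
  assumes zero: "P 0" and add: "\<And>a i. P a \<Longrightarrow> P (a + axis i 1)"
  shows "P a"
proof (induction "\<Sum>i\<in>UNIV. a $ i" arbitrary: a)
  case 0
  then have "a = 0" by (simp add: vec_eq_iff)
  then show ?case using zero by simp
next
  case (Suc m)
  then obtain i where i: "a $ i \<noteq> 0" by (metis sum.neutral nat.distinct(1))
  have a: "a - axis i 1 + axis i 1 = a" by (rule multi_index_sub_add[OF i])
  have "(\<Sum>k\<in>UNIV. (a - axis i 1 + axis i 1) $ k) = Suc (\<Sum>k\<in>UNIV. (a - axis i 1) $ k)"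
    by (simp only: vector_add_component sum.distrib sum_axis_1)
  then have "m = (\<Sum>k\<in>UNIV. (a - axis i 1) $ k)"
    using Suc.hyps(2) unfolding a by simp
  from add[OF Suc.hyps(1)[OF this], of i] show ?case unfolding a .
qed

lemma linear_multi_deriv: "linear (multi_deriv a)"
  by (induction a rule: multi_index_induct)
     (auto intro!: linearI simp: multi_deriv_add_axis linear_add linear_scale pdiff_add pdiff_scaleR
        simp del: One_nat_def)

lemma multi_deriv_pdiff: "multi_deriv a (pdiff j f) = pdiff j (multi_deriv a f)"
  by (induction a rule: multi_index_induct)
     (simp_all add: multi_deriv_add_axis pdiff_commute[of j] del: One_nat_def)

lemma pdiff_of_nat [simp]: "pdiff i (of_nat m) = 0"
  by (induction m) (simp_all add: pdiff_add)

text \<open>The Leibniz rule; it makes multiplication of the argument by a coordinate visible as a derivative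
  of the symbol.\<close>

lemma multi_deriv_coordinate:
  "multi_deriv a (coordinate j * f) =
     coordinate j * multi_deriv a f + of_nat (a $ j) * multi_deriv (a - axis j 1) f"
proof (induction a rule: multi_index_induct)
  case zero
  then show ?case by simp
next
  case (add a i)
  have "of_nat (a $ j) * pdiff i (multi_deriv (a - axis j 1) f) =
    of_nat (a $ j) * multi_deriv (a + axis i 1 - axis j 1) f"
    by (cases "a $ j = 0"; cases "i = j")
       (simp_all add: multi_deriv_add_axis[symmetric] multi_index_sub_add multi_index_add_sub
          multi_index_swap del: One_nat_def)
  then show ?case
    by (cases "i = j")
       (simp_all add: multi_deriv_add_axis add pdiff_add pdiff_mult pdiff_coordinate axis_1_nth
         multi_index_add_sub pdiff_of_nat_mult distrib_right del: One_nat_def)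
qed

lemma linear_smooth_mult: "linear (\<lambda>c :: 'n::finite smooth_fun. c * f * g)"
  by (rule linearI) (simp_all add: distrib_right)

lemma linear_bidiff_of: "linear (\<lambda>A. bidiff_of A f g)"
  unfolding bidiff_of_def by (rule linear_keys_sum) (rule linear_smooth_mult)

lemma bidiff_of_single: "bidiff_of (Poly_Mapping.single (a, b) c) f g =
    c * multi_deriv a f * multi_deriv b g"
  unfolding bidiff_of_def by (subst keys_sum_single) (simp_all add: linear_smooth_mult)

lemmas bidiff_of_linear_simps =
  linear_add[OF linear_bidiff_of] linear_diff[OF linear_bidiff_of] linear_neg[OF linear_bidiff_of]
  linear_scale[OF linear_bidiff_of] linear_sum[OF linear_bidiff_of] linear_0[OF linear_bidiff_of]

lemma linear_bidiff_of_left: "linear (\<lambda>f. bidiff_of A f g)"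
  unfolding bidiff_of_def
  by (rule linearI)
     (simp_all add: linear_add[OF linear_multi_deriv] linear_scale[OF linear_multi_deriv]
       distrib_left distrib_right sum.distrib scaleR_sum_right)

lemma linear_bidiff_of_right: "linear (\<lambda>g. bidiff_of A f g)"
  unfolding bidiff_of_def
  by (rule linearI)
     (simp_all add: linear_add[OF linear_multi_deriv] linear_scale[OF linear_multi_deriv]
       distrib_left distrib_right sum.distrib scaleR_sum_right)

lemmas bidiff_of_arg_simps =
  linear_add[OF linear_bidiff_of_left] linear_add[OF linear_bidiff_of_right]
  linear_diff[OF linear_bidiff_of_left] linear_diff[OF linear_bidiff_of_right]
  linear_neg[OF linear_bidiff_of_left] linear_neg[OF linear_bidiff_of_right]
  linear_scale[OF linear_bidiff_of_left] linear_scale[OF linear_bidiff_of_right]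
  linear_sum[OF linear_bidiff_of_left] linear_sum[OF linear_bidiff_of_right]

lemma bidiff_of_const: "bidiff_of (const_symbol \<phi> * A) f g = \<phi> * bidiff_of A f g"
proof (rule linear_eq_on_singles[where f = "\<lambda>A. bidiff_of (const_symbol \<phi> * A) f g"])
  fix k c
  show "bidiff_of (const_symbol \<phi> * Poly_Mapping.single k c) f g =
      \<phi> * bidiff_of (Poly_Mapping.single k c) f g"
    by (cases k) (simp add: const_symbol_times_single bidiff_of_single mult.assoc)
qed (auto intro!: linearI simp: bidiff_of_linear_simps distrib_left)

lemma bidiff_of_alpha: "bidiff_of (alpha j * A) f g = bidiff_of A (pdiff j f) g"
proof (rule linear_eq_on_singles[where f = "\<lambda>A. bidiff_of (alpha j * A) f g"])
  fix k c
  show "bidiff_of (alpha j * Poly_Mapping.single k c) f g =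
      bidiff_of (Poly_Mapping.single k c) (pdiff j f) g"
    by (cases k) (simp add: alpha_times_single bidiff_of_single multi_deriv_add_axis multi_deriv_pdiff
        del: One_nat_def)
qed (auto intro!: linearI simp: bidiff_of_linear_simps distrib_left)

lemma bidiff_of_beta: "bidiff_of (beta j * A) f g = bidiff_of A f (pdiff j g)"
proof (rule linear_eq_on_singles[where f = "\<lambda>A. bidiff_of (beta j * A) f g"])
  fix k c
  show "bidiff_of (beta j * Poly_Mapping.single k c) f g =
      bidiff_of (Poly_Mapping.single k c) f (pdiff j g)"
    by (cases k) (simp add: beta_times_single bidiff_of_single multi_deriv_add_axis multi_deriv_pdiff
        del: One_nat_def)
qed (auto intro!: linearI simp: bidiff_of_linear_simps distrib_left)

lemma pdiff_bidiff_of: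
  "pdiff j (bidiff_of A f g) =
     bidiff_of (coeff_pdiff j A) f g + bidiff_of A (pdiff j f) g + bidiff_of A f (pdiff j g)"
proof (rule linear_eq_on_singles[where f = "\<lambda>A. pdiff j (bidiff_of A f g)"])
  fix k c
  show "pdiff j (bidiff_of (Poly_Mapping.single k c) f g) =
     bidiff_of (coeff_pdiff j (Poly_Mapping.single k c)) f g +
     bidiff_of (Poly_Mapping.single k c) (pdiff j f) g + bidiff_of (Poly_Mapping.single k c) f (pdiff j g)"
    by (cases k)
       (simp add: coeff_pdiff_single bidiff_of_single multi_deriv_pdiff pdiff_mult algebra_simps)
qed (auto intro!: linearI simp: bidiff_of_linear_simps pdiff_add pdiff_scaleR symbol_linear_simps
    scaleR_add_right)

text \<open>The commutator with multiplication by \<open>x\<^sub>j\<close> is \<open>D_alpha j\<close> on polynomial forms. With the four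
  preceding rules it allows all computations with bidifferential operators to be done on symbols.\<close>

lemma bidiff_of_coordinate_left:
  "bidiff_of A (coordinate j * f) g = coordinate j * bidiff_of A f g + bidiff_of (D_alpha j A) f g"
proof (rule linear_eq_on_singles[where f = "\<lambda>A. bidiff_of A (coordinate j * f) g"])
  fix k c
  show "bidiff_of (Poly_Mapping.single k c) (coordinate j * f) g =
     coordinate j * bidiff_of (Poly_Mapping.single k c) f g + bidiff_of
         (D_alpha j (Poly_Mapping.single k c)) f g"
    by (cases k, simp only: D_alpha_single bidiff_of_single multi_deriv_coordinate)
       (simp add: algebra_simps)
qed (auto intro!: linearI simp: bidiff_of_linear_simps symbol_linear_simps scaleR_add_right distrib_left)

lemma bidiff_of_coordinate_right:
  "bidiff_of A f (coordinate j * g) = coordinate j * bidiff_of A f g + bidiff_of (D_beta j A) f g"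
proof (rule linear_eq_on_singles[where f = "\<lambda>A. bidiff_of A f (coordinate j * g)"])
  fix k c
  show "bidiff_of (Poly_Mapping.single k c) f (coordinate j * g) =
     coordinate j * bidiff_of (Poly_Mapping.single k c) f g + bidiff_of
         (D_beta j (Poly_Mapping.single k c)) f g"
    by (cases k, simp only: D_beta_single bidiff_of_single multi_deriv_coordinate)
       (simp add: algebra_simps)
qed (auto intro!: linearI simp: bidiff_of_linear_simps symbol_linear_simps scaleR_add_right distrib_left)

definition degree_below :: "nat \<Rightarrow> 'n::finite symbol set" where
  "degree_below m = supported {d. fst d + snd d < m}"

lemma degree_below_0: "P \<in> degree_below 0 \<longleftrightarrow> P = 0"
  by (simp add: degree_below_def supported_empty)

lemma D_degree_below:
  assumes "P \<in> degree_below (Suc m)"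
  shows "D_alpha i P \<in> degree_below m" "D_beta i P \<in> degree_below m"
  using assms unfolding degree_below_def
  by (auto intro: D_alpha_supported D_beta_supported)

text \<open>The kernel of \<open>bidiff_of\<close> is closed under \<open>D_alpha\<close> and \<open>D_beta\<close> by the commutator rules. By
  induction on the degree all these derivatives of \<open>A\<close> vanish, so \<open>A\<close> is a constant polynomial, and
  its value is found by applying the operator to the pair \<open>(1, 1)\<close>.\<close>

lemma bidiff_of_eq_0_imp:
  "A \<in> degree_below m \<Longrightarrow> (\<And>f g. bidiff_of A f g = 0) \<Longrightarrow> A = 0"
proof (induction m arbitrary: A)
  case 0
  then show ?case by (simp add: degree_below_0)
next
  case (Suc m)
  have D: "D_alpha j A = 0" "D_beta j A = 0" for j
  proof -
    show "D_alpha j A = 0"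
      using bidiff_of_coordinate_left[of A j] Suc.prems
      by (intro Suc.IH D_degree_below) auto
    show "D_beta j A = 0"
      using bidiff_of_coordinate_right[of A _ j] Suc.prems
      by (intro Suc.IH D_degree_below) auto
  qed
  (* On the coefficient of alpha^a beta^b the operator alpha_i D_alpha_i is multiplication by a_i. *)
  have zero: "Poly_Mapping.lookup A (a, b) = 0" if "(a, b) \<noteq> 0" for a b
  proof -
    have e: "Poly_Mapping.lookup (alpha i * D_alpha i P) (a, b) =
        of_nat (a $ i) * Poly_Mapping.lookup P (a, b)"
      "Poly_Mapping.lookup (beta i * D_beta i P) (a, b) =
          of_nat (b $ i) * Poly_Mapping.lookup P (a, b)" for i and P :: "'a symbol"
    proof -
      have "linear (\<lambda>P :: 'a symbol. Poly_Mapping.lookup (alpha i * D_alpha i P) (a, b))"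
        "linear (\<lambda>P :: 'a symbol. of_nat (a $ i) * Poly_Mapping.lookup P (a, b))"
        "linear (\<lambda>P :: 'a symbol. Poly_Mapping.lookup (beta i * D_beta i P) (a, b))"
        "linear (\<lambda>P :: 'a symbol. of_nat (b $ i) * Poly_Mapping.lookup P (a, b))"
        by (auto intro!: linearI simp: symbol_linear_simps distrib_left lookup_add lookup_scaleR)
      note lin = this
      show "Poly_Mapping.lookup (alpha i * D_alpha i P) (a, b) =
          of_nat (a $ i) * Poly_Mapping.lookup P (a, b)"
      proof (rule linear_eq_on_singles[OF lin(1,2)])
        fix k and c :: "'a smooth_fun"
        show "Poly_Mapping.lookup (alpha i * D_alpha i (Poly_Mapping.single k c)) (a, b) =
            of_nat (a $ i) * Poly_Mapping.lookup (Poly_Mapping.single k c) (a, b)"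
          by (cases k) (simp add: times_D_single lookup_single when_def)
      qed
      show "Poly_Mapping.lookup (beta i * D_beta i P) (a, b) =
          of_nat (b $ i) * Poly_Mapping.lookup P (a, b)"
      proof (rule linear_eq_on_singles[OF lin(3,4)])
        fix k and c :: "'a smooth_fun"
        show "Poly_Mapping.lookup (beta i * D_beta i (Poly_Mapping.single k c)) (a, b) =
            of_nat (b $ i) * Poly_Mapping.lookup (Poly_Mapping.single k c) (a, b)"
          by (cases k) (simp add: times_D_single lookup_single when_def)
      qed
    qed
    have "\<exists>i. a $ i \<noteq> 0 \<or> b $ i \<noteq> 0"
    proof (rule ccontr)
      assume "\<nexists>i. a $ i \<noteq> 0 \<or> b $ i \<noteq> 0"
      then have "a = 0" "b = 0" by (simp_all add: vec_eq_iff)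
      with that show False by (simp add: zero_prod_def)
    qed
    then obtain i where "a $ i \<noteq> 0 \<or> b $ i \<noteq> 0" by blast
    then show ?thesis
      using e(1)[of i A] e(2)[of i A] D by (auto simp: of_nat_times_smooth)
  qed
  have "A = Poly_Mapping.single (0, 0) (Poly_Mapping.lookup A (0, 0))"
  proof (rule poly_mapping_eqI)
    fix k
    show "Poly_Mapping.lookup A k = Poly_Mapping.lookup
        (Poly_Mapping.single (0, 0) (Poly_Mapping.lookup A (0, 0))) k"
      using zero by (cases k) (auto simp: lookup_single when_def zero_prod_def)
  qed
  moreover have "bidiff_of (Poly_Mapping.single (0, 0) c) 1 1 = c" for c :: "'a smooth_fun"
    by (simp add: bidiff_of_single)
  ultimately show ?case using Suc.prems(2)[of 1 1] by (metis single_zero)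
qed

lemma in_degree_below: "\<exists>m. P \<in> degree_below m"
proof -
  have "Poly_Mapping.lookup P k = 0" if "\<not> fst (bidegree k) + snd (bidegree k) < Suc (total_degree P)" for k
  proof (rule ccontr)
    assume "Poly_Mapping.lookup P k \<noteq> 0"
    then have "monomial_degree k \<le> total_degree P"
      unfolding total_degree_def by (intro Max_ge) (auto simp: in_keys_iff)
    then show False using that by (simp add: monomial_degree_bidegree)
  qed
  then show ?thesis unfolding degree_below_def supported_def by blast
qed

lemma bidiff_of_inject: "bidiff_of A = bidiff_of B \<longleftrightarrow> A = B"
proof
  assume eq: "bidiff_of A = bidiff_of B"
  have "bidiff_of (A - B) f g = 0" for f g
    by (simp add: bidiff_of_linear_simps eq)
  moreover obtain m where "A - B \<in> degree_below m" using in_degree_below by blast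
  ultimately show "A = B" using bidiff_of_eq_0_imp by fastforce
qed simp

lemma polynomial_form_bidiff_of [simp]: "polynomial_form (bidiff_of A) = A"
  unfolding polynomial_form_def by (simp add: bidiff_of_inject)

section \<open>The projective fields in homogeneous coordinates\<close>

text \<open>On the affine chart of projective space the homogeneous coordinates are \<open>1\<close> and the \<open>x\<^sub>i\<close>, where
  \<open>None\<close> stands for the additional index.\<close>

definition hcoord :: "'n::finite option \<Rightarrow> 'n smooth_fun" where
  "hcoord a = (case a of None \<Rightarrow> 1 | Some i \<Rightarrow> coordinate i)"

text \<open>The partial derivatives in the homogeneous coordinates, acting on functions of homogeneity zero: by
  Euler's relation the additional one is minus the Euler field.\<close>

definition hframe :: "'n::finite option \<Rightarrow> 'n vector_field" where
  "hframe b = (case b of None \<Rightarrow> (\<chi> k. - coordinate k) | Some j \<Rightarrow> axis j 1)"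

text \<open>The matrix units of \<open>gl\<^bsub>n+1\<^esub>\<close> acting on projective space. The identity matrix acts by zero, so
  these fields span the projective \<open>sl\<^bsub>n+1\<^esub>\<close>.\<close>

definition gl_field :: "'n::finite option \<Rightarrow> 'n option \<Rightarrow> 'n vector_field" where
  "gl_field a b = (\<chi> k. hcoord a * hframe b $ k)"

lemma axis_nth_if: "axis i x $ k = (if k = i then x else 0)"
  by (simp add: axis_def)

lemma gl_field_simps:
  "gl_field (Some i) (Some j) = axis j (coordinate i)"
  "gl_field None (Some j) = axis j 1"
  "gl_field None None = - (\<Sum>k\<in>UNIV. axis k (coordinate k))"
  "gl_field (Some i) None = - (\<chi> k. coordinate i * coordinate k)"
  by (auto simp: gl_field_def hcoord_def hframe_def vec_eq_iff axis_nth_if)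

lemma gl_field_in_sl_fields: "gl_field a b \<in> sl_fields"
proof -
  let ?S = "range (\<lambda>i. axis i 1 :: 'a vector_field) \<union> range (\<lambda>(j, i). axis i (coordinate j))
      \<union> range (\<lambda>j. \<chi> i. coordinate j * coordinate i)"
  have "axis j 1 \<in> ?S" "(\<chi> i. coordinate j * coordinate i) \<in> ?S" for j by auto
  moreover have "axis i (coordinate j) \<in> ?S" for i j by force
  ultimately have gen: "axis j 1 \<in> span ?S" "(\<chi> i. coordinate j * coordinate i) \<in> span ?S"
    "axis i (coordinate j) \<in> span ?S" for i j
    by (blast intro: span_base)+
  show ?thesis
    unfolding sl_fields_def
    by (cases a; cases b) (auto simp only: gl_field_simps intro: gen intro!: span_neg span_sum)
qed

lemma sl_fields_subset_span_gl: "sl_fields \<subseteq> span (range (case_prod gl_field))"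
proof -
  let ?G = "range (case_prod gl_field) :: 'a vector_field set"
  have gl: "gl_field a b \<in> span ?G" for a b by (rule span_base) force
  have "(\<chi> i. coordinate j * coordinate i) \<in> span ?G" for j
    using span_neg[OF gl[of "Some j" None]] by (simp add: gl_field_simps)
  then show ?thesis
    unfolding sl_fields_def using gl[of "Some _" "Some _"] gl[of None "Some _"]
    by (intro span_minimal subspace_span) (auto simp: gl_field_simps)
qed

section \<open>The action on densities\<close>

lemma linear_lie_density: "linear (lie_density w X)"
  unfolding lie_density_def
  by (rule linearI)
     (simp_all add: pdiff_add pdiff_scaleR distrib_left sum.distrib scaleR_add_right
       scaleR_sum_right scaleR_left_commute)

text \<open>Densities of weight \<open>w\<close> are functions of homogeneity \<open>- w (n + 1)\<close> in the homogeneous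
  coordinates; the constant is what Euler's relation then adds to \<open>hframe None\<close>.\<close>

definition twisted_frame :: "real \<Rightarrow> 'n::finite option \<Rightarrow> 'n smooth_fun \<Rightarrow> 'n smooth_fun" where
  "twisted_frame w b f = (\<Sum>k\<in>UNIV. hframe b $ k * pdiff k f)
     - (if b = None then (w * (real CARD('n) + 1)) *\<^sub>R f else 0)"

lemma twisted_frame_simps:
  "twisted_frame w (Some j) f = pdiff j f"
  "twisted_frame w None f = - (\<Sum>k\<in>UNIV. coordinate k * pdiff k f) - (w * (real CARD('n) + 1)) *\<^sub>R f"
  for f :: "'n::finite smooth_fun"
  by (simp_all add: twisted_frame_def hframe_def axis_nth_if if_distrib[of "\<lambda>x. x * _"] sum_negf
      cong: if_cong)

lemma linear_twisted_frame: "linear (twisted_frame w b)"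
  unfolding twisted_frame_def
  by (rule linearI)
     (simp_all add: pdiff_add pdiff_scaleR distrib_left sum.distrib scaleR_add_right
       scaleR_sum_right scaleR_left_commute scaleR_diff_right algebra_simps)

lemma pdiff_hcoord: "pdiff k (hcoord a) = (if a = Some k then 1 else 0)"
  by (cases a) (auto simp: hcoord_def pdiff_coordinate)

lemma euler_hcoord: "(\<Sum>k\<in>UNIV. coordinate k * pdiff k (hcoord a)) = (if a = None then 0 else hcoord a)"
  by (cases a) (auto simp: hcoord_def pdiff_coordinate if_distrib[of "\<lambda>x. _ * x"] cong: if_cong)

lemma divergence_gl_field:
  "divergence (gl_field a b) =
     (if a = b then 1 else 0) - (if b = None then (real CARD('n) + 1) *\<^sub>R hcoord a else 0)"
  for a b :: "'n::finite option"
proof (cases b)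
  case None
  have "divergence (gl_field a b) = - (\<Sum>k\<in>UNIV. hcoord a + coordinate k * pdiff k (hcoord a))"
    by (simp add: divergence_def gl_field_def None hframe_def pdiff_mult linear_neg[OF linear_pdiff]
        pdiff_coordinate sum_negf sum_subtractf sum.distrib mult.commute)
  also have "\<dots> = - (of_nat CARD('n) * hcoord a + (if a = None then 0 else hcoord a))"
    by (simp add: sum.distrib euler_hcoord)
  finally show ?thesis
    by (cases a) (simp_all add: None scaleR_conv_of_real algebra_simps hcoord_def)
next
  case (Some j)
  then show ?thesis
    by (auto simp: divergence_def gl_field_def hframe_def pdiff_mult pdiff_hcoord axis_nth_if
        if_distrib[of "pdiff _"] if_distrib[of "\<lambda>x. _ * x"] if_distrib[of "\<lambda>x. x * _"] cong: if_cong)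
qed

lemma lie_density_gl_field:
  "lie_density w (gl_field a b) f = hcoord a * twisted_frame w b f + (if a = b then w *\<^sub>R f else 0)"
  for f :: "'n::finite smooth_fun"
  unfolding lie_density_def divergence_gl_field twisted_frame_def
  by (auto simp: gl_field_def sum_distrib_left algebra_simps scaleR_right_diff_distrib)

lemma twisted_frame_hcoord:
  "twisted_frame w b (hcoord c * f) = hcoord c * twisted_frame w b f
     + (if b = c then f else 0) - (if b = None then hcoord c * f else 0)"
proof (cases b)
  case None
  have "(\<Sum>k\<in>UNIV. coordinate k * pdiff k (hcoord c * f)) =
     hcoord c * (\<Sum>k\<in>UNIV. coordinate k * pdiff k f) + (\<Sum>k\<in>UNIV. coordinate k * pdiff k (hcoord c)) * f"
    by (simp add: pdiff_mult distrib_left sum.distrib sum_distrib_left sum_distrib_right mult.assoc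
        mult.left_commute)
  then show ?thesis
    by (auto simp: None twisted_frame_simps euler_hcoord algebra_simps) (simp_all add: hcoord_def)
next
  case (Some j)
  then show ?thesis by (auto simp: twisted_frame_simps pdiff_mult pdiff_hcoord)
qed

lemma twisted_frame_commute:
  "twisted_frame w b (twisted_frame w d f) - twisted_frame w d (twisted_frame w b f) =
     (if b = None then twisted_frame w d f else 0) - (if d = None then twisted_frame w b f else 0)"
proof -
  have 1: "pdiff j (twisted_frame w None f) = twisted_frame w None (pdiff j f) - pdiff j f"
    for j and f :: "'a smooth_fun"
  proof -
    have "(\<Sum>k\<in>UNIV. pdiff j (coordinate k * pdiff k f)) =
      (\<Sum>k\<in>UNIV. coordinate k * pdiff k (pdiff j f)) + pdiff j f"
      by (simp add: pdiff_mult sum.distrib pdiff_coordinate pdiff_commute[of j]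
          if_distrib[of "\<lambda>x. x * _"] cong: if_cong)
    then show ?thesis
      by (simp add: twisted_frame_simps linear_diff[OF linear_pdiff] linear_neg[OF linear_pdiff]
          linear_sum[OF linear_pdiff] pdiff_scaleR)
  qed
  show ?thesis
    by (cases b; cases d) (simp_all add: 1 twisted_frame_simps(1) pdiff_commute)
qed

text \<open>Only the commutation relations between the coordinates and the twisted frame enter; the scalars
  that the weight contributes for \<open>a = b\<close> drop out of the bracket.\<close>

lemma lie_density_bracket:
  "lie_density w (gl_field a b) (lie_density w (gl_field c d) f)
     - lie_density w (gl_field c d) (lie_density w (gl_field a b) f) =
   (if b = c then lie_density w (gl_field a d) f else 0)
     - (if d = a then lie_density w (gl_field c b) f else 0)"
proof -
  let ?M = "\<lambda>a b f. hcoord a * twisted_frame w b f"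
  have M: "?M a b (?M c d f) = hcoord a * hcoord c * twisted_frame w b (twisted_frame w d f)
      + (if b = c then ?M a d f else 0) - (if b = None then hcoord a * hcoord c * twisted_frame w d
          f else 0)"
    for a b c d
    by (simp add: twisted_frame_hcoord algebra_simps)
  have comm: "hcoord a * hcoord c * twisted_frame w b (twisted_frame w d f)
      = hcoord a * hcoord c * twisted_frame w d (twisted_frame w b f)
      + (if b = None then hcoord a * hcoord c * twisted_frame w d f else 0)
      - (if d = None then hcoord a * hcoord c * twisted_frame w b f else 0)"
    using arg_cong[OF twisted_frame_commute[of w b d f], of "\<lambda>x. hcoord a * hcoord c * x"]
    by (auto simp: algebra_simps)
  have "?M a b (?M c d f) - ?M c d (?M a b f) =
      (if b = c then ?M a d f else 0) - (if d = a then ?M c b f else 0)"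
    unfolding M[of a b c d] M[of c d a b] comm by (auto simp: mult.commute)
  then show ?thesis
    by (auto simp: lie_density_gl_field linear_add[OF linear_twisted_frame]
        linear_scale[OF linear_twisted_frame] linear_0[OF linear_twisted_frame] distrib_left
            scaleR_add_right algebra_simps)
qed

section \<open>The action on symbols\<close>

text \<open>The matrix units of \<open>gl\<^sub>n\<close> acting on the two covectors \<open>\<alpha>\<close> and \<open>\<beta>\<close> simultaneously.\<close>

definition gl_act :: "'n::finite \<Rightarrow> 'n \<Rightarrow> 'n symbol \<Rightarrow> 'n symbol" where
  "gl_act i j P = alpha i * D_alpha j P + beta i * D_beta j P"

abbreviation xsym :: "'n::finite \<Rightarrow> 'n symbol" where
  "xsym i \<equiv> const_symbol (coordinate i)"

lemma linear_lie_symbol: "linear (lie_symbol \<delta> X)"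
  unfolding lie_symbol_def
  by (rule linearI)
     (simp_all add: symbol_linear_simps distrib_left sum.distrib scaleR_add_right scaleR_diff_right
       scaleR_sum_right algebra_simps)

lemma lie_symbol_altdef:
  "lie_symbol \<delta> X P = (\<Sum>i\<in>UNIV. const_symbol (X $ i) * coeff_pdiff i P)
     - (\<Sum>i\<in>UNIV. \<Sum>j\<in>UNIV. const_symbol (pdiff j (X $ i)) * gl_act i j P)
     + \<delta> *\<^sub>R (const_symbol (divergence X) * P)"
  by (simp add: lie_symbol_def gl_act_def const_symbol_scaleR)

lemma lie_symbol_gl_field:
  fixes P :: "'n::finite symbol"
  shows "lie_symbol \<delta> (gl_field (Some i) (Some j)) P =
      xsym i * coeff_pdiff j P - gl_act j i P + (if i = j then \<delta> *\<^sub>R P else 0)"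
    and "lie_symbol \<delta> (gl_field None (Some j)) P = coeff_pdiff j P"
    and "lie_symbol \<delta> (gl_field None None) P =
      - (\<Sum>k\<in>UNIV. xsym k * coeff_pdiff k P) + (\<Sum>k\<in>UNIV. gl_act k k P) - (real CARD('n) * \<delta>) *\<^sub>R P"
    and "lie_symbol \<delta> (gl_field (Some i) None) P =
      - (xsym i * (\<Sum>k\<in>UNIV. xsym k * coeff_pdiff k P)) + xsym i * (\<Sum>k\<in>UNIV. gl_act k k P)
      + (\<Sum>k\<in>UNIV. xsym k * gl_act k i P) - ((real CARD('n) + 1) * \<delta>) *\<^sub>R (xsym i * P)"
proof -
  have push: "const_symbol (if b then f else g) * Q =
      (if b then const_symbol f * Q else const_symbol g * Q)"
    for b f g and Q :: "'n symbol"
    by simp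
  have const_if: "(\<Sum>j\<in>UNIV. if b then F j else 0) = (if b then \<Sum>j\<in>UNIV. F j else 0)"
    for b and F :: "'n \<Rightarrow> 'n symbol"
    by simp
  note simps = const_if gl_field_def hframe_def hcoord_def axis_nth_if
    pdiff_coordinate pdiff_mult push if_distrib[of "pdiff _"] if_distrib[of "\<lambda>x. _ * x"]
    linear_neg[OF linear_pdiff]
  show "lie_symbol \<delta> (gl_field (Some i) (Some j)) P =
      xsym i * coeff_pdiff j P - gl_act j i P + (if i = j then \<delta> *\<^sub>R P else 0)"
    unfolding lie_symbol_altdef divergence_gl_field by (simp add: simps cong: if_cong)
  show "lie_symbol \<delta> (gl_field None (Some j)) P = coeff_pdiff j P"
    unfolding lie_symbol_altdef divergence_gl_field by (simp add: simps cong: if_cong)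
  show "lie_symbol \<delta> (gl_field None None) P =
      - (\<Sum>k\<in>UNIV. xsym k * coeff_pdiff k P) + (\<Sum>k\<in>UNIV. gl_act k k P) - (real CARD('n) * \<delta>) *\<^sub>R P"
    unfolding lie_symbol_altdef divergence_gl_field
        by (simp add: simps const_symbol_uminus sum_negf linear_diff[OF linear_const_symbol]
        const_symbol_scaleR left_diff_distrib scaleR_diff_right scaleR_add_left scaleR_add_right
        distrib_left mult.commute[of \<delta>] cong: if_cong)
  show "lie_symbol \<delta> (gl_field (Some i) None) P =
      - (xsym i * (\<Sum>k\<in>UNIV. xsym k * coeff_pdiff k P)) + xsym i * (\<Sum>k\<in>UNIV. gl_act k k P)
      + (\<Sum>k\<in>UNIV. xsym k * gl_act k i P) - ((real CARD('n) + 1) * \<delta>) *\<^sub>R (xsym i * P)"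
    unfolding lie_symbol_altdef divergence_gl_field
        by (simp add: simps const_symbol_uminus const_symbol_mult sum_negf sum.distrib sum_subtractf
        sum_distrib_left linear_diff[OF linear_const_symbol] const_symbol_scaleR left_diff_distrib
        mult.assoc mult.commute[of \<delta>] if_distrib[of "\<lambda>x. x * _"] cong: if_cong)
qed

section \<open>The action on bidifferential operators\<close>

text \<open>The difference between the action on operators and the action on symbols. It comes from the second
  derivatives of the field and is therefore present only for the quadratic fields
  \<open>gl_field (Some i) None\<close>; the weights enter through the derivative of the divergence.\<close>

definition order_lowering :: "real \<times> real \<Rightarrow> 'n::finite option \<Rightarrow> 'n option \<Rightarrow> 'n symbol \<Rightarrow> 'n symbol" where
  "order_lowering w a b A = (case (a, b) of
     (Some i, None) \<Rightarrow>
       (\<Sum>k\<in>UNIV. alpha k * D_alpha k (D_alpha i A)) + (fst w * (real CARD('n) + 1)) *\<^sub>R D_alpha i A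
       + ((\<Sum>k\<in>UNIV. beta k * D_beta k (D_beta i A)) + (snd w * (real CARD('n) + 1)) *\<^sub>R D_beta i A)
   | _ \<Rightarrow> 0)"

lemma linear_order_lowering: "linear (order_lowering w a b)"
  unfolding order_lowering_def
  by (rule linearI)
     (auto simp: symbol_linear_simps distrib_left sum.distrib scaleR_add_right
       scaleR_sum_right algebra_simps split: option.split)

text \<open>The action of \<open>gl_field a b\<close> on a bidifferential operator, read on its polynomial form.\<close>

definition op_action :: "real \<times> real \<Rightarrow> real \<Rightarrow> 'n::finite option \<Rightarrow> 'n option \<Rightarrow> 'n symbol \<Rightarrow> 'n symbol" where
  "op_action w \<mu> a b A = lie_symbol (\<mu> - fst w - snd w) (gl_field a b) A + order_lowering w a b A"

lemma linear_op_action: "linear (op_action w \<mu> a b)"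
  unfolding op_action_def by (intro linear_compose_add linear_lie_symbol linear_order_lowering)

lemma lie_density_gl_field_simps:
  fixes f :: "'n::finite smooth_fun"
  shows "lie_density w (gl_field (Some i) (Some j)) f =
      coordinate i * pdiff j f + (if i = j then w *\<^sub>R f else 0)"
    and "lie_density w (gl_field None (Some j)) f = pdiff j f"
    and "lie_density w (gl_field None None) f =
      - (\<Sum>k\<in>UNIV. coordinate k * pdiff k f) - (w * real CARD('n)) *\<^sub>R f"
    and "lie_density w (gl_field (Some i) None) f =
      - (coordinate i * (\<Sum>k\<in>UNIV. coordinate k * pdiff k f)) - (w * (real CARD('n) + 1)) *\<^sub>R
          (coordinate i * f)"
  by (simp_all add: lie_density_gl_field twisted_frame_simps hcoord_def algebra_simps)

lemma bidiff_of_op_action: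
  "bidiff_of (op_action w \<mu> a b A) f g = lie_bidiff w \<mu> (gl_field a b) (bidiff_of A) f g"
proof -
  note rules = bidiff_of_linear_simps bidiff_of_arg_simps bidiff_of_const bidiff_of_alpha bidiff_of_beta
    pdiff_bidiff_of bidiff_of_coordinate_left bidiff_of_coordinate_right
  note sums = sum.distrib sum_subtractf sum_negf sum_distrib_left
  show ?thesis
  proof (cases a)
    case None
    show ?thesis
    proof (cases b)
      case N: None
      show ?thesis
        by (simp add: None N op_action_def order_lowering_def lie_bidiff_def
            lie_density_gl_field_simps lie_symbol_gl_field gl_act_def rules, simp add: sums algebra_simps)
    next
      case (Some j)
      show ?thesis
        by (simp add: None Some op_action_def order_lowering_def lie_bidiff_def
            lie_density_gl_field_simps lie_symbol_gl_field rules)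
    qed
  next
    case a: (Some i)
    show ?thesis
    proof (cases b)
      case None
      show ?thesis
        by (simp add: None a op_action_def order_lowering_def lie_bidiff_def
            lie_density_gl_field_simps lie_symbol_gl_field gl_act_def rules, simp add: sums algebra_simps)
    next
      case (Some j)
      show ?thesis
        by (simp add: a Some op_action_def order_lowering_def lie_bidiff_def
            lie_density_gl_field_simps lie_symbol_gl_field gl_act_def rules
            linear_0[OF linear_bidiff_of_left] linear_0[OF linear_bidiff_of_right],
            simp add: algebra_simps)
    qed
  qed
qed

lemma lie_bidiff_bracket:
  "lie_bidiff w \<mu> X (lie_bidiff w \<mu> Y (bidiff_of A)) f g
      - lie_bidiff w \<mu> Y (lie_bidiff w \<mu> X (bidiff_of A)) f g =
    (lie_density \<mu> X (lie_density \<mu> Y (bidiff_of A f g)) - lie_density \<mu> Y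
        (lie_density \<mu> X (bidiff_of A f g)))
    - bidiff_of A (lie_density (fst w) X (lie_density (fst w) Y f) - lie_density (fst w) Y
        (lie_density (fst w) X f)) g
    - bidiff_of A f (lie_density (snd w) X (lie_density (snd w) Y g) - lie_density (snd w) Y
        (lie_density (snd w) X g))"
  by (simp add: lie_bidiff_def linear_diff[OF linear_lie_density] bidiff_of_arg_simps)

text \<open>The action on operators is a representation because the actions on the three density modules are;
  injectivity of \<open>bidiff_of\<close> transports this to polynomial forms.\<close>

lemma op_action_bracket:
  "op_action w \<mu> a b (op_action w \<mu> c d A) - op_action w \<mu> c d (op_action w \<mu> a b A) =
     (if b = c then op_action w \<mu> a d A else 0) - (if d = a then op_action w \<mu> c b A else 0)"
proof -
  have act: "lie_bidiff w \<mu> (gl_field a b) (bidiff_of B) = bidiff_of (op_action w \<mu> a b B)" for a b B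
    by (intro ext) (simp add: bidiff_of_op_action)
  have "bidiff_of (op_action w \<mu> a b (op_action w \<mu> c d A) - op_action w \<mu> c d (op_action w \<mu> a b A)) f g =
     bidiff_of ((if b = c then op_action w \<mu> a d A else 0)
         - (if d = a then op_action w \<mu> c b A else 0)) f g" for f g
    using lie_bidiff_bracket[of w \<mu> "gl_field a b" "gl_field c d" A f g]
    unfolding lie_density_bracket act
    by (auto simp: bidiff_of_linear_simps bidiff_of_op_action lie_bidiff_def bidiff_of_arg_simps
        linear_0[OF linear_bidiff_of_left] linear_0[OF linear_bidiff_of_right])
  then show ?thesis by (metis ext bidiff_of_inject)
qed

definition op_casimir :: "real \<times> real \<Rightarrow> real \<Rightarrow> 'n::finite symbol \<Rightarrow> 'n symbol" where
  "op_casimir w \<mu> A = (\<Sum>a\<in>UNIV. \<Sum>b\<in>UNIV. op_action w \<mu> a b (op_action w \<mu> b a A))"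

definition symbol_casimir :: "real \<Rightarrow> 'n::finite symbol \<Rightarrow> 'n symbol" where
  "symbol_casimir \<delta> P =
     (\<Sum>a\<in>UNIV. \<Sum>b\<in>UNIV. lie_symbol \<delta> (gl_field a b) (lie_symbol \<delta> (gl_field b a) P))"

lemma linear_op_casimir: "linear (op_casimir w \<mu>)"
  unfolding op_casimir_def
  by (intro linear_compose_sum ballI linear_compose[OF linear_op_action linear_op_action, unfolded o_def])

lemma linear_symbol_casimir: "linear (symbol_casimir \<delta>)"
  unfolding symbol_casimir_def
  by (intro linear_compose_sum ballI linear_compose[OF linear_lie_symbol linear_lie_symbol, unfolded o_def])

lemma op_casimir_commutes: "op_action w \<mu> a b (op_casimir w \<mu> A) = op_casimir w \<mu> (op_action w \<mu> a b A)"
  unfolding op_casimir_def by (rule gl_casimir_commutes[OF linear_op_action op_action_bracket])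

lemma gl_act_supported: "P \<in> supported D \<Longrightarrow> gl_act i j P \<in> supported D"
  unfolding gl_act_def
proof (rule subspace_add[OF subspace_supported])
  assume P: "P \<in> supported D"
  have "D_alpha j P \<in> supported {(k, l). (Suc k, l) \<in> D}" by (rule D_alpha_supported[OF P]) simp
  then show "alpha i * D_alpha j P \<in> supported D" by (rule alpha_supported) simp
  have "D_beta j P \<in> supported {(k, l). (k, Suc l) \<in> D}" by (rule D_beta_supported[OF P]) simp
  then show "beta i * D_beta j P \<in> supported D" by (rule beta_supported) simp
qed

lemma lie_symbol_supported: "P \<in> supported D \<Longrightarrow> lie_symbol \<delta> X P \<in> supported D"
  unfolding lie_symbol_altdef
  by (intro subspace_add subspace_diff subspace_sum subspace_scale subspace_supported
      const_supported coeff_pdiff_supported gl_act_supported)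

lemma symbol_casimir_supported: "P \<in> supported D \<Longrightarrow> symbol_casimir \<delta> P \<in> supported D"
  unfolding symbol_casimir_def by (intro subspace_sum subspace_supported lie_symbol_supported)

lemma order_lowering_degree_below:
  assumes "A \<in> degree_below (Suc m)"
  shows "order_lowering w a b A \<in> degree_below m"
proof (cases "\<exists>i. a = Some i \<and> b = None")
  case True
  then obtain i where ab: "a = Some i" "b = None" by blast
  have 1: "D_alpha i A \<in> degree_below m" "D_beta i A \<in> degree_below m"
    using assms by (rule D_degree_below)+
  have "alpha k * D_alpha k (D_alpha i A) \<in> degree_below m"
      "beta k * D_beta k (D_beta i A) \<in> degree_below m" for k
  proof -
    have "D_alpha k (D_alpha i A) \<in> supported {d. Suc (fst d + snd d) < m}"
      "D_beta k (D_beta i A) \<in> supported {d. Suc (fst d + snd d) < m}"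
      using 1 unfolding degree_below_def by (auto intro: D_alpha_supported D_beta_supported)
    then show "alpha k * D_alpha k (D_alpha i A) \<in> degree_below m"
        "beta k * D_beta k (D_beta i A) \<in> degree_below m"
      unfolding degree_below_def by (auto intro: alpha_supported beta_supported)
  qed
  then show ?thesis
    using 1 unfolding order_lowering_def ab degree_below_def
    by (auto intro!: subspace_add[OF subspace_supported] subspace_sum[OF subspace_supported]
        subspace_scale[OF subspace_supported])
next
  case False
  then have "order_lowering w a b A = 0"
    by (auto simp: order_lowering_def split: option.split)
  then show ?thesis by (simp add: degree_below_def subspace_0[OF subspace_supported])
qed

lemma subspace_degree_below: "subspace (degree_below m)"
  unfolding degree_below_def by (rule subspace_supported)

lemma degree_below_mono: "m \<le> n \<Longrightarrow> A \<in> degree_below m \<Longrightarrow> A \<in> degree_below n"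
  unfolding degree_below_def by (auto elim!: supported_mono[rotated])

lemma op_casimir_minus_symbol_casimir:
  assumes A: "A \<in> degree_below (Suc m)"
  shows "op_casimir w \<mu> A - symbol_casimir (\<mu> - fst w - snd w) A \<in> degree_below m"
proof -
  let ?L = "\<lambda>a b. lie_symbol (\<mu> - fst w - snd w) (gl_field a b :: 'a vector_field)"
  let ?N = "order_lowering w :: _ \<Rightarrow> _ \<Rightarrow> 'a symbol \<Rightarrow> _"
  have L: "?L a b B \<in> degree_below n" if "B \<in> degree_below n" for a b n B
    using that unfolding degree_below_def by (rule lie_symbol_supported)
  have "op_action w \<mu> a b (op_action w \<mu> b a A) - ?L a b (?L b a A)
      = ?L a b (?N b a A) + ?N a b (?L b a A) + ?N a b (?N b a A)" for a b
    by (simp add: op_action_def linear_add[OF linear_lie_symbol] linear_add[OF linear_order_lowering])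
  moreover have "?L a b (?N b a A) + ?N a b (?L b a A) + ?N a b (?N b a A) \<in> degree_below m" for a b
    by (intro subspace_add[OF subspace_degree_below] L order_lowering_degree_below A
        degree_below_mono[OF le_SucI[OF le_refl]])
  ultimately show ?thesis
    unfolding op_casimir_def symbol_casimir_def sum_subtractf[symmetric]
    by (intro subspace_sum[OF subspace_degree_below]) simp
qed

section \<open>The Casimir operator on symbols\<close>

lemma sum_UNIV_option: "(\<Sum>a\<in>UNIV. F a) = F None + (\<Sum>i\<in>UNIV. F (Some i))" for F ::
    "'n::finite option \<Rightarrow> 'b::comm_monoid_add"
  by (simp add: UNIV_option_conv sum.reindex)

lemma linear_gl_act: "linear (gl_act i j)"
  unfolding gl_act_def
  by (rule linearI) (simp_all add: symbol_linear_simps distrib_left scaleR_add_right)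

lemma gl_act_times_x: "gl_act i j (xsym k * P) = xsym k * gl_act i j P"
  by (simp add: gl_act_def D_alpha_times_const D_beta_times_const distrib_left mult.left_commute)

lemma coeff_pdiff_gl_act: "coeff_pdiff k (gl_act i j P) = gl_act i j (coeff_pdiff k P)"
  by (simp add: gl_act_def symbol_linear_simps coeff_pdiff_times_alpha coeff_pdiff_times_beta
      D_alpha_coeff_pdiff D_beta_coeff_pdiff)

lemma coeff_pdiff_times_x: "coeff_pdiff i (xsym j * P) =
    xsym j * coeff_pdiff i P + (if i = j then P else 0)"
  by (simp add: coeff_pdiff_times_const pdiff_coordinate)

lemma scaleR_times_2: "c *\<^sub>R (x * 2) = (c * 2) *\<^sub>R (x :: 'a::real_algebra_1)"
  by (simp only: mult_2_right scaleR_add_right scaleR_add_left)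

text \<open>All derivatives of the coefficients cancel: the Casimir operator commutes with translations, and at
  the origin each derivative comes with a factor that vanishes there. What remains is a Casimir operator of \<open>gl\<^sub>n\<close>
  acting on \<open>\<alpha>\<close> and \<open>\<beta>\<close>.\<close>

lemma symbol_casimir_gl:
  fixes P :: "'n::finite symbol"
  defines "M \<equiv> \<lambda>P :: 'n symbol. \<Sum>k\<in>UNIV. gl_act k k P"
  shows "symbol_casimir \<delta> P =
    (\<Sum>i\<in>UNIV. \<Sum>j\<in>UNIV. gl_act j i (gl_act i j P)) + M (M P)
    + (real CARD('n) + 1 - 2 * (real CARD('n) + 1) * \<delta>) *\<^sub>R M P
    + (real CARD('n) * (real CARD('n) + 1) * \<delta> * (\<delta> - 1)) *\<^sub>R P"
proof -
  let ?n = "real CARD('n)"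
  let ?L = "\<lambda>a b. lie_symbol \<delta> (gl_field a b :: 'n vector_field)"
  let ?d = "coeff_pdiff :: 'n \<Rightarrow> 'n symbol \<Rightarrow> 'n symbol"
  (* X is the Euler field on the coefficients; XX and Y collect the remaining terms of second and
     of first order in the derivatives of the coefficients. *)
  define X where "X Q = (\<Sum>k\<in>UNIV. xsym k * ?d k Q)" for Q :: "'n symbol"
  define XX where "XX = (\<Sum>i\<in>UNIV. \<Sum>j\<in>UNIV. xsym i * (xsym j * ?d i (?d j P)))"
  define Y where "Y = (\<Sum>i\<in>UNIV. \<Sum>j\<in>UNIV. xsym i * gl_act i j (?d j P))"
  note lin = symbol_linear_simps linear_add[OF linear_gl_act] linear_diff[OF linear_gl_act]
    linear_neg[OF linear_gl_act] linear_scale[OF linear_gl_act] linear_sum[OF linear_gl_act]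
    linear_0[OF linear_gl_act]
  note rules = gl_act_times_x coeff_pdiff_gl_act coeff_pdiff_times_x
  note sums = sum.distrib sum_subtractf sum_negf sum_distrib_left[symmetric] scaleR_sum_right[symmetric]
  have lin_X: "X (Q + R) = X Q + X R" "X (Q - R) = X Q - X R" "X (- Q) = - X Q"
    "X (c *\<^sub>R Q) = c *\<^sub>R X Q" for Q R c
    by (simp_all add: X_def lin distrib_left right_diff_distrib sums)
  have lin_M: "M (Q + R) = M Q + M R" "M (Q - R) = M Q - M R" "M (- Q) = - M Q"
    "M (c *\<^sub>R Q) = c *\<^sub>R M Q" for Q R c
    by (simp_all add: M_def lin sums)
  have XX: "X (X P) = X P + XX"
  proof -
    have "X (X P) = (\<Sum>k\<in>UNIV. \<Sum>j\<in>UNIV. xsym k * (xsym j * ?d k (?d j P))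
        + (if k = j then xsym k * ?d j P else 0))"
      by (auto simp: X_def lin rules sum_distrib_left distrib_left intro!: sum.cong)
    also have "\<dots> = X P + XX"
      by (simp add: X_def XX_def sum.distrib)
    finally show ?thesis .
  qed
  have MX: "M (X P) = X (M P)"
    unfolding M_def X_def by (simp add: lin rules sum_distrib_left) (rule sum.swap)
  have dX: "?d j (M P) = M (?d j P)" "M (xsym i * Q) = xsym i * M Q" for i j Q
    by (simp_all add: M_def lin rules sum_distrib_left)
  (* T00, T1, T2, T3 are the blocks of the sum over a, b in which both, only b, only a, or neither
     is None. All terms in X, XX and Y cancel between the blocks. *)
  have 00: "?L None None Q = - X Q + M Q - (?n * \<delta>) *\<^sub>R Q" for Q
    by (simp add: lie_symbol_gl_field X_def M_def)
  have T00: "?L None None (?L None None P) = X P + XX - 2 *\<^sub>R X (M P) + (2 * ?n * \<delta>) *\<^sub>R X P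
      + M (M P) - (2 * ?n * \<delta>) *\<^sub>R M P + (?n * \<delta> * (?n * \<delta>)) *\<^sub>R P"
    unfolding 00 by (simp add: lin_X lin_M XX MX algebra_simps scaleR_2 scaleR_times_2)
  have i0: "?L (Some i) None Q = - (xsym i * X Q) + xsym i * M Q
      + (\<Sum>k\<in>UNIV. xsym k * gl_act k i Q) - ((?n + 1) * \<delta>) *\<^sub>R (xsym i * Q)" for i Q
    by (simp add: lie_symbol_gl_field X_def M_def)
  have Xd: "(\<Sum>i\<in>UNIV. xsym i * X (?d i P)) = XX"
    by (simp add: X_def XX_def sum_distrib_left coeff_pdiff_commute)
  have Xd': "(\<Sum>i\<in>UNIV. xsym i * M (?d i P)) = X (M P)"
    by (simp add: X_def dX)
  have Y': "(\<Sum>i\<in>UNIV. \<Sum>k\<in>UNIV. xsym k * gl_act k i (?d i P)) = Y"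
    unfolding Y_def by (rule sum.swap)
  have T1: "(\<Sum>i\<in>UNIV. ?L (Some i) None (?L None (Some i) P)) =
      - XX + X (M P) + Y - ((?n + 1) * \<delta>) *\<^sub>R X P"
    unfolding i0 lie_symbol_gl_field(2)
    by (simp add: sum.distrib sum_subtractf sum_negf scaleR_sum_right[symmetric] Xd Xd' Y' X_def[symmetric])
  have dsum: "(\<Sum>j\<in>UNIV. ?d j (xsym j * Q)) = ?n *\<^sub>R Q + X Q" for Q
    by (simp add: rules sum.distrib X_def scaleR_conv_of_real)
  have T2: "(\<Sum>j\<in>UNIV. ?L None (Some j) (?L (Some j) None P)) =
      - ((?n + 1) *\<^sub>R X P) - XX + (?n + 1) *\<^sub>R M P + X (M P) + Y 
      - ((?n + 1) * \<delta>) *\<^sub>R (?n *\<^sub>R P + X P)"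
  proof -
    have "(\<Sum>j\<in>UNIV. ?d j (\<Sum>k\<in>UNIV. xsym k * gl_act k j P)) =
       (\<Sum>j\<in>UNIV. (\<Sum>k\<in>UNIV. xsym k * gl_act k j (?d j P)) + gl_act j j P)"
      by (simp add: lin rules sum.distrib)
    then have "(\<Sum>j\<in>UNIV. ?d j (\<Sum>k\<in>UNIV. xsym k * gl_act k j P)) = Y + M P"
      by (simp add: sum.distrib Y' M_def)
    note Y = this
    have "?L None (Some j) (?L (Some j) None P) = - ?d j (xsym j * X P) + ?d j (xsym j * M P)
        + ?d j (\<Sum>k\<in>UNIV. xsym k * gl_act k j P) - ((?n + 1) * \<delta>) *\<^sub>R ?d j (xsym j * P)" for j
      by (simp only: i0 lie_symbol_gl_field(2) linear_add[OF linear_coeff_pdiff]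
          linear_diff[OF linear_coeff_pdiff] linear_neg[OF linear_coeff_pdiff]
          linear_scale[OF linear_coeff_pdiff])
    then have F: "(\<Sum>j\<in>UNIV. ?L None (Some j) (?L (Some j) None P)) =
      - (?n *\<^sub>R X P + X (X P)) + (?n *\<^sub>R M P + X (M P)) + (Y + M P)
      - ((?n + 1) * \<delta>) *\<^sub>R (?n *\<^sub>R P + X P)"
      by (simp only: sum.distrib sum_subtractf sum_negf scaleR_sum_right[symmetric] dsum Y)
    show ?thesis
      unfolding F XX by (simp add: scaleR_add_left)
  qed
  have T3: "(\<Sum>i\<in>UNIV. \<Sum>j\<in>UNIV. ?L (Some i) (Some j) (?L (Some j) (Some i) P)) =
     ?n *\<^sub>R X P + XX - 2 *\<^sub>R Y + (\<Sum>i\<in>UNIV. \<Sum>j\<in>UNIV. gl_act j i (gl_act i j P))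
     + (\<delta> *\<^sub>R X P + \<delta> *\<^sub>R X P - \<delta> *\<^sub>R M P - \<delta> *\<^sub>R M P + (?n * (\<delta> * \<delta>)) *\<^sub>R P)"
  proof -
    have "?L (Some i) (Some j) (?L (Some j) (Some i) P) =
      xsym i * ?d i P + xsym i * (xsym j * ?d i (?d j P)) - xsym i * gl_act i j (?d j P) - xsym
          j * gl_act j i (?d i P)
      + gl_act j i (gl_act i j P)
      + (if i = j then \<delta> *\<^sub>R (xsym i * ?d i P) + \<delta> *\<^sub>R (xsym i * ?d i P)
           - \<delta> *\<^sub>R gl_act i i P - \<delta> *\<^sub>R gl_act i i P + (\<delta> * \<delta>) *\<^sub>R P else 0)" for i j
    proof (cases "i = j")
      case True
      then show ?thesis
        by (simp only: lie_symbol_gl_field lin rules distrib_left right_diff_distrib if_True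
            scaleR_diff_right scaleR_add_right scaleR_scaleR mult_scaleR_right simp_thms)
           (simp only: diff_conv_add_uminus minus_add_distrib minus_minus add_ac)
    next
      case False
      then show ?thesis
        by (simp add: lie_symbol_gl_field lin rules distrib_left right_diff_distrib
            coeff_pdiff_commute[of j i])
    qed
    moreover have "(\<Sum>i\<in>UNIV. \<Sum>j\<in>UNIV. xsym j * gl_act j i (?d i P)) = Y"
      unfolding Y_def by (rule sum.swap)
    moreover have "(\<Sum>i\<in>UNIV. \<Sum>j\<in>(UNIV::'n set). xsym i * ?d i P) = ?n *\<^sub>R X P"
      unfolding X_def by (simp only: sum_constant_scaleR scaleR_sum_right)
    moreover have "(\<Sum>i\<in>(UNIV::'n set). c *\<^sub>R P) = (?n * c) *\<^sub>R P" for c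
      by (simp only: sum_constant_scaleR scaleR_scaleR)
    ultimately show ?thesis
      by (simp only: sum.distrib sum_subtractf XX_def[symmetric] Y_def[symmetric] M_def
          scaleR_sum_right[symmetric]
          X_def[symmetric] scaleR_2 sum.delta sum.delta' finite UNIV_I if_True diff_diff_eq)
  qed
  have "symbol_casimir \<delta> P = ?L None None (?L None None P)
     + (\<Sum>j\<in>UNIV. ?L None (Some j) (?L (Some j) None P))
     + (\<Sum>i\<in>UNIV. ?L (Some i) None (?L None (Some i) P))
     + (\<Sum>i\<in>UNIV. \<Sum>j\<in>UNIV. ?L (Some i) (Some j) (?L (Some j) (Some i) P))"
    by (simp add: symbol_casimir_def sum_UNIV_option sum.distrib)
  then show ?thesis
    unfolding T00 T1 T2 T3 by (simp add: algebra_simps scaleR_2 scaleR_times_2)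
qed

text \<open>With \<open>raise_beta\<close>, the raising and lowering operators of the \<open>sl\<^sub>2\<close> that mixes \<open>\<alpha>\<close> and \<open>\<beta>\<close>. It
  commutes with \<open>gl\<^sub>n\<close>, and on a given total degree the Casimir operators of the two determine each
  other.\<close>

definition raise_alpha :: "'n::finite symbol \<Rightarrow> 'n symbol" where
  "raise_alpha P = (\<Sum>i\<in>UNIV. alpha i * D_beta i P)"

definition raise_beta :: "'n::finite symbol \<Rightarrow> 'n symbol" where
  "raise_beta P = (\<Sum>i\<in>UNIV. beta i * D_alpha i P)"

lemma linear_raise: "linear raise_alpha" "linear raise_beta"
  unfolding raise_alpha_def raise_beta_def
  by (auto intro!: linearI simp: symbol_linear_simps distrib_left sum.distrib scaleR_sum_right)

lemma raise_alpha_supported: "P \<in> supported {(k, Suc l)} \<Longrightarrow> raise_alpha P \<in> supported {(Suc k, l)}"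
  unfolding raise_alpha_def
  by (intro subspace_sum subspace_supported alpha_supported[where D = "{(k, l)}"]
      D_beta_supported[where D = "{(k, Suc l)}"]) auto

lemma raise_beta_supported: "P \<in> supported {(Suc k, l)} \<Longrightarrow> raise_beta P \<in> supported {(k, Suc l)}"
  unfolding raise_beta_def
  by (intro subspace_sum subspace_supported beta_supported[where D = "{(k, l)}"]
      D_alpha_supported[where D = "{(Suc k, l)}"]) auto

lemma raise_alpha_0: "P \<in> supported {(k, 0)} \<Longrightarrow> raise_alpha P = 0"
proof -
  assume "P \<in> supported {(k, 0)}"
  then have "D_beta i P \<in> supported {}" for i by (rule D_beta_supported) auto
  then show ?thesis by (simp add: supported_empty raise_alpha_def)
qed

lemma raise_beta_0: "P \<in> supported {(0, l)} \<Longrightarrow> raise_beta P = 0"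
proof -
  assume "P \<in> supported {(0, l)}"
  then have "D_alpha i P \<in> supported {}" for i by (rule D_alpha_supported) auto
  then show ?thesis by (simp add: supported_empty raise_beta_def)
qed

lemma raise_beta_alpha:
  assumes P: "P \<in> supported {(k, l)}"
  shows "raise_beta (raise_alpha P) =
    real l *\<^sub>R P + (\<Sum>i\<in>UNIV. \<Sum>j\<in>UNIV. beta i * (alpha j * D_alpha i (D_beta j P)))"
  unfolding raise_beta_def raise_alpha_def
  by (simp add: symbol_linear_simps D_alpha_times_alpha distrib_left sum_distrib_left sum.distrib
      euler_bidegree[OF P] if_distrib[of "\<lambda>x. _ * x"] cong: if_cong)

lemma raise_alpha_beta:
  assumes P: "P \<in> supported {(k, l)}"
  shows "raise_alpha (raise_beta P) = raise_beta (raise_alpha P) + (real k - real l) *\<^sub>R P"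
proof -
  have "raise_alpha (raise_beta P) =
    real k *\<^sub>R P + (\<Sum>i\<in>UNIV. \<Sum>j\<in>UNIV. alpha i * (beta j * D_beta i (D_alpha j P)))"
    unfolding raise_beta_def raise_alpha_def
    by (simp add: symbol_linear_simps D_beta_times_beta distrib_left sum_distrib_left sum.distrib
        euler_bidegree[OF P] if_distrib[of "\<lambda>x. _ * x"] cong: if_cong)
  also have "(\<Sum>i\<in>UNIV. \<Sum>j\<in>UNIV. alpha i * (beta j * D_beta i (D_alpha j P))) =
     (\<Sum>i\<in>UNIV. \<Sum>j\<in>UNIV. beta i * (alpha j * D_alpha i (D_beta j P)))"
    by (subst sum.swap) (simp add: D_alpha_D_beta mult.left_commute)
  finally show ?thesis
    by (simp add: raise_beta_alpha[OF P] scaleR_diff_left)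
qed

lemma gl_act_trace:
  assumes P: "P \<in> supported {(k, l)}"
  shows "(\<Sum>i\<in>UNIV. gl_act i i P) = (real k + real l) *\<^sub>R P"
  by (simp add: gl_act_def sum.distrib euler_bidegree[OF P] scaleR_add_left)

text \<open>The quadratic Casimir operator of \<open>gl\<^sub>n\<close> expressed through the commuting \<open>sl\<^sub>2\<close>.\<close>

lemma gl_act_quadratic:
  fixes P :: "'n::finite symbol"
  assumes P: "P \<in> supported {(k, l)}"
  shows "(\<Sum>i\<in>UNIV. \<Sum>j\<in>UNIV. gl_act j i (gl_act i j P)) =
    (real CARD('n) * (real k + real l) + real k * (real k - 1) + real l * (real l - 1) - real l - real
        l) *\<^sub>R P
    + 2 *\<^sub>R raise_beta (raise_alpha P)"
proof -
  let ?n = "real CARD('n)"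
  define S where "S = (\<Sum>i\<in>UNIV. \<Sum>j\<in>UNIV. beta i * (alpha j * D_alpha i (D_beta j P)))"
  have A: "(\<Sum>i\<in>UNIV. alpha i * D_alpha i (D_alpha j P)) = (real k - 1) *\<^sub>R D_alpha j P" for j
  proof -
    have "D_alpha j (\<Sum>i\<in>UNIV. alpha i * D_alpha i P) =
        D_alpha j P + (\<Sum>i\<in>UNIV. alpha i * D_alpha i (D_alpha j P))"
      by (simp add: symbol_linear_simps D_alpha_times_alpha sum.distrib D_alpha_commute[of j])
    then show ?thesis
      by (simp add: euler_bidegree[OF P] symbol_linear_simps scaleR_diff_left)
  qed
  have B: "(\<Sum>i\<in>UNIV. beta i * D_beta i (D_beta j P)) = (real l - 1) *\<^sub>R D_beta j P" for j
  proof -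
    have "D_beta j (\<Sum>i\<in>UNIV. beta i * D_beta i P) = D_beta j P + (\<Sum>i\<in>UNIV. beta i * D_beta i (D_beta j P))"
      by (simp add: symbol_linear_simps D_beta_times_beta sum.distrib D_beta_commute[of j])
    then show ?thesis
      by (simp add: euler_bidegree[OF P] symbol_linear_simps scaleR_diff_left)
  qed
  have "gl_act j i (gl_act i j P) =
      alpha j * D_alpha j P + alpha j * (alpha i * D_alpha i (D_alpha j P))
      + beta i * (alpha j * D_alpha i (D_beta j P)) + beta j * (alpha i * D_alpha j (D_beta i P))
      + (beta j * D_beta j P + beta j * (beta i * D_beta i (D_beta j P)))" for i j
    by (simp add: gl_act_def symbol_linear_simps D_alpha_times_alpha D_alpha_times_beta
        D_beta_times_beta D_beta_times_alpha distrib_left D_alpha_D_beta mult.left_commute)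
  then have "(\<Sum>i\<in>UNIV. \<Sum>j\<in>UNIV. gl_act j i (gl_act i j P)) =
      (\<Sum>i\<in>(UNIV::'n set). \<Sum>j\<in>UNIV. alpha j * D_alpha j P)
      + (\<Sum>i\<in>UNIV. \<Sum>j\<in>UNIV. alpha j * (alpha i * D_alpha i (D_alpha j P))) + S
      + (\<Sum>i\<in>UNIV. \<Sum>j\<in>UNIV. beta j * (alpha i * D_alpha j (D_beta i P)))
      + ((\<Sum>i\<in>(UNIV::'n set). \<Sum>j\<in>UNIV. beta j * D_beta j P)
      + (\<Sum>i\<in>UNIV. \<Sum>j\<in>UNIV. beta j * (beta i * D_beta i (D_beta j P))))"
    by (simp only: sum.distrib S_def)
  also have "(\<Sum>i\<in>UNIV. \<Sum>j\<in>UNIV. beta j * (alpha i * D_alpha j (D_beta i P))) = S"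
    unfolding S_def by (rule sum.swap)
  also have "(\<Sum>i\<in>UNIV. \<Sum>j\<in>UNIV. alpha j * (alpha i * D_alpha i (D_alpha j P))) =
      (real k * (real k - 1)) *\<^sub>R P"
    by (subst sum.swap)
       (simp add: sum_distrib_left[symmetric] A scaleR_sum_right[symmetric] euler_bidegree[OF P]
           mult.commute)
  also have "(\<Sum>i\<in>UNIV. \<Sum>j\<in>UNIV. beta j * (beta i * D_beta i (D_beta j P))) = (real l * (real l - 1)) *\<^sub>R P"
    by (subst sum.swap)
       (simp add: sum_distrib_left[symmetric] B scaleR_sum_right[symmetric] euler_bidegree[OF P]
           mult.commute)
  also have "(\<Sum>i\<in>(UNIV::'n set). \<Sum>j\<in>UNIV. alpha j * D_alpha j P) = (?n * real k) *\<^sub>R P"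
    by (simp only: euler_bidegree[OF P] sum_constant_scaleR scaleR_scaleR)
  also have "(\<Sum>i\<in>(UNIV::'n set). \<Sum>j\<in>UNIV. beta j * D_beta j P) = (?n * real l) *\<^sub>R P"
    by (simp only: euler_bidegree[OF P] sum_constant_scaleR scaleR_scaleR)
  also have "S = raise_beta (raise_alpha P) - real l *\<^sub>R P"
    by (simp add: raise_beta_alpha[OF P] S_def)
  finally show ?thesis
    by (simp only: scaleR_add_left scaleR_diff_left scaleR_minus_left distrib_left scaleR_2 add_ac
        diff_conv_add_uminus minus_add_distrib)
qed

text \<open>The constants \<open>\<gamma>\<close> of the resonance condition appear here: \<open>\<gamma>\<close> at \<open>(k + l, l)\<close> is the eigenvalue on
  the highest weight vectors of bidegree \<open>(k, l)\<close>, which \<open>raise_alpha\<close> kills.\<close>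

lemma symbol_casimir_bidegree:
  fixes P :: "'n::finite symbol"
  assumes P: "P \<in> supported {(k, l)}"
  shows "symbol_casimir \<delta> P = casimir_gamma CARD('n) \<delta> (k + l) l *\<^sub>R P + 2 *\<^sub>R raise_beta (raise_alpha P)"
proof -
  let ?n = "real CARD('n)" and ?s = "real k + real l"
  have gamma: "casimir_gamma CARD('n) \<delta> (k + l) l =
    (?n * ?s + real k * (real k - 1) + real l * (real l - 1) - real l - real l) + ?s * ?s
    + (?n + 1 - 2 * (?n + 1) * \<delta>) * ?s + ?n * (?n + 1) * \<delta> * (\<delta> - 1)"
    by (simp add: casimir_gamma_def algebra_simps power2_eq_square)
  show ?thesis
    unfolding symbol_casimir_gl gl_act_quadratic[OF P] gl_act_trace[OF P]
      linear_scale[OF linear_gl_act] scaleR_sum_right[symmetric] gamma scaleR_scaleR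
    by (simp only: scaleR_add_left ac_simps)
qed

lemma casimir_gamma_symmetric: "casimir_gamma n \<delta> (k + l) k =
    casimir_gamma n \<delta> (k + l) l + 2 * (real l - real k)"
  by (simp add: casimir_gamma_def algebra_simps power2_eq_square)

text \<open>Exchanging the covectors reverses the order of the two ladder operators; the new value of \<open>\<gamma>\<close>
  accounts for their commutator.\<close>

lemma symbol_casimir_bidegree':
  fixes P :: "'n::finite symbol"
  assumes P: "P \<in> supported {(k, l)}"
  shows "symbol_casimir \<delta> P = casimir_gamma CARD('n) \<delta> (k + l) k *\<^sub>R P + 2 *\<^sub>R raise_alpha (raise_beta P)"
  by (simp add: symbol_casimir_bidegree[OF P] raise_alpha_beta[OF P] casimir_gamma_symmetric algebra_simps)

text \<open>Compare the values of the Casimir operator on two neighbouring bidegrees: the change of \<open>\<gamma>\<close> is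
  compensated by the commutator of \<open>raise_alpha\<close> and \<open>raise_beta\<close>.\<close>

lemma symbol_casimir_raise_beta:
  assumes P: "P \<in> supported {(k, l)}"
  shows "symbol_casimir \<delta> (raise_beta P) = raise_beta (symbol_casimir \<delta> P)"
proof (cases k)
  case 0
  then have "raise_beta P = 0" using P raise_beta_0 by blast
  moreover have "raise_beta (symbol_casimir \<delta> P) = 0"
    using symbol_casimir_supported[OF P] 0 raise_beta_0 by blast
  ultimately show ?thesis by (simp add: linear_0[OF linear_symbol_casimir])
next
  case (Suc m)
  let ?F = raise_beta and ?E = raise_alpha and ?\<gamma> = "casimir_gamma CARD('a) \<delta>"
  have FP: "?F P \<in> supported {(m, Suc l)}" using P Suc raise_beta_supported by blast
  have "symbol_casimir \<delta> (?F P) = ?\<gamma> (k + l) (Suc l) *\<^sub>R ?F P + 2 *\<^sub>R ?F (?E (?F P))"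
    using symbol_casimir_bidegree[OF FP, of \<delta>] Suc by simp
  also have "?F (?E (?F P)) = ?F (?F (?E P)) + (real k - real l) *\<^sub>R ?F P"
    by (simp add: raise_alpha_beta[OF P] linear_add[OF linear_raise(2)] linear_scale[OF linear_raise(2)])
  also have "?\<gamma> (k + l) (Suc l) = ?\<gamma> (k + l) l - 2 * (real k - real l)"
    by (simp add: casimir_gamma_def algebra_simps power2_eq_square)
  finally show ?thesis
    by (simp add: symbol_casimir_bidegree[OF P] linear_add[OF linear_raise(2)]
        linear_scale[OF linear_raise(2)] scaleR_diff_left scaleR_diff_right scaleR_add_right)
qed

lemma symbol_casimir_raise_alpha:
  assumes P: "P \<in> supported {(k, l)}"
  shows "symbol_casimir \<delta> (raise_alpha P) = raise_alpha (symbol_casimir \<delta> P)"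
proof (cases l)
  case 0
  then have "raise_alpha P = 0" using P raise_alpha_0 by blast
  moreover have "raise_alpha (symbol_casimir \<delta> P) = 0"
    using symbol_casimir_supported[OF P] 0 raise_alpha_0 by blast
  ultimately show ?thesis by (simp add: linear_0[OF linear_symbol_casimir])
next
  case (Suc m)
  let ?F = raise_beta and ?E = raise_alpha and ?\<gamma> = "casimir_gamma CARD('a) \<delta>"
  have EP: "?E P \<in> supported {(Suc k, m)}" using P Suc raise_alpha_supported by blast
  have "symbol_casimir \<delta> (?E P) = ?\<gamma> (k + l) (Suc k) *\<^sub>R ?E P + 2 *\<^sub>R ?E (?F (?E P))"
    using symbol_casimir_bidegree'[OF EP, of \<delta>] Suc by simp
  also have "?E (?F (?E P)) = ?E (?E (?F P)) - (real k - real l) *\<^sub>R ?E P"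
    by (simp add: raise_alpha_beta[OF P] linear_add[OF linear_raise(1)] linear_scale[OF linear_raise(1)])
  also have "?\<gamma> (k + l) (Suc k) = ?\<gamma> (k + l) k + 2 * (real k - real l)"
    by (simp add: casimir_gamma_def algebra_simps power2_eq_square)
  finally show ?thesis
    by (simp add: symbol_casimir_bidegree'[OF P] linear_add[OF linear_raise(1)]
        linear_scale[OF linear_raise(1)] scaleR_add_left scaleR_diff_left scaleR_diff_right
        scaleR_add_right)
qed

lemma single_bidegree_cases:
  "{d :: nat \<times> nat. fst d + snd d = i \<and> snd d = l} = (if l \<le> i then {(i - l, l)} else {})"
  "{d :: nat \<times> nat. fst d + snd d = i \<and> fst d = l} = (if l \<le> i then {(l, i - l)} else {})"
  by auto

text \<open>The ladder that starts at \<open>\<beta>\<close>-degree zero.\<close>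

lemma casimir_annihilated_beta:
  fixes P :: "'n::finite symbol"
  assumes "P \<in> supported {d. fst d + snd d = i \<and> snd d = l}"
  shows "op_poly (\<Prod>p\<le>l. [:- casimir_gamma CARD('n) \<delta> i p, 1:]) (symbol_casimir \<delta>) P = 0"
proof (rule sl2_ladder_annihilates[where B = "\<lambda>l. supported {d. fst d + snd d = i \<and> snd d = l}"
      and E = raise_alpha and F = raise_beta, OF linear_symbol_casimir linear_raise])
  fix l and Q :: "'n symbol"
  assume Q: "Q \<in> supported {d. fst d + snd d = i \<and> snd d = l}"
  show "symbol_casimir \<delta> Q \<in> supported {d. fst d + snd d = i \<and> snd d = l}"
    using Q by (rule symbol_casimir_supported)
  show "symbol_casimir \<delta> (raise_beta Q) = raise_beta (symbol_casimir \<delta> Q)"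
    using Q symbol_casimir_raise_beta[of Q "i - l" l]
    by (auto simp: single_bidegree_cases supported_empty linear_0 linear_raise linear_symbol_casimir
        split: if_splits)
  show "symbol_casimir \<delta> Q = casimir_gamma CARD('n) \<delta> i l *\<^sub>R Q + 2 *\<^sub>R raise_beta (raise_alpha Q)"
    using Q symbol_casimir_bidegree[of Q "i - l" l \<delta>]
    by (auto simp: single_bidegree_cases supported_empty linear_0 linear_raise linear_symbol_casimir
        split: if_splits)
next
  fix l and Q :: "'n symbol"
  assume Q: "Q \<in> supported {d. fst d + snd d = i \<and> snd d = Suc l}"
  show "raise_alpha Q \<in> supported {d. fst d + snd d = i \<and> snd d = l}"
  proof (cases "Suc l \<le> i")
    case True
    then have "Suc (i - Suc l) = i - l" by simp
    with True Q show ?thesis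
      using raise_alpha_supported[of Q "i - Suc l" l] by (simp add: single_bidegree_cases)
  next
    case False
    then show ?thesis using Q
      by (simp add: single_bidegree_cases supported_empty linear_0 linear_raise
          subspace_0[OF subspace_supported])
  qed
next
  fix Q :: "'n symbol"
  assume "Q \<in> supported {d. fst d + snd d = i \<and> snd d = 0}"
  then show "raise_alpha Q = 0" using raise_alpha_0[of Q i] by (simp add: single_bidegree_cases)
qed (use assms subspace_supported in auto)

text \<open>The ladder that starts at \<open>\<alpha>\<close>-degree zero.\<close>

lemma casimir_annihilated_alpha:
  fixes P :: "'n::finite symbol"
  assumes "P \<in> supported {d. fst d + snd d = i \<and> fst d = l}"
  shows "op_poly (\<Prod>p\<le>l. [:- casimir_gamma CARD('n) \<delta> i p, 1:]) (symbol_casimir \<delta>) P = 0"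
proof (rule sl2_ladder_annihilates[where B = "\<lambda>l. supported {d. fst d + snd d = i \<and> fst d = l}"
      and E = raise_beta and F = raise_alpha, OF linear_symbol_casimir linear_raise(2,1)])
  fix l and Q :: "'n symbol"
  assume Q: "Q \<in> supported {d. fst d + snd d = i \<and> fst d = l}"
  show "symbol_casimir \<delta> Q \<in> supported {d. fst d + snd d = i \<and> fst d = l}"
    using Q by (rule symbol_casimir_supported)
  show "symbol_casimir \<delta> (raise_alpha Q) = raise_alpha (symbol_casimir \<delta> Q)"
    using Q symbol_casimir_raise_alpha[of Q l "i - l"]
    by (auto simp: single_bidegree_cases supported_empty linear_0 linear_raise linear_symbol_casimir
        split: if_splits)
  show "symbol_casimir \<delta> Q = casimir_gamma CARD('n) \<delta> i l *\<^sub>R Q + 2 *\<^sub>R raise_alpha (raise_beta Q)"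
    using Q symbol_casimir_bidegree'[of Q l "i - l" \<delta>]
    by (auto simp: single_bidegree_cases supported_empty linear_0 linear_raise linear_symbol_casimir
        split: if_splits)
next
  fix l and Q :: "'n symbol"
  assume Q: "Q \<in> supported {d. fst d + snd d = i \<and> fst d = Suc l}"
  show "raise_beta Q \<in> supported {d. fst d + snd d = i \<and> fst d = l}"
  proof (cases "Suc l \<le> i")
    case True
    then have "Suc (i - Suc l) = i - l" by simp
    with True Q show ?thesis
      using raise_beta_supported[of Q l "i - Suc l"] by (simp add: single_bidegree_cases)
  next
    case False
    then show ?thesis using Q
      by (simp add: single_bidegree_cases supported_empty linear_0 linear_raise
          subspace_0[OF subspace_supported])
  qed
next
  fix Q :: "'n symbol"
  assume "Q \<in> supported {d. fst d + snd d = i \<and> fst d = 0}"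
  then show "raise_beta Q = 0" using raise_beta_0[of Q i] by (simp add: single_bidegree_cases)
qed (use assms subspace_supported in auto)

definition casimir_poly :: "nat \<Rightarrow> real \<Rightarrow> nat \<Rightarrow> real poly" where
  "casimir_poly n \<delta> i = (\<Prod>p\<le>i div 2. [:- casimir_gamma n \<delta> i p, 1:])"

text \<open>In total degree \<open>i\<close> one of the two partial degrees is at most \<open>i div 2\<close>, and the ladder that starts
  from that side stays within the factors of \<open>casimir_poly\<close>.\<close>

lemma casimir_poly_annihilates:
  fixes P :: "'n::finite symbol"
  assumes "P \<in> supported {d. fst d + snd d = i}"
  shows "op_poly (casimir_poly CARD('n) \<delta> i) (symbol_casimir \<delta>) P = 0"
proof -
  let ?C = "symbol_casimir \<delta> :: 'n symbol \<Rightarrow> 'n symbol"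
  have dvd: "op_poly (casimir_poly CARD('n) \<delta> i) ?C Q = 0"
    if "l \<le> i div 2" "op_poly (\<Prod>p\<le>l. [:- casimir_gamma CARD('n) \<delta> i p, 1:]) ?C Q = 0" for l Q
  proof -
    have "(\<Prod>p\<le>l. [:- casimir_gamma CARD('n) \<delta> i p, 1:]) dvd casimir_poly CARD('n) \<delta> i"
      unfolding casimir_poly_def by (rule prod_dvd_prod_subset) (use that in auto)
    then obtain q where "casimir_poly CARD('n) \<delta> i = (\<Prod>p\<le>l. [:- casimir_gamma CARD('n) \<delta> i p, 1:]) * q" ..
    then have "casimir_poly CARD('n) \<delta> i = q * (\<Prod>p\<le>l. [:- casimir_gamma CARD('n) \<delta> i p, 1:])"
      by (simp only: mult.commute)
    then show ?thesis
      by (simp only: op_poly_mult[OF linear_symbol_casimir] that(2)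
          linear_0[OF linear_op_poly[OF linear_symbol_casimir]])
  qed
  have "op_poly (casimir_poly CARD('n) \<delta> i) ?C P \<in> {0}"
    using assms
  proof (rule supported_linear_image[OF _ linear_op_poly[OF linear_symbol_casimir] subspace_single_0])
    fix k :: "'n multi_index \<times> 'n multi_index" and c
    assume k: "bidegree k \<in> {d. fst d + snd d = i}"
    show "op_poly (casimir_poly CARD('n) \<delta> i) ?C (Poly_Mapping.single k c) \<in> {0}"
    proof (cases "snd (bidegree k) \<le> i div 2")
      case True
      then show ?thesis
        using k dvd casimir_annihilated_beta[of "Poly_Mapping.single k c" i "snd (bidegree k)" \<delta>]
        by (auto intro!: single_supported)
    next
      case False
      then have "fst (bidegree k) \<le> i div 2" using k by auto
      then show ?thesis
        using k dvd casimir_annihilated_alpha[of "Poly_Mapping.single k c" i "fst (bidegree k)" \<delta>]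
        by (auto intro!: single_supported)
    qed
  qed
  then show ?thesis by simp
qed

lemma casimir_poly_comaximal:
  assumes "\<not> resonant n \<delta>" "i \<noteq> j"
  shows "comaximal (casimir_poly n \<delta> i) (casimir_poly n \<delta> j)"
  unfolding casimir_poly_def
proof (rule comaximal_prod, rule comaximal_sym, rule comaximal_prod, rule comaximal_linear_factors)
  fix p q assume "q \<in> {..j div 2}" "p \<in> {..i div 2}"
  then show "casimir_gamma n \<delta> j q \<noteq> casimir_gamma n \<delta> i p"
    using assms unfolding resonant_def by (metis atMost_iff linorder_neqE_nat)
qed

section \<open>Homogeneous components\<close>

lemma lookup_homogeneous_component:
  "Poly_Mapping.lookup (homogeneous_component r P) k =
      (if monomial_degree k = r then Poly_Mapping.lookup P k else 0)"
  by (simp add: homogeneous_component_def lookup_mapp when_def in_keys_iff)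

lemma linear_homogeneous_component: "linear (homogeneous_component r)"
  by (rule linearI) (auto intro!: poly_mapping_eqI simp: lookup_homogeneous_component lookup_add
      lookup_scaleR)

lemma homogeneous_component_twice:
  "homogeneous_component i (homogeneous_component j P) = (if i = j then homogeneous_component i P else 0)"
  by (auto intro!: poly_mapping_eqI simp: lookup_homogeneous_component)

lemma homogeneous_component_supported: "homogeneous_component i P \<in> supported {d. fst d + snd d = i}"
  by (auto simp: supported_def lookup_homogeneous_component monomial_degree_bidegree)

lemma homogeneous_component_id: "P \<in> supported {d. fst d + snd d = i} \<Longrightarrow> homogeneous_component i P = P"
  by (auto intro!: poly_mapping_eqI simp: supported_def lookup_homogeneous_component
      monomial_degree_bidegree)

lemma homogeneous_component_single:
  "homogeneous_component i (Poly_Mapping.single k c) =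
      (if monomial_degree k = i then Poly_Mapping.single k c else 0)"
  by (auto intro!: poly_mapping_eqI simp: lookup_homogeneous_component lookup_single when_def)

lemma degree_below_iff: "P \<in> degree_below m \<longleftrightarrow> (\<forall>i\<ge>m. homogeneous_component i P = 0)"
proof
  assume "P \<in> degree_below m"
  then show "\<forall>i\<ge>m. homogeneous_component i P = 0"
    by (auto intro!: poly_mapping_eqI
        simp: degree_below_def supported_def lookup_homogeneous_component monomial_degree_bidegree)
next
  assume *: "\<forall>i\<ge>m. homogeneous_component i P = 0"
  have "Poly_Mapping.lookup P k = 0" if "\<not> monomial_degree k < m" for k
  proof -
    have "Poly_Mapping.lookup (homogeneous_component (monomial_degree k) P) k = 0"
      using * that by simp
    then show ?thesis by (simp add: lookup_homogeneous_component)
  qed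
  then show "P \<in> degree_below m"
    by (auto simp: degree_below_def supported_def monomial_degree_bidegree)
qed

lemma homogeneous_component_commute:
  assumes "linear T" "\<And>D P. P \<in> supported D \<Longrightarrow> T P \<in> supported D"
  shows "homogeneous_component i (T P) = T (homogeneous_component i P)"
proof (rule linear_eq_on_singles[where f = "\<lambda>P. homogeneous_component i (T P)"])
  show "linear (\<lambda>P. homogeneous_component i (T P))" "linear (\<lambda>P. T (homogeneous_component i P))"
    using linear_compose[OF assms(1) linear_homogeneous_component]
      linear_compose[OF linear_homogeneous_component assms(1)] by (simp_all add: o_def)
  fix k c
  let ?S = "T (Poly_Mapping.single k c)"
  have "?S \<in> supported {d. fst d + snd d = monomial_degree k}"
    by (intro assms(2) single_supported) (simp add: monomial_degree_bidegree)
  then have "homogeneous_component (monomial_degree k) ?S = ?S"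
    by (rule homogeneous_component_id)
  then have "homogeneous_component i ?S = (if monomial_degree k = i then ?S else 0)"
    by (metis homogeneous_component_twice)
  then show "homogeneous_component i ?S = T (homogeneous_component i (Poly_Mapping.single k c))"
    by (simp add: homogeneous_component_single linear_0[OF assms(1)])
qed

section \<open>Differential operators on symbols\<close>

definition elementary_ops :: "('n::finite symbol \<Rightarrow> 'n symbol) set" where
  "elementary_ops = range (\<lambda>f P. const_symbol f * P) \<union> range (\<lambda>i P. alpha i * P) \<union> range (\<lambda>i P. beta i * P)
     \<union> range D_alpha \<union> range D_beta \<union> range coeff_pdiff \<union> range homogeneous_component"

text \<open>Elementary operators are composed on the left only: on a normal form this is checked term by term,
  and polynomials in the Casimir operator are built up in this direction.\<close>

inductive symbol_diffop :: "('n::finite symbol \<Rightarrow> 'n symbol) \<Rightarrow> bool" where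
  ident: "symbol_diffop (\<lambda>P. P)"
| comp: "g \<in> elementary_ops \<Longrightarrow> symbol_diffop F \<Longrightarrow> symbol_diffop (\<lambda>P. g (F P))"
| add: "symbol_diffop F \<Longrightarrow> symbol_diffop G \<Longrightarrow> symbol_diffop (\<lambda>P. F P + G P)"

text \<open>The normal form of a differential operator that \<open>is_differential\<close> asks for.\<close>

definition diffop_of :: "((('n::finite multi_index \<times> 'n multi_index) \<times> ('n multi_index \<times> 'n multi_index)
    \<times> 'n multi_index) \<Rightarrow>\<^sub>0 'n smooth_fun) \<Rightarrow> 'n symbol \<Rightarrow> 'n symbol" where
  "diffop_of C P = (\<Sum>(l, k, c)\<in>Poly_Mapping.keys C. Poly_Mapping.single l
     (Poly_Mapping.lookup C (l, k, c) * multi_deriv c (Poly_Mapping.lookup P k)))"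

lemma linear_diffop_term:
  "linear (\<lambda>x. Poly_Mapping.single (fst m) (x * multi_deriv (snd (snd m))
      (Poly_Mapping.lookup P (fst (snd m)))))"
  by (rule linearI) (simp_all add: distrib_right single_add scaleR_single)

lemma diffop_of_altdef:
  "diffop_of C P = (\<Sum>m\<in>Poly_Mapping.keys C. (\<lambda>m x. Poly_Mapping.single (fst m)
     (x * multi_deriv (snd (snd m)) (Poly_Mapping.lookup P (fst (snd m))))) m (Poly_Mapping.lookup C m))"
  by (simp add: diffop_of_def case_prod_unfold)

lemma linear_diffop_of: "linear (\<lambda>C. diffop_of C P)"
  unfolding diffop_of_altdef by (rule linear_keys_sum) (rule linear_diffop_term)

lemma diffop_of_single:
  "diffop_of (Poly_Mapping.single (l, k, c) x) P =
      Poly_Mapping.single l (x * multi_deriv c (Poly_Mapping.lookup P k))"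
  unfolding diffop_of_altdef by (subst keys_sum_single)
      (simp_all only: linear_diffop_term fst_conv snd_conv)

lemma elementary_linear: "g \<in> elementary_ops \<Longrightarrow> linear g"
  by (auto simp: elementary_ops_def intro: linear_times_left linear_D_alpha linear_D_beta
      linear_coeff_pdiff linear_homogeneous_component)

lemma elementary_of_single:
  assumes "g \<in> elementary_ops"
  shows "\<exists>C. \<forall>P. g (Poly_Mapping.single l (x * multi_deriv c (Poly_Mapping.lookup P k))) = diffop_of C P"
proof -
  obtain a b where l: "l = (a, b)" by (cases l)
  have monom: "\<exists>C. \<forall>P. Poly_Mapping.single l' (y * multi_deriv c (Poly_Mapping.lookup P k)) =
      diffop_of C P" for l' y
    by (rule exI[of _ "Poly_Mapping.single (l', k, c) y"]) (simp add: diffop_of_single)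
  from assms consider f where "g = (*) (const_symbol f)" | i where "g = (*) (alpha i)"
    | i where "g = (*) (beta i)" | i where "g = D_alpha i" | i where "g = D_beta i"
    | i where "g = coeff_pdiff i" | i where "g = homogeneous_component i"
    unfolding elementary_ops_def by blast
  then show ?thesis
  proof cases
    case (1 f)
    then show ?thesis using monom[of l "f * x"] by (simp add: const_symbol_times_single mult.assoc)
  next
    case 2
    then show ?thesis using monom by (simp add: l alpha_times_single)
  next
    case 3
    then show ?thesis using monom by (simp add: l beta_times_single)
  next
    case (4 i)
    then show ?thesis using monom[of _ "of_nat (a $ i) * x"] by (simp add: l D_alpha_single mult.assoc)
  next
    case (5 i)
    then show ?thesis using monom[of _ "of_nat (b $ i) * x"] by (simp add: l D_beta_single mult.assoc)
  next
    case (6 i)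
    let ?C = "Poly_Mapping.single (l, k, c) (pdiff i x) + Poly_Mapping.single (l, k, c + axis i 1) x"
    have "g (Poly_Mapping.single l (x * multi_deriv c (Poly_Mapping.lookup P k))) = diffop_of ?C P" for P
      unfolding 6 coeff_pdiff_single pdiff_mult linear_add[OF linear_diffop_of] diffop_of_single
        multi_deriv_add_axis single_add by (rule add.commute)
    then show ?thesis by blast
  next
    case (7 i)
    show ?thesis
    proof (cases "monomial_degree l = i")
      case True
      then show ?thesis using monom[of l x] by (simp add: 7 homogeneous_component_single)
    next
      case False
      then show ?thesis
        by (intro exI[of _ 0]) (simp add: 7 homogeneous_component_single linear_0[OF linear_diffop_of])
    qed
  qed
qed

lemma elementary_of_diffop:
  assumes g: "g \<in> elementary_ops"
  shows "\<exists>C'. \<forall>P. g (diffop_of C P) = diffop_of C' P"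
proof (induction C rule: single_plus_induct)
  case (single m x)
  obtain l k c where "m = (l, k, c)" by (cases m)
  then show ?case using elementary_of_single[OF g] by (simp add: diffop_of_single)
next
  case (plus p q)
  then obtain C D where "\<forall>P. g (diffop_of p P) = diffop_of C P" "\<forall>P. g (diffop_of q P) = diffop_of D P"
    by blast
  then show ?case
    by (intro exI[of _ "C + D"]) (simp add: linear_add[OF linear_diffop_of]
        linear_add[OF elementary_linear[OF g]])
qed

lemma finite_bounded_multi_index: "finite {a :: 'n::finite multi_index. \<forall>i. a $ i \<le> r}"
proof (rule finite_subset)
  show "{a :: 'n multi_index. \<forall>i. a $ i \<le> r} \<subseteq> vec_lambda ` (UNIV \<rightarrow>\<^sub>E {..r})"
  proof
    fix a :: "'n multi_index"
    assume "a \<in> {a. \<forall>i. a $ i \<le> r}"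
    then have "a = vec_lambda (($) a)" "($) a \<in> UNIV \<rightarrow>\<^sub>E {..r}" by auto
    then show "a \<in> vec_lambda ` (UNIV \<rightarrow>\<^sub>E {..r})" by blast
  qed
qed (intro finite_imageI finite_PiE; simp)

lemma finite_monomials: "finite {k :: 'n::finite multi_index \<times> 'n multi_index. monomial_degree k \<le> r}"
proof (rule finite_subset)
  show "{k :: 'n multi_index \<times> 'n multi_index. monomial_degree k \<le> r} \<subseteq> {a. \<forall>i. a $ i \<le> r} \<times> {a. \<forall>i. a
      $ i \<le> r}"
  proof clarify
    fix a b :: "'n multi_index"
    assume *: "monomial_degree (a, b) \<le> r"
    have "a $ i \<le> (\<Sum>i\<in>UNIV. a $ i)" "b $ i \<le> (\<Sum>i\<in>UNIV. b $ i)" for i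
      by (auto intro: member_le_sum)
    then show "a \<in> {a. \<forall>i. a $ i \<le> r} \<and> b \<in> {a. \<forall>i. a $ i \<le> r}"
      using * unfolding monomial_degree_def by (auto intro: order_trans le_trans trans_le_add1
          trans_le_add2)
         (metis add_leE order_trans)+
  qed
qed (intro finite_cartesian_product finite_bounded_multi_index)

text \<open>A bound on the degree is needed already for the identity, whose normal form has one term for each
  monomial.\<close>

lemma symbol_diffop_representation:
  "symbol_diffop F \<Longrightarrow> \<exists>C. \<forall>P\<in>degree_below (Suc r). F P = diffop_of C P"
proof (induction rule: symbol_diffop.induct)
  case ident
  let ?K = "{k :: 'a multi_index \<times> 'a multi_index. monomial_degree k \<le> r}"
  have "P = diffop_of (\<Sum>k\<in>?K. Poly_Mapping.single (k, k, 0) 1) P" if "P \<in> degree_below (Suc r)" for P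
  proof -
    have "P = (\<Sum>k\<in>?K. Poly_Mapping.single k (Poly_Mapping.lookup P k))"
    proof (subst sum_single_keys[symmetric], rule sum.mono_neutral_left)
      show "Poly_Mapping.keys P \<subseteq> ?K"
      proof
        fix k assume "k \<in> Poly_Mapping.keys P"
        then have "bidegree k \<in> {d. fst d + snd d < Suc r}"
          using that unfolding degree_below_def supported_def in_keys_iff by blast
        then show "k \<in> ?K" by (simp add: monomial_degree_bidegree)
      qed
    qed (auto simp: finite_monomials in_keys_iff)
    then show ?thesis
      by (simp add: linear_sum[OF linear_diffop_of] diffop_of_single)
  qed
  then show ?case by blast
next
  case (comp g F)
  then show ?case using elementary_of_diffop by metis
next
  case (add F G)
  then obtain C D where "\<forall>P\<in>degree_below (Suc r). F P = diffop_of C P"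
      "\<forall>P\<in>degree_below (Suc r). G P = diffop_of D P"
    by blast
  then show ?case
    by (intro exI[of _ "C + D"]) (simp add: linear_add[OF linear_diffop_of])
qed

lemma diffop_generators:
  assumes "symbol_diffop F"
  shows "symbol_diffop (\<lambda>P. const_symbol f * F P)" "symbol_diffop (\<lambda>P. alpha i * F P)"
    "symbol_diffop (\<lambda>P. beta i * F P)" "symbol_diffop (\<lambda>P. D_alpha i (F P))"
    "symbol_diffop (\<lambda>P. D_beta i (F P))" "symbol_diffop (\<lambda>P. coeff_pdiff i (F P))"
    "symbol_diffop (\<lambda>P. homogeneous_component m (F P))"
  using symbol_diffop.comp[OF _ assms] by (auto simp: elementary_ops_def)

lemma scaleR_eq_const_symbol: "c *\<^sub>R P = const_symbol (c *\<^sub>R 1) * P"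
  by (simp add: const_symbol_scaleR)

lemma diffop_scaleR: "symbol_diffop F \<Longrightarrow> symbol_diffop (\<lambda>P. c *\<^sub>R F P)"
  unfolding scaleR_eq_const_symbol by (rule diffop_generators)

lemma diffop_uminus: "symbol_diffop F \<Longrightarrow> symbol_diffop (\<lambda>P. - F P)"
  using diffop_scaleR[of F "-1"] by simp

lemma diffop_diff: "symbol_diffop F \<Longrightarrow> symbol_diffop G \<Longrightarrow> symbol_diffop (\<lambda>P. F P - G P)"
  using symbol_diffop.add[OF _ diffop_uminus] by fastforce

lemma diffop_zero: "symbol_diffop (\<lambda>P. 0)"
  using diffop_scaleR[OF symbol_diffop.ident, of 0] by simp

lemma diffop_sum: "(\<And>i. i \<in> I \<Longrightarrow> symbol_diffop (F i)) \<Longrightarrow> symbol_diffop (\<lambda>P. \<Sum>i\<in>I. F i P)"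
  by (induction I rule: infinite_finite_induct) (auto intro: diffop_zero symbol_diffop.add)

lemma diffop_op_action: "symbol_diffop F \<Longrightarrow> symbol_diffop (\<lambda>P. op_action w \<mu> a b (F P))"
  unfolding op_action_def lie_symbol_altdef gl_act_def order_lowering_def
  by (cases a; cases b)
     (auto intro!: symbol_diffop.add diffop_diff diffop_sum diffop_scaleR diffop_generators diffop_zero)

lemma diffop_op_casimir: "symbol_diffop F \<Longrightarrow> symbol_diffop (\<lambda>P. op_casimir w \<mu> (F P))"
  unfolding op_casimir_def by (intro diffop_sum diffop_op_action)

lemma diffop_op_poly:
  "symbol_diffop F \<Longrightarrow> symbol_diffop (\<lambda>P. op_poly p (op_casimir w \<mu>) (F P))"
  by (induction p)
     (auto simp: op_poly_pCons[OF linear_op_casimir]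
       intro!: symbol_diffop.add diffop_scaleR diffop_op_casimir diffop_zero)

section \<open>Degrees\<close>

lemma degree_below_total_degree: "P \<in> degree_below (Suc m) \<longleftrightarrow> total_degree P \<le> m"
  by (auto simp: degree_below_def supported_def total_degree_def in_keys_iff monomial_degree_bidegree
      less_Suc_eq_le)

text \<open>Two polynomials have the same principal part if their difference has lower degree than one of them.
  For \<open>total_degree P = 0\<close> the hypothesis says \<open>B = P\<close>.\<close>

lemma principal_part_determined:
  assumes "B - P \<in> degree_below (total_degree P)"
  shows "total_degree B = total_degree P"
    and "homogeneous_component (total_degree P) B = homogeneous_component (total_degree P) P"
proof -
  let ?m = "total_degree P"
  show hom: "homogeneous_component ?m B = homogeneous_component ?m P"
    using assms by (auto simp: degree_below_iff linear_diff[OF linear_homogeneous_component])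
  have P: "P \<in> degree_below (Suc ?m)" by (simp add: degree_below_total_degree)
  have "(B - P) + P \<in> degree_below (Suc ?m)"
    using assms degree_below_mono[of ?m "Suc ?m"] P by (intro subspace_add[OF subspace_degree_below]) auto
  then have le: "total_degree B \<le> ?m" by (simp add: degree_below_total_degree)
  show "total_degree B = ?m"
  proof (rule ccontr)
    assume "total_degree B \<noteq> ?m"
    with le obtain m where m: "?m = Suc m" "total_degree B \<le> m"
      by (cases ?m) auto
    then have "B - (B - P) \<in> degree_below (Suc m)"
      using assms
      by (intro subspace_diff[OF subspace_degree_below, of B _ "B - P"])
          (simp_all add: degree_below_total_degree)
    then have "P \<in> degree_below (Suc m)" by simp
    then show False using m by (simp add: degree_below_total_degree)
  qed
qed

section \<open>The projectively equivariant symbol map\<close>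

lemma divergence_add: "divergence (X + Y) = divergence X + divergence Y"
  by (simp add: divergence_def pdiff_add sum.distrib)

lemma divergence_scaleR: "divergence (c *\<^sub>R X) = c *\<^sub>R divergence X"
  by (simp add: divergence_def pdiff_scaleR scaleR_sum_right)

lemma linear_lie_density_field: "linear (\<lambda>X. lie_density w X f)"
  by (rule linearI)
     (simp_all add: lie_density_def divergence_add divergence_scaleR distrib_right sum.distrib
       scaleR_add_right scaleR_sum_right scaleR_left_commute)

lemma linear_lie_symbol_field: "linear (\<lambda>X. lie_symbol \<delta> X P)"
  by (rule linearI)
     (simp_all add: lie_symbol_altdef divergence_add divergence_scaleR distrib_right sum.distrib
       scaleR_add_right scaleR_diff_right scaleR_sum_right scaleR_left_commute const_symbol_add
       const_symbol_scaleR pdiff_add pdiff_scaleR)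

lemma lie_bidiff_gl_field: "lie_bidiff w \<mu> (gl_field a b) (bidiff_of A) = bidiff_of (op_action w \<mu> a b A)"
  by (intro ext) (simp add: bidiff_of_op_action)

lemma lie_bidiff_field_linear:
  "lie_bidiff w \<mu> (X + Y) (bidiff_of A) f g =
      lie_bidiff w \<mu> X (bidiff_of A) f g + lie_bidiff w \<mu> Y (bidiff_of A) f g"
  "lie_bidiff w \<mu> (c *\<^sub>R X) (bidiff_of A) f g = c *\<^sub>R lie_bidiff w \<mu> X (bidiff_of A) f g"
  by (simp_all add: lie_bidiff_def linear_add[OF linear_lie_density_field]
      linear_scale[OF linear_lie_density_field] bidiff_of_arg_simps scaleR_diff_right)

lemma bidiff_of_add: "bidiff_of (A + B) = (\<lambda>f g. bidiff_of A f g + bidiff_of B f g)"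
  by (intro ext) (simp add: bidiff_of_linear_simps)

lemma bidiff_of_scaleR: "bidiff_of (c *\<^sub>R A) = (\<lambda>f g. c *\<^sub>R bidiff_of A f g)"
  by (intro ext) (simp add: bidiff_of_linear_simps)

text \<open>Composition with the linear isomorphism \<open>bidiff_of\<close> turns a symbol map into a linear bijection of
  the space of symbols.\<close>

lemma equivariant_symbol_map_iff:
  "equivariant_symbol_map w \<mu> \<sigma> \<longleftrightarrow>
     linear (\<lambda>A. \<sigma> (bidiff_of A)) \<and> bij (\<lambda>A. \<sigma> (bidiff_of A)) \<and>
     (\<forall>A. total_degree (\<sigma> (bidiff_of A)) = total_degree A \<and>
       homogeneous_component (total_degree A) (\<sigma> (bidiff_of A)) = homogeneous_component
           (total_degree A) A) \<and>
     (\<forall>X\<in>sl_fields. \<forall>A. \<sigma> (lie_bidiff w \<mu> X (bidiff_of A)) = lie_symbol (\<mu> - fst w - snd w) X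
         (\<sigma> (bidiff_of A)))"
proof -
  have "bij_betw \<sigma> bidiff_ops UNIV \<longleftrightarrow> bij (\<lambda>A. \<sigma> (bidiff_of A))"
  proof -
    have "bij_betw bidiff_of UNIV bidiff_ops"
      by (auto simp: bij_betw_def bidiff_ops_def inj_def bidiff_of_inject)
    from bij_betw_comp_iff[OF this, of \<sigma> UNIV] show ?thesis by (simp add: o_def)
  qed
  moreover have "(\<forall>S\<in>bidiff_ops. \<forall>T\<in>bidiff_ops. \<sigma> (\<lambda>f g. S f g + T f g) = \<sigma> S + \<sigma> T) \<and>
     (\<forall>c. \<forall>T\<in>bidiff_ops. \<sigma> (\<lambda>f g. c *\<^sub>R T f g) = Poly_Mapping.map ((*\<^sub>R) c) (\<sigma> T)) \<longleftrightarrow>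
     linear (\<lambda>A. \<sigma> (bidiff_of A))"
    unfolding linear_iff bidiff_ops_def bidiff_of_add bidiff_of_scaleR scaleR_poly_mapping_def[symmetric]
    by auto
  ultimately show ?thesis
    unfolding equivariant_symbol_map_def preserves_principal_symbol_def principal_symbol_def total_order_def
    by (auto simp: bidiff_ops_def)
qed

text \<open>The parameter \<open>dim_type\<close> fixes the type that carries the dimension.\<close>

locale nonresonant_weights =
  fixes w :: "real \<times> real" and \<mu> :: real and dim_type :: "'n::finite itself"
  assumes nonresonant: "\<not> resonant CARD('n) (\<mu> - fst w - snd w)"
begin

abbreviation \<delta> :: real where
  "\<delta> \<equiv> \<mu> - fst w - snd w"

sublocale graded_perturbation homogeneous_component
  "symbol_casimir \<delta> :: 'n symbol \<Rightarrow> 'n symbol" "op_casimir w \<mu>" "casimir_poly CARD('n) \<delta>"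
proof (rule graded_perturbation.intro)
  fix i j m :: nat and P :: "'n symbol"
  show "linear (homogeneous_component i :: 'n symbol \<Rightarrow> 'n symbol)" by (rule linear_homogeneous_component)
  show "homogeneous_component i (homogeneous_component j P) = (if i = j then homogeneous_component i P else 0)"
    by (rule homogeneous_component_twice)
  show "\<exists>m. \<forall>i\<ge>m. homogeneous_component i P = 0"
    using in_degree_below degree_below_iff by blast
  show "P = 0" if "\<And>i. homogeneous_component i P = 0"
    using that degree_below_iff[of P 0] by (simp add: degree_below_0)
  show "linear (symbol_casimir \<delta> :: 'n symbol \<Rightarrow> 'n symbol)" by (rule linear_symbol_casimir)
  show "linear (op_casimir w \<mu> :: 'n symbol \<Rightarrow> 'n symbol)" by (rule linear_op_casimir)
  show "homogeneous_component i (symbol_casimir \<delta> P) = symbol_casimir \<delta> (homogeneous_component i P)"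
    by (rule homogeneous_component_commute[OF linear_symbol_casimir symbol_casimir_supported])
  show "homogeneous_component j (op_casimir w \<mu> P - symbol_casimir \<delta> P) = 0"
    if "\<And>i. i > m \<Longrightarrow> homogeneous_component i P = 0" "m \<le> j"
    using op_casimir_minus_symbol_casimir[of P m w \<mu>] that by (auto simp: degree_below_iff)
  show "op_poly (casimir_poly CARD('n) \<delta> i) (symbol_casimir \<delta>) (homogeneous_component i P) = 0"
    by (rule casimir_poly_annihilates[OF homogeneous_component_supported])
  show "comaximal (casimir_poly CARD('n) \<delta> i) (casimir_poly CARD('n) \<delta> j)" if "i \<noteq> j"
    by (rule casimir_poly_comaximal[OF nonresonant that])
qed

lemma filt_eq: "filt m = degree_below m"
  by (auto simp: filt_def degree_below_iff)

lemma lift_gl_equivariant: "op_action w \<mu> a b (lift P) = lift (lie_symbol \<delta> (gl_field a b) P)"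
proof (rule lift_equivariant[OF linear_op_action linear_lie_symbol op_casimir_commutes])
  show "homogeneous_component i (lie_symbol \<delta> (gl_field a b) Q) = lie_symbol \<delta> (gl_field a b) (homogeneous_component i Q)" for i Q
    by (rule homogeneous_component_commute[OF linear_lie_symbol lie_symbol_supported])
  show "op_action w \<mu> a b Q - lie_symbol \<delta> (gl_field a b) Q \<in> filt m" if "Q \<in> filt (Suc m)" for Q m
    using order_lowering_degree_below that by (simp add: op_action_def filt_eq)
qed

lemma lift_sl_equivariant:
  assumes "X \<in> sl_fields"
  shows "lie_bidiff w \<mu> X (bidiff_of (lift P)) = bidiff_of (lift (lie_symbol \<delta> X P))"
proof -
  have "X \<in> span (range (case_prod gl_field))" using assms sl_fields_subset_span_gl by blast
  then have "\<forall>f g. lie_bidiff w \<mu> X (bidiff_of (lift P)) f g = bidiff_of (lift (lie_symbol \<delta> X P)) f g"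
  proof (induction rule: span_induct_alt)
    case base
    show ?case
      using lie_bidiff_field_linear(2)[of w \<mu> 0 "0 :: 'n vector_field" "lift P"]
      by (simp add: linear_0[OF linear_lie_symbol_field] linear_0[OF linear_lift] bidiff_of_linear_simps)
  next
    case (step c X Y)
    then obtain a b where X: "X = gl_field a b" by auto
    show ?case
      using step(2)
      by (simp add: X lie_bidiff_field_linear lie_bidiff_gl_field lift_gl_equivariant linear_add[OF linear_lie_symbol_field]
          linear_scale[OF linear_lie_symbol_field] linear_add[OF linear_lift] linear_scale[OF linear_lift]
          bidiff_of_linear_simps)
  qed
  then show ?thesis by (intro ext) simp
qed

definition symbol_map :: "'n bi_operator \<Rightarrow> 'n symbol" where
  "symbol_map = restrict (\<lambda>T. inv lift (polynomial_form T)) bidiff_ops"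

lemma symbol_map_lift: "symbol_map (bidiff_of (lift P)) = P"
  by (simp add: symbol_map_def bidiff_ops_def inv_f_f[OF inj_lift])

lemma equivariant_symbol_map: "equivariant_symbol_map w \<mu> symbol_map"
  unfolding equivariant_symbol_map_iff
proof (intro conjI ballI allI)
  let ?G = "\<lambda>A. symbol_map (bidiff_of A)"
  have G: "?G (lift P) = P" for P by (rule symbol_map_lift)
  have ex: "\<exists>P. A = lift P" for A using bij_lift by (metis bij_pointE)
  show "linear ?G"
  proof (rule linearI)
    show "?G (A + B) = ?G A + ?G B" for A B
      using ex[of A] ex[of B] G by (metis linear_add[OF linear_lift])
    show "?G (c *\<^sub>R A) = c *\<^sub>R ?G A" for c A
      using ex[of A] G by (metis linear_scale[OF linear_lift])
  qed
  have "?G = inv lift"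
    by (intro ext) (simp add: symbol_map_def bidiff_ops_def)
  then show "bij ?G" by (simp add: bij_imp_bij_inv[OF bij_lift])
  fix A
  obtain P where A: "A = lift P" using ex by blast
  have "A - P \<in> degree_below (total_degree P)"
    using lift_minus_id[of P "total_degree P"] by (simp add: A filt_eq degree_below_total_degree)
  from principal_part_determined[OF this]
  show "total_degree (?G A) = total_degree A"
    "homogeneous_component (total_degree A) (?G A) = homogeneous_component (total_degree A) A"
    by (simp_all add: A G)
next
  fix X :: "'n vector_field" and A
  assume X: "X \<in> sl_fields"
  obtain P where A: "A = lift P" using bij_lift by (metis bij_pointE)
  show "symbol_map (lie_bidiff w \<mu> X (bidiff_of A)) = lie_symbol \<delta> X (symbol_map (bidiff_of A))"
    by (simp add: A lift_sl_equivariant[OF X] symbol_map_lift)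
qed

text \<open>An equivariant symbol map \<open>G\<close> intertwines the two Casimir operators, so the preimage of a
  homogeneous symbol of degree \<open>i\<close> is killed by \<open>casimir_poly\<close> of degree \<open>i\<close> at \<open>op_casimir\<close>. As \<open>G\<close>
  preserves principal symbols, this preimage is the one that \<open>lift\<close> provides.\<close>

lemma equivariant_inverse_lift:
  fixes \<sigma> :: "'n bi_operator \<Rightarrow> 'n symbol"
  assumes "equivariant_symbol_map w \<mu> \<sigma>"
  shows "\<sigma> (bidiff_of (lift P)) = P"
proof -
  define G where "G A = \<sigma> (bidiff_of A)" for A :: "'n symbol"
  have lin: "linear G" and bij: "bij G"
    and deg: "total_degree (G A) = total_degree A"
      "homogeneous_component (total_degree A) (G A) = homogeneous_component (total_degree A) A"
    and act: "G (op_action w \<mu> a b A) = lie_symbol \<delta> (gl_field a b) (G A)" for A a b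
    using assms gl_field_in_sl_fields[where 'a = 'n] unfolding equivariant_symbol_map_iff G_def
    by (auto simp: lie_bidiff_gl_field[symmetric])
  have cas: "G (op_casimir w \<mu> A) = symbol_casimir \<delta> (G A)" for A
    by (simp add: op_casimir_def symbol_casimir_def linear_sum[OF lin] act)
  have homog: "G (lift (homogeneous_component i V)) = homogeneous_component i V" for i V
  proof -
    let ?P = "homogeneous_component i V"
    obtain A where A: "G A = ?P" using bij by (metis bij_pointE)
    have "G (op_poly (casimir_poly CARD('n) \<delta> i) (op_casimir w \<mu>) A) = G 0"
      by (simp add: op_poly_intertwine[OF linear_K linear_C lin cas] A annihilates linear_0[OF lin])
    then have ann: "op_poly (casimir_poly CARD('n) \<delta> i) (op_casimir w \<mu>) A = 0"
      using bij by (meson bij_is_inj injD)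
    have "A - ?P \<in> filt i"
    proof (cases "?P = 0")
      case True
      then have "A = 0" using A bij linear_0[OF lin] by (metis bij_is_inj injD)
      then show ?thesis using True by (simp add: subspace_0[OF subspace_filt])
    next
      case False
      have "total_degree ?P \<le> i"
        using hom_in_filt[of i V] by (simp add: filt_eq degree_below_total_degree)
      moreover have "?P \<notin> degree_below i"
        using False by (auto simp: degree_below_iff homogeneous_component_twice)
      ultimately have "total_degree ?P = i"
        by (cases i) (auto simp: degree_below_total_degree)
      then have "total_degree A = i" "homogeneous_component i A = ?P"
        using deg[of A] by (auto simp: A homogeneous_component_twice)
      then show ?thesis
        using minus_top_in_filt[of A i] by (simp add: filt_eq degree_below_total_degree)
    qed
    from lift_unique[OF ann this] show ?thesis using A by simp
  qed
  have "G (lift P) = P"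
  proof (rule linear_eq_on_singles[where f = "\<lambda>P. G (lift P)" and g = "\<lambda>P. P"])
    show "linear (\<lambda>P. G (lift P))" using linear_compose[OF linear_lift lin] by (simp add: o_def)
    show "G (lift (Poly_Mapping.single k c)) = Poly_Mapping.single k c" for k c
      using homog[of "monomial_degree k" "Poly_Mapping.single k c"] by (simp add: homogeneous_component_single)
  qed (rule linear_id[unfolded id_def])
  then show ?thesis by (simp add: G_def)
qed

lemma equivariant_eq_symbol_map:
  fixes \<sigma> :: "'n bi_operator \<Rightarrow> 'n symbol"
  assumes "equivariant_symbol_map w \<mu> \<sigma>" "T \<in> bidiff_ops"
  shows "\<sigma> T = symbol_map T"
proof -
  obtain A where "T = bidiff_of A" using assms(2) by (auto simp: bidiff_ops_def)
  moreover obtain P where "A = lift P" using bij_lift by (metis bij_pointE)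
  ultimately show ?thesis
    by (simp add: equivariant_inverse_lift[OF assms(1)] symbol_map_lift)
qed

lemma diffop_unlift: "symbol_diffop F \<Longrightarrow> symbol_diffop (\<lambda>P. unlift m (F P))"
proof (induction m arbitrary: F)
  case 0
  then show ?case by (simp add: diffop_zero)
next
  case (Suc m)
  have "symbol_diffop (\<lambda>P. F P - lift_at m (homogeneous_component m (F P)))"
    by (intro diffop_diff diffop_op_poly diffop_generators(7) Suc.prems)
  from symbol_diffop.add[OF diffop_generators(7)[OF Suc.prems] Suc.IH[OF this]]
  show ?case by simp
qed

lemma equivariant_is_differential:
  fixes \<sigma> :: "'n bi_operator \<Rightarrow> 'n symbol"
  assumes "equivariant_symbol_map w \<mu> \<sigma>"
  shows "is_differential \<sigma>"
  unfolding is_differential_def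
proof
  fix r
  obtain C where C: "\<And>P. P \<in> degree_below (Suc r) \<Longrightarrow> unlift (Suc r) P = diffop_of C P"
    using symbol_diffop_representation[OF diffop_unlift[OF symbol_diffop.ident]] by blast
  have "\<sigma> T = diffop_of C (polynomial_form T)" if T: "T \<in> bidiff_ops" "total_order T \<le> r" for T
  proof -
    obtain A where A: "T = bidiff_of A" using T(1) by (auto simp: bidiff_ops_def)
    then have deg: "A \<in> degree_below (Suc r)"
      using T(2) by (simp add: total_order_def degree_below_total_degree)
    then have "\<sigma> T = \<sigma> (bidiff_of (lift (unlift (Suc r) A)))"
      by (simp only: A lift_unlift filt_eq)
    also have "\<dots> = unlift (Suc r) A" by (rule equivariant_inverse_lift[OF assms])
    finally show ?thesis by (simp only: C[OF deg] A polynomial_form_bidiff_of)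
  qed
  then show "\<exists>C. \<forall>T\<in>bidiff_ops. total_order T \<le> r \<longrightarrow>
      \<sigma> T = (\<Sum>(l, k, c)\<in>Poly_Mapping.keys C. Poly_Mapping.single l
        (Poly_Mapping.lookup C (l, k, c) * multi_deriv c (Poly_Mapping.lookup (polynomial_form T) k)))"
    unfolding diffop_of_def by blast
qed

end

theorem theorem5:
  fixes w :: "real \<times> real" and \<mu> :: real
  assumes "CARD('n::finite) \<ge> 2"
    and "\<not> resonant CARD('n) (\<mu> - fst w - snd w)"
  shows "(\<exists>!\<sigma> :: 'n bi_operator \<Rightarrow> 'n symbol.
            \<sigma> \<in> extensional bidiff_ops \<and> equivariant_symbol_map w \<mu> \<sigma>)
         \<and> (\<forall>\<sigma> :: 'n bi_operator \<Rightarrow> 'n symbol.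
              equivariant_symbol_map w \<mu> \<sigma> \<longrightarrow> is_differential \<sigma>)"
proof -
  interpret nonresonant_weights w \<mu> "TYPE('n)" by standard (rule assms(2))
  have "symbol_map \<in> extensional bidiff_ops" by (simp add: symbol_map_def)
  then show ?thesis
    using equivariant_symbol_map equivariant_eq_symbol_map equivariant_is_differential
    by (intro conjI ex1I[of _ symbol_map] allI impI) (auto intro: extensionalityI)
qed

end
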